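(* Let $P$ be a finite poset equipped with a sheaf $F$, and let $P=\bigcup_{\alpha\in K}P_\alpha$ be a covering of $P$ by upper convex subposets, indexed by a finite set $K$. For nonempty $X\subseteq K$ put $P_X=\bigcap_{\alpha\in X}P_\alpha$, and let the nerve $N$ be the subposet of the Boolean lattice of subsets of $K$ (ordered by inclusion) consisting of those nonempty $X$ with $P_X\ne\varnothing$. For each $q\ge0$ let $\mathcal{H}_q$ be the sheaf on $N$ with $\mathcal{H}_q(X)=\mathrm{HS}_q(P_X;F)$ and, for $X\subseteq Y$, structure map $\mathrm{HS}_q(P_Y;F)\to\mathrm{HS}_q(P_X;F)$ induced by the inclusion $P_Y\hookrightarrow P_X$. Then there is a spectral sequence $$E^2_{p,q}=\mathrm{HS}_p(N;\mathcal{H}_q)\Rightarrow\mathrm{HS}_{p+q}(P;F).$$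
   Context: A subset $K'\subseteq P$ is upper convex if $x\in K'$ and $x\le y$ imply $y\in K'$. A sheaf $F$ on a poset assigns an $R$-module $F(x)$ ($R$ commutative with $1$) to each element and a homomorphism $F^y_x:F(y)\to F(x)$ to each $x\le y$, functorially (contravariant functor); it restricts to subposets. Sheaf homology $\mathrm{HS}_*(Q;G)$ of a finite poset $Q$ with sheaf $G$: the left derived functors of the colimit functor evaluated at $G$, computed as the homology of $S_n(Q;G)=\bigoplus_\sigma G(x_0)$ over chains $\sigma=(x_n\le\cdots\le x_0)$ in $Q$, with $d(s_\sigma)=G^{x_0}_{x_1}(s)_{d_0\sigma}+\sum_{i=1}^n(-1)^is_{d_i\sigma}$, where $s_\sigma$ is $s\in G(x_0)$ in the summand indexed by $\sigma$ and $d_i\sigma$ omits $x_i$. *)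

theory Defs
  imports "HOL-Algebra.Module" "HOL-Algebra.AbelCoset"
begin

definition lin_maps :: "'r ring \<Rightarrow> ('r,'a) module \<Rightarrow> ('r,'b) module \<Rightarrow> ('a \<Rightarrow> 'b) set" where
  "lin_maps R M N = {f. f \<in> carrier M \<rightarrow> carrier N
      \<and> (\<forall>x\<in>carrier M. \<forall>y\<in>carrier M. f (x \<oplus>\<^bsub>M\<^esub> y) = f x \<oplus>\<^bsub>N\<^esub> f y)
      \<and> (\<forall>a\<in>carrier R. \<forall>x\<in>carrier M. f (a \<odot>\<^bsub>M\<^esub> x) = a \<odot>\<^bsub>N\<^esub> f x)}"

definition mod_iso :: "'r ring \<Rightarrow> ('r,'a) module \<Rightarrow> ('r,'b) module \<Rightarrow> bool" where
  "mod_iso R M N \<longleftrightarrow> (\<exists>f\<in>lin_maps R M N. bij_betw f (carrier M) (carrier N))"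

definition quot_mod :: "('r,'a) module \<Rightarrow> 'a set \<Rightarrow> 'a set \<Rightarrow> ('r,'a set) module" where
  "quot_mod M A B = \<lparr>carrier = (\<lambda>a. B +>\<^bsub>M\<^esub> a) ` A,
     monoid.mult = (\<lambda>C D. undefined), one = undefined,
     zero = B,
     add = (\<lambda>C D. C <+>\<^bsub>M\<^esub> D),
     smult = (\<lambda>r C. B <+>\<^bsub>M\<^esub> ((\<lambda>c. r \<odot>\<^bsub>M\<^esub> c) ` C))\<rparr>"

text \<open>A poset is a subset Q of a type with a partial order (induced order).
  A sheaf assigns a module G x to each x in Q and a linear map rho y x : G y \<rightarrow> G x
  to each x \<le> y, contravariantly functorially.\<close>
definition is_sheaf :: "'r ring \<Rightarrow> 'a::order set \<Rightarrow> ('a \<Rightarrow> ('r,'m) module) \<Rightarrow> ('a \<Rightarrow> 'a \<Rightarrow> 'm \<Rightarrow> 'm) \<Rightarrow> bool" where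
  "is_sheaf R Q G rho \<longleftrightarrow>
     (\<forall>x\<in>Q. module R (G x))
   \<and> (\<forall>x\<in>Q. \<forall>y\<in>Q. x \<le> y \<longrightarrow> rho y x \<in> lin_maps R (G y) (G x))
   \<and> (\<forall>x\<in>Q. \<forall>s\<in>carrier (G x). rho x x s = s)
   \<and> (\<forall>x\<in>Q. \<forall>y\<in>Q. \<forall>z\<in>Q. x \<le> y \<longrightarrow> y \<le> z \<longrightarrow>
        (\<forall>s\<in>carrier (G z). rho y x (rho z y s) = rho z x s))"

definition upper_convex :: "'a::order set \<Rightarrow> 'a set \<Rightarrow> bool" where
  "upper_convex P S \<longleftrightarrow> S \<subseteq> P \<and> (\<forall>x\<in>S. \<forall>y\<in>P. x \<le> y \<longrightarrow> y \<in> S)"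

text \<open>n-chains x_n \<le> ... \<le> x_0 in Q, represented as the list [x_0, x_1, ..., x_n].\<close>
definition chains :: "'a::order set \<Rightarrow> nat \<Rightarrow> 'a list set" where
  "chains Q n = {\<sigma>. length \<sigma> = Suc n \<and> set \<sigma> \<subseteq> Q \<and> (\<forall>i<n. \<sigma> ! (Suc i) \<le> \<sigma> ! i)}"

definition face :: "nat \<Rightarrow> 'a list \<Rightarrow> 'a list" where
  "face i \<sigma> = take i \<sigma> @ drop (Suc i) \<sigma>"

text \<open>S_n(Q;G) = direct sum over n-chains \<sigma> of G(x_0).\<close>
definition chain_mod :: "'a::order set \<Rightarrow> ('a \<Rightarrow> ('r,'m) module) \<Rightarrow> nat \<Rightarrow> ('r, 'a list \<Rightarrow> 'm) module" where
  "chain_mod Q G n = \<lparr>carrier = {s. (\<forall>\<sigma>\<in>chains Q n. s \<sigma> \<in> carrier (G (hd \<sigma>)))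
                                   \<and> (\<forall>\<sigma>. \<sigma> \<notin> chains Q n \<longrightarrow> s \<sigma> = undefined)},
     monoid.mult = (\<lambda>s t. undefined), one = undefined,
     zero = (\<lambda>\<sigma>. if \<sigma> \<in> chains Q n then \<zero>\<^bsub>G (hd \<sigma>)\<^esub> else undefined),
     add = (\<lambda>s t \<sigma>. if \<sigma> \<in> chains Q n then s \<sigma> \<oplus>\<^bsub>G (hd \<sigma>)\<^esub> t \<sigma> else undefined),
     smult = (\<lambda>a s \<sigma>. if \<sigma> \<in> chains Q n then a \<odot>\<^bsub>G (hd \<sigma>)\<^esub> s \<sigma> else undefined)\<rparr>"

definition gen :: "'a::order set \<Rightarrow> ('a \<Rightarrow> ('r,'m) module) \<Rightarrow> nat \<Rightarrow> 'a list \<Rightarrow> 'm \<Rightarrow> 'a list \<Rightarrow> 'm" where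
  "gen Q G n \<sigma> m = (\<lambda>\<tau>. if \<tau> \<in> chains Q n then (if \<tau> = \<sigma> then m else \<zero>\<^bsub>G (hd \<tau>)\<^esub>) else undefined)"

definition bdry :: "'a::order set \<Rightarrow> ('a \<Rightarrow> ('r,'m) module) \<Rightarrow> ('a \<Rightarrow> 'a \<Rightarrow> 'm \<Rightarrow> 'm) \<Rightarrow> nat
                    \<Rightarrow> ('a list \<Rightarrow> 'm) \<Rightarrow> ('a list \<Rightarrow> 'm)" where
  "bdry Q G rho n s = finsum (chain_mod Q G n)
     (\<lambda>\<sigma>. gen Q G n (face 0 \<sigma>) (rho (\<sigma> ! 0) (\<sigma> ! 1) (s \<sigma>))
          \<oplus>\<^bsub>chain_mod Q G n\<^esub>
          finsum (chain_mod Q G n)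
            (\<lambda>i. if even i then gen Q G n (face i \<sigma>) (s \<sigma>)
                 else \<ominus>\<^bsub>chain_mod Q G n\<^esub> gen Q G n (face i \<sigma>) (s \<sigma>))
            {1..Suc n})
     (chains Q (Suc n))"

definition cycles :: "'a::order set \<Rightarrow> ('a \<Rightarrow> ('r,'m) module) \<Rightarrow> ('a \<Rightarrow> 'a \<Rightarrow> 'm \<Rightarrow> 'm) \<Rightarrow> nat \<Rightarrow> ('a list \<Rightarrow> 'm) set" where
  "cycles Q G rho n = (if n = 0 then carrier (chain_mod Q G 0)
     else {s \<in> carrier (chain_mod Q G n). bdry Q G rho (n - 1) s = \<zero>\<^bsub>chain_mod Q G (n - 1)\<^esub>})"

definition boundaries :: "'a::order set \<Rightarrow> ('a \<Rightarrow> ('r,'m) module) \<Rightarrow> ('a \<Rightarrow> 'a \<Rightarrow> 'm \<Rightarrow> 'm) \<Rightarrow> nat \<Rightarrow> ('a list \<Rightarrow> 'm) set" where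
  "boundaries Q G rho n = bdry Q G rho n ` carrier (chain_mod Q G (Suc n))"

definition HS :: "'a::order set \<Rightarrow> ('a \<Rightarrow> ('r,'m) module) \<Rightarrow> ('a \<Rightarrow> 'a \<Rightarrow> 'm \<Rightarrow> 'm) \<Rightarrow> nat
                  \<Rightarrow> ('r, ('a list \<Rightarrow> 'm) set) module" where
  "HS Q G rho n = quot_mod (chain_mod Q G n) (cycles Q G rho n) (boundaries Q G rho n)"

definition ext_chain :: "'a::order set \<Rightarrow> 'a set \<Rightarrow> ('a \<Rightarrow> ('r,'m) module) \<Rightarrow> nat
                         \<Rightarrow> ('a list \<Rightarrow> 'm) \<Rightarrow> ('a list \<Rightarrow> 'm)" where
  "ext_chain Q' Q G n s = (\<lambda>\<tau>. if \<tau> \<in> chains Q' n then s \<tau>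
                              else if \<tau> \<in> chains Q n then \<zero>\<^bsub>G (hd \<tau>)\<^esub> else undefined)"

definition HS_map :: "'a::order set \<Rightarrow> 'a set \<Rightarrow> ('a \<Rightarrow> ('r,'m) module) \<Rightarrow> ('a \<Rightarrow> 'a \<Rightarrow> 'm \<Rightarrow> 'm) \<Rightarrow> nat
                      \<Rightarrow> ('a list \<Rightarrow> 'm) set \<Rightarrow> ('a list \<Rightarrow> 'm) set" where
  "HS_map Q' Q G rho n C = boundaries Q G rho n <+>\<^bsub>chain_mod Q G n\<^esub> (ext_chain Q' Q G n ` C)"

definition PX :: "('k \<Rightarrow> 'a set) \<Rightarrow> 'k set \<Rightarrow> 'a set" where
  "PX Pa X = (\<Inter>\<alpha>\<in>X. Pa \<alpha>)"

definition nerve :: "'k set \<Rightarrow> ('k \<Rightarrow> 'a set) \<Rightarrow> 'k set set" where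
  "nerve K Pa = {X. X \<subseteq> K \<and> X \<noteq> {} \<and> PX Pa X \<noteq> {}}"

definition Hsheaf :: "('k \<Rightarrow> 'a::order set) \<Rightarrow> ('a \<Rightarrow> ('r,'m) module) \<Rightarrow> ('a \<Rightarrow> 'a \<Rightarrow> 'm \<Rightarrow> 'm) \<Rightarrow> nat
                      \<Rightarrow> 'k set \<Rightarrow> ('r, ('a list \<Rightarrow> 'm) set) module" where
  "Hsheaf Pa F rho q X = HS (PX Pa X) F rho q"

definition Hsheaf_map :: "('k \<Rightarrow> 'a::order set) \<Rightarrow> ('a \<Rightarrow> ('r,'m) module) \<Rightarrow> ('a \<Rightarrow> 'a \<Rightarrow> 'm \<Rightarrow> 'm) \<Rightarrow> nat
                      \<Rightarrow> 'k set \<Rightarrow> 'k set \<Rightarrow> ('a list \<Rightarrow> 'm) set \<Rightarrow> ('a list \<Rightarrow> 'm) set" where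
  "Hsheaf_map Pa F rho q Y X = HS_map (PX Pa Y) (PX Pa X) F rho q"

definition ss_pages :: "'r ring \<Rightarrow> (nat \<Rightarrow> int \<Rightarrow> int \<Rightarrow> ('r,'e) module) \<Rightarrow> (nat \<Rightarrow> int \<Rightarrow> int \<Rightarrow> 'e \<Rightarrow> 'e) \<Rightarrow> bool" where
  "ss_pages R E d \<longleftrightarrow> (\<forall>r\<ge>2. \<forall>p q.
      module R (E r p q)
    \<and> d r p q \<in> lin_maps R (E r p q) (E r (p - int r) (q + int r - 1))
    \<and> (\<forall>x\<in>carrier (E r p q). d r (p - int r) (q + int r - 1) (d r p q x)
                              = \<zero>\<^bsub>E r (p - 2 * int r) (q + 2 * int r - 2)\<^esub>)
    \<and> mod_iso R (E (Suc r) p q)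
        (quot_mod (E r p q) {x \<in> carrier (E r p q). d r p q x = \<zero>\<^bsub>E r (p - int r) (q + int r - 1)\<^esub>}
                  (d r (p + int r) (q - int r + 1) ` carrier (E r (p + int r) (q - int r + 1)))))"

text \<open>E^\<infinity>_{p,q}: for a first quadrant spectral sequence the page stabilises once r > p and r > q+1.\<close>
definition E_inf :: "(nat \<Rightarrow> int \<Rightarrow> int \<Rightarrow> ('r,'e) module) \<Rightarrow> int \<Rightarrow> int \<Rightarrow> ('r,'e) module" where
  "E_inf E p q = E (nat (max (p + 1) (q + 2))) p q"

definition converging_ss :: "'r ring \<Rightarrow> (nat \<Rightarrow> int \<Rightarrow> int \<Rightarrow> ('r,'e) module) \<Rightarrow> (nat \<Rightarrow> int \<Rightarrow> int \<Rightarrow> 'e \<Rightarrow> 'e)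
                             \<Rightarrow> (nat \<Rightarrow> nat \<Rightarrow> ('r,'g) module) \<Rightarrow> (nat \<Rightarrow> ('r,'h) module) \<Rightarrow> bool" where
  "converging_ss R E d E2 H \<longleftrightarrow>
     ss_pages R E d
   \<and> (\<forall>p q. (0 \<le> p \<and> 0 \<le> q \<longrightarrow> mod_iso R (E 2 p q) (E2 (nat p) (nat q)))
          \<and> (\<not> (0 \<le> p \<and> 0 \<le> q) \<longrightarrow> carrier (E 2 p q) = {\<zero>\<^bsub>E 2 p q\<^esub>}))
   \<and> (\<forall>n. \<exists>\<Phi> :: int \<Rightarrow> 'h set.
          \<Phi> (-1) = {\<zero>\<^bsub>H n\<^esub>} \<and> \<Phi> (int n) = carrier (H n)
        \<and> (\<forall>p. 0 \<le> p \<and> p \<le> int n \<longrightarrow>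
              submodule (\<Phi> p) R (H n) \<and> \<Phi> (p - 1) \<subseteq> \<Phi> p
            \<and> mod_iso R (quot_mod (H n) (\<Phi> p) (\<Phi> (p - 1))) (E_inf E p (int n - p))))"

end

theory Submission
  imports Defs
begin

text \<open>The chains \<open>S\<^sub>q(P\<^sub>X)\<close> over the chains of the nerve form a double complex
  \<open>D\<^sub>p\<^sub>q = S\<^sub>p(N; X \<mapsto> S\<^sub>q(P\<^sub>X; F))\<close>.  Filtering its total complex by \<open>p\<close> gives the second page
  \<open>HS\<^sub>p(N; H\<^sub>q)\<close>.  Split along a fixed chain \<open>\<sigma>\<close> of \<open>P\<close>, the row of index \<open>q\<close> is the chain complex of
  the poset of all nonempty sets of indices \<open>\<alpha>\<close> with \<open>\<sigma>\<close> contained in \<open>P\<^sub>\<alpha>\<close>.  This poset is nonempty because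
  \<open>P\<^sub>\<alpha>\<close> is upper convex and so contains \<open>\<sigma>\<close> as soon as it contains the least element of \<open>\<sigma>\<close>, and it has
  a greatest element, hence it is contractible.  So the rows resolve \<open>S\<^sub>q(P; F)\<close> and the total complex computes
  \<open>HS(P; F)\<close>.

  The page \<open>E\<^sup>r\<^sub>p\<^sub>q\<close> is realised as a subquotient of \<open>D\<^sub>p\<^sub>q\<close> itself: leading terms of the elements of
  filtration \<open>p\<close> whose boundary has filtration \<open>p - r\<close>, modulo leading terms of the boundaries of elements of
  filtration \<open>p + r - 1\<close>.\<close>

section \<open>Linear maps and subquotients\<close>

text \<open>The predicate \<open>ss_pages\<close> gives all pages one element type and compares
  consecutive pages only up to isomorphism. Leading terms suit this: every page consists of cosets
  in the same module \<open>D p q\<close>, whereas iterated homology would change the type at each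
  step. A leading term has many extensions to the total complex, so differentials and isomorphisms
  are induced by additive relations.

  The contraction of a row cannot come from maps of the coefficient modules \<open>Gq q X\<close> as
  a whole: the greatest index set \<open>Kc \<sigma>\<close> depends on \<sigma>, so elements are
  split along \<sigma> before being coned. It does not commute with the vertical differential in
  general, because a face of \<sigma> may lie in more of the sets of the covering. Exactness is
  therefore used one row at a time, in the column by column correction \<open>fill\<close>.

  On the second page, cosets of chains have to be matched with chains of cosets. The sheaf
  \<open>Zq q\<close> of vertical cycles mediates: it sits inside \<open>Gq q\<close> and maps onto
  the homology sheaf.\<close>

lemma (in abelian_group) a_inv_zero [simp]: "\<ominus> \<zero> = \<zero>"
  by (metis l_zero r_neg zero_closed a_inv_closed)

lemma (in abelian_group) minus_zero_right: "x \<in> carrier G \<Longrightarrow> x \<ominus> \<zero> = x"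
  by (simp add: a_minus_def)

lemma (in abelian_group) minus_eq_zero_iff: "x \<in> carrier G \<Longrightarrow> y \<in> carrier G \<Longrightarrow> x \<ominus> y = \<zero> \<longleftrightarrow> x = y"
  by (metis a_minus_def minus_equality minus_minus a_inv_closed r_neg)

lemma (in abelian_group) minus_plus_cancel:
  assumes "x \<in> carrier G" "y \<in> carrier G" shows "(x \<ominus> y) \<oplus> y = x"
  using assms by (simp add: a_minus_def a_assoc l_neg)

lemma (in abelian_group) minus_minus_cancel:
  assumes "x \<in> carrier G" "y \<in> carrier G" shows "x \<ominus> y \<ominus> x = \<ominus> y"
proof -
  have "x \<ominus> y \<ominus> x = \<ominus> y \<oplus> (x \<oplus> \<ominus> x)"
    using assms by (simp add: a_minus_def a_ac del: r_neg l_neg)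
  then show ?thesis using assms by (simp add: r_neg)
qed

lemma lin_mapsI:
  assumes "\<And>x. x \<in> carrier M \<Longrightarrow> f x \<in> carrier N"
    and "\<And>x y. x \<in> carrier M \<Longrightarrow> y \<in> carrier M \<Longrightarrow> f (x \<oplus>\<^bsub>M\<^esub> y) = f x \<oplus>\<^bsub>N\<^esub> f y"
    and "\<And>a x. a \<in> carrier R \<Longrightarrow> x \<in> carrier M \<Longrightarrow> f (a \<odot>\<^bsub>M\<^esub> x) = a \<odot>\<^bsub>N\<^esub> f x"
  shows "f \<in> lin_maps R M N"
  using assms by (auto simp: lin_maps_def)

lemma lin_maps_closed: "f \<in> lin_maps R M N \<Longrightarrow> x \<in> carrier M \<Longrightarrow> f x \<in> carrier N"
  and lin_maps_add: "f \<in> lin_maps R M N \<Longrightarrow> x \<in> carrier M \<Longrightarrow> y \<in> carrier M \<Longrightarrow> f (x \<oplus>\<^bsub>M\<^esub> y) = f x \<oplus>\<^bsub>N\<^esub> f y"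
  and lin_maps_smult: "f \<in> lin_maps R M N \<Longrightarrow> a \<in> carrier R \<Longrightarrow> x \<in> carrier M \<Longrightarrow> f (a \<odot>\<^bsub>M\<^esub> x) = a \<odot>\<^bsub>N\<^esub> f x"
  by (auto simp: lin_maps_def)

lemma lin_maps_zero:
  assumes "f \<in> lin_maps R M N" "module R M" "module R N"
  shows "f \<zero>\<^bsub>M\<^esub> = \<zero>\<^bsub>N\<^esub>"
proof -
  interpret M: module R M by fact
  interpret N: module R N by fact
  have c: "f \<zero>\<^bsub>M\<^esub> \<in> carrier N" by (rule lin_maps_closed[OF assms(1) M.M.zero_closed])
  have "f \<zero>\<^bsub>M\<^esub> = f (\<zero>\<^bsub>R\<^esub> \<odot>\<^bsub>M\<^esub> \<zero>\<^bsub>M\<^esub>)" by simp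
  also have "\<dots> = \<zero>\<^bsub>R\<^esub> \<odot>\<^bsub>N\<^esub> f \<zero>\<^bsub>M\<^esub>" by (rule lin_maps_smult[OF assms(1)]) auto
  also have "\<dots> = \<zero>\<^bsub>N\<^esub>" using c by simp
  finally show ?thesis .
qed

text \<open>Linear maps and submodules are specified by sums and scalar multiples only;
  multiplication by minus one is how negatives are handled.\<close>

lemma uminus_eq_smult:
  assumes "module R M" "x \<in> carrier M"
  shows "\<ominus>\<^bsub>M\<^esub> x = (\<ominus>\<^bsub>R\<^esub> \<one>\<^bsub>R\<^esub>) \<odot>\<^bsub>M\<^esub> x"
proof -
  interpret M: module R M by fact
  show ?thesis using assms(2) by (simp add: M.smult_l_minus)
qed

lemma lin_maps_uminus:
  assumes "f \<in> lin_maps R M N" "module R M" "module R N" "x \<in> carrier M"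
  shows "f (\<ominus>\<^bsub>M\<^esub> x) = \<ominus>\<^bsub>N\<^esub> f x"
proof -
  interpret M: module R M by fact
  show ?thesis using assms
    by (simp add: uminus_eq_smult[where R=R] lin_maps_smult lin_maps_closed)
qed

lemma lin_maps_minus:
  assumes "f \<in> lin_maps R M N" "module R M" "module R N" "x \<in> carrier M" "y \<in> carrier M"
  shows "f (x \<ominus>\<^bsub>M\<^esub> y) = f x \<ominus>\<^bsub>N\<^esub> f y"
proof -
  interpret M: module R M by fact
  interpret N: module R N by fact
  show ?thesis using assms
    by (simp add: a_minus_def lin_maps_add lin_maps_uminus lin_maps_closed)
qed

lemma lin_maps_finsum:
  assumes "f \<in> lin_maps R M N" "module R M" "module R N" "\<And>i. i \<in> A \<Longrightarrow> g i \<in> carrier M"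
  shows "f (finsum M g A) = finsum N (\<lambda>i. f (g i)) A"
proof -
  interpret M: module R M by fact
  interpret N: module R N by fact
  show ?thesis
  proof (cases "finite A")
    case True
    then show ?thesis using assms(4)
    proof (induction A rule: finite_induct)
      case empty
      then show ?case using lin_maps_zero[OF assms(1-3)] by simp
    next
      case (insert a A)
      then show ?case using lin_maps_closed[OF assms(1)]
        by (simp add: M.finsum_insert N.finsum_insert Pi_def lin_maps_add[OF assms(1)])
    qed
  next
    case False
    then show ?thesis using lin_maps_zero[OF assms(1-3)] by (simp add: M.finsum_infinite N.finsum_infinite)
  qed
qed

lemma lin_maps_comp:
  assumes "f \<in> lin_maps R M N" "g \<in> lin_maps R N L"
  shows "(\<lambda>x. g (f x)) \<in> lin_maps R M L"
  using assms by (auto simp: lin_maps_def Pi_def)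

lemma lin_maps_id: "(\<lambda>x. x) \<in> lin_maps R M M"
  by (auto simp: lin_maps_def)

lemma lin_maps_zero_map:
  assumes "module R N" shows "(\<lambda>x. \<zero>\<^bsub>N\<^esub>) \<in> lin_maps R M N"
proof -
  interpret N: module R N by fact
  show ?thesis by (auto intro!: lin_mapsI)
qed

lemma lin_maps_plus:
  assumes "f \<in> lin_maps R M N" "g \<in> lin_maps R M N" "module R N"
  shows "(\<lambda>x. f x \<oplus>\<^bsub>N\<^esub> g x) \<in> lin_maps R M N"
proof -
  interpret N: module R N by fact
  show ?thesis
    using assms
    by (intro lin_mapsI)
       (simp_all add: lin_maps_add lin_maps_smult lin_maps_closed N.smult_r_distr N.add.m_ac)
qed

lemma lin_maps_neg:
  assumes "f \<in> lin_maps R M N" "module R N"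
  shows "(\<lambda>x. \<ominus>\<^bsub>N\<^esub> f x) \<in> lin_maps R M N"
proof -
  interpret N: module R N by fact
  show ?thesis
    using assms
    by (intro lin_mapsI)
       (simp_all add: lin_maps_add lin_maps_smult lin_maps_closed N.minus_add N.smult_r_minus N.a_comm)
qed

lemma lin_maps_sum:
  assumes "\<And>i. i \<in> A \<Longrightarrow> f i \<in> lin_maps R M N" "module R M" "module R N"
  shows "(\<lambda>x. finsum N (\<lambda>i. f i x) A) \<in> lin_maps R M N"
proof -
  interpret M: module R M by fact
  interpret N: module R N by fact
  have c: "\<And>i x. i \<in> A \<Longrightarrow> x \<in> carrier M \<Longrightarrow> f i x \<in> carrier N"
    by (rule lin_maps_closed[OF assms(1)])
  show ?thesis
  proof (cases "finite A")
    case True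
    then show ?thesis using assms(1)
    proof (induction A rule: finite_induct)
      case empty
      then show ?case using lin_maps_zero_map[OF assms(3)] by simp
    next
      case (insert a A)
      have *: "(\<lambda>x. f a x \<oplus>\<^bsub>N\<^esub> finsum N (\<lambda>i. f i x) A) \<in> lin_maps R M N"
        using insert by (intro lin_maps_plus) (auto simp: assms(3))
      have e: "finsum N (\<lambda>i. f i x) (insert a A) = f a x \<oplus>\<^bsub>N\<^esub> finsum N (\<lambda>i. f i x) A"
        if "x \<in> carrier M" for x
        by (rule N.finsum_insert) (use insert lin_maps_closed[OF insert.prems that] in auto)
      show ?case
        by (rule lin_mapsI)
           (simp_all add: e lin_maps_closed[OF *] lin_maps_add[OF *] lin_maps_smult[OF *])
    qed
  next
    case False
    then show ?thesis using lin_maps_zero_map[OF assms(3)] by (simp add: N.finsum_infinite)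
  qed
qed

lemma submoduleI':
  assumes "module R M" "H \<subseteq> carrier M" "\<zero>\<^bsub>M\<^esub> \<in> H"
    "\<And>a b. a \<in> H \<Longrightarrow> b \<in> H \<Longrightarrow> a \<oplus>\<^bsub>M\<^esub> b \<in> H"
    "\<And>a x. a \<in> carrier R \<Longrightarrow> x \<in> H \<Longrightarrow> a \<odot>\<^bsub>M\<^esub> x \<in> H"
  shows "submodule H R M"
proof -
  interpret M: module R M by fact
  show ?thesis using assms
    by (intro M.submoduleI) (auto simp: uminus_eq_smult[OF assms(1)] subset_iff)
qed

lemma submoduleD:
  assumes "submodule H R M" "module R M"
  shows submodule_subset: "H \<subseteq> carrier M" and submodule_zero: "\<zero>\<^bsub>M\<^esub> \<in> H"
    and submodule_add: "\<And>a b. a \<in> H \<Longrightarrow> b \<in> H \<Longrightarrow> a \<oplus>\<^bsub>M\<^esub> b \<in> H"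
    and submodule_smult: "\<And>a x. a \<in> carrier R \<Longrightarrow> x \<in> H \<Longrightarrow> a \<odot>\<^bsub>M\<^esub> x \<in> H"
    and submodule_uminus: "\<And>a. a \<in> H \<Longrightarrow> \<ominus>\<^bsub>M\<^esub> a \<in> H"
    and submodule_minus: "\<And>a b. a \<in> H \<Longrightarrow> b \<in> H \<Longrightarrow> a \<ominus>\<^bsub>M\<^esub> b \<in> H"
proof -
  interpret M: module R M by fact
  interpret submodule H R M by fact
  show "H \<subseteq> carrier M" "\<zero>\<^bsub>M\<^esub> \<in> H" using M.submoduleE[OF assms(1)] one_closed by auto
  show a: "\<And>a b. a \<in> H \<Longrightarrow> b \<in> H \<Longrightarrow> a \<oplus>\<^bsub>M\<^esub> b \<in> H"
    and "\<And>a x. a \<in> carrier R \<Longrightarrow> x \<in> H \<Longrightarrow> a \<odot>\<^bsub>M\<^esub> x \<in> H"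
    and b: "\<And>a. a \<in> H \<Longrightarrow> \<ominus>\<^bsub>M\<^esub> a \<in> H"
    using M.submoduleE[OF assms(1)] by auto
  show "\<And>a b. a \<in> H \<Longrightarrow> b \<in> H \<Longrightarrow> a \<ominus>\<^bsub>M\<^esub> b \<in> H" using a b by (simp add: a_minus_def)
qed

lemma submodule_image:
  assumes "f \<in> lin_maps R M N" "module R M" "module R N" "submodule H R M"
  shows "submodule (f ` H) R N"
proof (rule submoduleI')
  interpret M: module R M by fact
  note H = submoduleD[OF assms(4,2)]
  have s: "x \<in> carrier M" if "x \<in> H" for x using that H(1) by blast
  show "f ` H \<subseteq> carrier N" using H(1) lin_maps_closed[OF assms(1)] by blast
  show "\<zero>\<^bsub>N\<^esub> \<in> f ` H" using lin_maps_zero[OF assms(1-3)] H(2) by (metis imageI)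
  fix a b assume "a \<in> f ` H" "b \<in> f ` H"
  then show "a \<oplus>\<^bsub>N\<^esub> b \<in> f ` H" using H(3) s
    by (auto simp: lin_maps_add[OF assms(1), symmetric])
next
  note H = submoduleD[OF assms(4,2)]
  fix a x assume "a \<in> carrier R" "x \<in> f ` H"
  then show "a \<odot>\<^bsub>N\<^esub> x \<in> f ` H" using H(1,4)
    by (auto simp: lin_maps_smult[OF assms(1), symmetric] subset_iff)
qed fact

lemma submodule_preimage:
  assumes "f \<in> lin_maps R M N" "module R M" "module R N" "submodule H R M" "submodule H' R N"
  shows "submodule {x \<in> H. f x \<in> H'} R M"
proof -
  interpret M: module R M by fact
  note H = submoduleD[OF assms(4,2)]
  note H' = submoduleD[OF assms(5,3)]
  have s: "x \<in> carrier M" if "x \<in> H" for x using that H(1) by blast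
  show ?thesis
    by (rule submoduleI'[OF assms(2)])
      (use s H H' in \<open>auto simp: lin_maps_zero[OF assms(1-3)] lin_maps_add[OF assms(1)] lin_maps_smult[OF assms(1)]\<close>)
qed

lemma submodule_zero_set:
  assumes "module R M" shows "submodule {\<zero>\<^bsub>M\<^esub>} R M"
proof -
  interpret M: module R M by fact
  show ?thesis by (rule submoduleI'[OF assms]) auto
qed

text \<open>Homology modules and pages alike are quotients A / B inside one ambient module, whose
  operations on representatives compute everything.\<close>

locale subquot =
  fixes R :: "'r ring" and M :: "('r,'a) module" and A B :: "'a set"
  assumes mod: "module R M" and subA: "submodule A R M" and subB: "submodule B R M" and BA: "B \<subseteq> A"
begin

sublocale M: module R M by (rule mod)

lemmas A = submoduleD[OF subA mod]
lemmas B = submoduleD[OF subB mod]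

lemma A_carrier: "x \<in> A \<Longrightarrow> x \<in> carrier M" using A(1) by blast

lemma abelian_subgroup_B: "abelian_subgroup B M"
  using subB by (intro abelian_subgroupI3 additive_subgroupI)
     (auto simp: submodule_def M.abelian_group_axioms)

lemma coset_eq_iff:
  assumes "x \<in> carrier M" "y \<in> carrier M"
  shows "B +>\<^bsub>M\<^esub> x = B +>\<^bsub>M\<^esub> y \<longleftrightarrow> x \<ominus>\<^bsub>M\<^esub> y \<in> B"
proof -
  interpret B: abelian_subgroup B M by (rule abelian_subgroup_B)
  show ?thesis
  proof
    assume "B +>\<^bsub>M\<^esub> x = B +>\<^bsub>M\<^esub> y"
    then have "x \<in> B +>\<^bsub>M\<^esub> y" using B.a_rcos_self[OF assms(1)] by simp
    then show "x \<ominus>\<^bsub>M\<^esub> y \<in> B" using B.a_rcos_module[OF assms(2,1)] by (simp add: a_minus_def)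
  next
    assume "x \<ominus>\<^bsub>M\<^esub> y \<in> B"
    then have "x \<in> B +>\<^bsub>M\<^esub> y" using B.a_rcos_module[OF assms(2,1)] by (simp add: a_minus_def)
    then show "B +>\<^bsub>M\<^esub> x = B +>\<^bsub>M\<^esub> y"
      using B.a_repr_independence'[OF _ assms(2)] by simp
  qed
qed

lemma coset_eq_zero_iff:
  assumes "x \<in> carrier M"
  shows "B +>\<^bsub>M\<^esub> x = B \<longleftrightarrow> x \<in> B"
  using coset_eq_iff[OF assms M.zero_closed] assms B(1) by (simp add: M.minus_zero_right)

lemma coset_add:
  assumes "x \<in> carrier M" "y \<in> carrier M"
  shows "(B +>\<^bsub>M\<^esub> x) <+>\<^bsub>M\<^esub> (B +>\<^bsub>M\<^esub> y) = B +>\<^bsub>M\<^esub> (x \<oplus>\<^bsub>M\<^esub> y)"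
proof -
  interpret B: abelian_subgroup B M by (rule abelian_subgroup_B)
  show ?thesis using assms by (simp add: B.a_rcos_sum)
qed

text \<open>The multiple of a coset by \<open>r\<close> may fill only part of a coset, for instance
  when \<open>r\<close> is zero; this is why \<open>quot_mod\<close> adds \<open>B\<close>
  back.\<close>

lemma coset_smult:
  assumes r: "r \<in> carrier R" and x: "x \<in> carrier M"
  shows "B <+>\<^bsub>M\<^esub> ((\<lambda>c. r \<odot>\<^bsub>M\<^esub> c) ` (B +>\<^bsub>M\<^esub> x)) = B +>\<^bsub>M\<^esub> (r \<odot>\<^bsub>M\<^esub> x)"
proof -
  have Bc: "b \<in> carrier M" if "b \<in> B" for b using that B(1) by blast
  show ?thesis
  proof (intro subset_antisym subsetI)
    fix u assume "u \<in> B <+>\<^bsub>M\<^esub> ((\<lambda>c. r \<odot>\<^bsub>M\<^esub> c) ` (B +>\<^bsub>M\<^esub> x))"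
    then obtain b b' where b: "b \<in> B" "b' \<in> B" "u = b \<oplus>\<^bsub>M\<^esub> (r \<odot>\<^bsub>M\<^esub> (b' \<oplus>\<^bsub>M\<^esub> x))"
      by (auto simp: set_add_def' a_r_coset_def')
    then have "u = (b \<oplus>\<^bsub>M\<^esub> r \<odot>\<^bsub>M\<^esub> b') \<oplus>\<^bsub>M\<^esub> (r \<odot>\<^bsub>M\<^esub> x)"
      using Bc r x by (simp add: M.smult_r_distr M.a_assoc)
    then show "u \<in> B +>\<^bsub>M\<^esub> (r \<odot>\<^bsub>M\<^esub> x)" using b B r by (auto simp: a_r_coset_def')
  next
    fix u assume "u \<in> B +>\<^bsub>M\<^esub> (r \<odot>\<^bsub>M\<^esub> x)"
    then obtain b where b: "b \<in> B" "u = b \<oplus>\<^bsub>M\<^esub> (r \<odot>\<^bsub>M\<^esub> x)" by (auto simp: a_r_coset_def')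
    have "u = b \<oplus>\<^bsub>M\<^esub> (r \<odot>\<^bsub>M\<^esub> (\<zero>\<^bsub>M\<^esub> \<oplus>\<^bsub>M\<^esub> x))" using b x by simp
    then show "u \<in> B <+>\<^bsub>M\<^esub> ((\<lambda>c. r \<odot>\<^bsub>M\<^esub> c) ` (B +>\<^bsub>M\<^esub> x))"
      using b(1) B(2) by (fastforce simp: set_add_def' a_r_coset_def')
  qed
qed

abbreviation "quot \<equiv> quot_mod M A B"

lemma quot_zero: "\<zero>\<^bsub>quot\<^esub> = B" and quot_zero_coset: "\<zero>\<^bsub>quot\<^esub> = B +>\<^bsub>M\<^esub> \<zero>\<^bsub>M\<^esub>"
  using coset_eq_zero_iff[OF M.zero_closed] B(2) by (auto simp: quot_mod_def)

lemma quot_add: "x \<in> A \<Longrightarrow> y \<in> A \<Longrightarrow> (B +>\<^bsub>M\<^esub> x) \<oplus>\<^bsub>quot\<^esub> (B +>\<^bsub>M\<^esub> y) = B +>\<^bsub>M\<^esub> (x \<oplus>\<^bsub>M\<^esub> y)"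
  using coset_add A_carrier by (simp add: quot_mod_def)

lemma quot_smult: "r \<in> carrier R \<Longrightarrow> x \<in> A \<Longrightarrow> r \<odot>\<^bsub>quot\<^esub> (B +>\<^bsub>M\<^esub> x) = B +>\<^bsub>M\<^esub> (r \<odot>\<^bsub>M\<^esub> x)"
  using coset_smult A_carrier by (simp add: quot_mod_def)

lemma carrier_quot: "carrier quot = (\<lambda>a. B +>\<^bsub>M\<^esub> a) ` A"
  by (simp add: quot_mod_def)

lemma quotI: "x \<in> A \<Longrightarrow> B +>\<^bsub>M\<^esub> x \<in> carrier quot"
  by (simp add: carrier_quot)

lemma module_quot: "module R quot"
proof (rule moduleI)
  show "cring R" by (rule M.R.cring_axioms)
  show "abelian_group quot"
  proof (rule abelian_groupI)
    fix x assume "x \<in> carrier quot"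
    then obtain a where a: "a \<in> A" "x = B +>\<^bsub>M\<^esub> a" by (auto simp: carrier_quot)
    then have "(B +>\<^bsub>M\<^esub> (\<ominus>\<^bsub>M\<^esub> a)) \<oplus>\<^bsub>quot\<^esub> x = \<zero>\<^bsub>quot\<^esub>"
      using A A_carrier by (simp add: quot_add quot_zero_coset M.l_neg)
    then show "\<exists>y\<in>carrier quot. y \<oplus>\<^bsub>quot\<^esub> x = \<zero>\<^bsub>quot\<^esub>" by (rule bexI) (rule quotI[OF A(5)[OF a(1)]])
  qed (use A A_carrier in \<open>auto simp: carrier_quot quot_add quot_zero_coset M.a_ac\<close>)
qed (use A A_carrier in \<open>auto simp: carrier_quot quot_add quot_smult M.smult_l_distr M.smult_r_distr M.smult_assoc1\<close>)

lemma quot_eq_iff: "x \<in> A \<Longrightarrow> y \<in> A \<Longrightarrow> B +>\<^bsub>M\<^esub> x = B +>\<^bsub>M\<^esub> y \<longleftrightarrow> x \<ominus>\<^bsub>M\<^esub> y \<in> B"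
  using coset_eq_iff A_carrier by simp

text \<open>Stated on \<open>A\<close> regarded as a module, since only cosets of elements of
  \<open>A\<close> lie in the quotient; the passage from vertical cycles to their homology classes
  is this map.\<close>

lemma quot_proj: "(\<lambda>x. B +>\<^bsub>M\<^esub> x) \<in> lin_maps R (M\<lparr>carrier := A\<rparr>) quot"
  by (rule lin_mapsI) (auto simp: quotI quot_add quot_smult)

lemma quot_eq_zero_iff: "x \<in> A \<Longrightarrow> B +>\<^bsub>M\<^esub> x = \<zero>\<^bsub>quot\<^esub> \<longleftrightarrow> x \<in> B"
  using coset_eq_zero_iff A_carrier by (simp add: quot_zero)

end

text \<open>Additive relations in the sense of Mac Lane: they induce maps between subquotients
  without a choice of lifts.\<close>

locale subquot_rel = S: subquot R M A B + T: subquot R N C D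
  for R :: "'r ring" and M :: "('r,'a) module" and A B
    and N :: "('r,'b) module" and C D +
  fixes L :: "('a \<times> 'b) set"
  assumes L_sub: "L \<subseteq> A \<times> C"
    and L_add: "\<And>a b a' b'. (a,b) \<in> L \<Longrightarrow> (a',b') \<in> L \<Longrightarrow> (a \<oplus>\<^bsub>M\<^esub> a', b \<oplus>\<^bsub>N\<^esub> b') \<in> L"
    and L_smult: "\<And>r a b. r \<in> carrier R \<Longrightarrow> (a,b) \<in> L \<Longrightarrow> (r \<odot>\<^bsub>M\<^esub> a, r \<odot>\<^bsub>N\<^esub> b) \<in> L"
    and L_total: "\<And>a. a \<in> A \<Longrightarrow> \<exists>b. (a,b) \<in> L"
    and L_zero: "\<And>a b. (a,b) \<in> L \<Longrightarrow> a \<in> B \<Longrightarrow> b \<in> D"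
begin

lemma LD: "(a,b) \<in> L \<Longrightarrow> a \<in> A" "(a,b) \<in> L \<Longrightarrow> b \<in> C" using L_sub by auto

definition qmap :: "'a set \<Rightarrow> 'b set" where
  "qmap X = D +>\<^bsub>N\<^esub> (SOME b. \<exists>a. (a,b) \<in> L \<and> X = B +>\<^bsub>M\<^esub> a)"

lemma L_minus: assumes "(a,b) \<in> L" "(a',b') \<in> L" shows "(a \<ominus>\<^bsub>M\<^esub> a', b \<ominus>\<^bsub>N\<^esub> b') \<in> L"
proof -
  have "(\<ominus>\<^bsub>M\<^esub> a', \<ominus>\<^bsub>N\<^esub> b') \<in> L"
    using L_smult[OF _ assms(2), of "\<ominus>\<^bsub>R\<^esub> \<one>\<^bsub>R\<^esub>"] LD[OF assms(2)]
    by (simp add: uminus_eq_smult[OF S.mod] uminus_eq_smult[OF T.mod] S.A_carrier T.A_carrier)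
  then show ?thesis using L_add[OF assms(1)] by (simp add: a_minus_def)
qed

text \<open>Two pairs of \<open>L\<close> over the same coset differ by a pair whose first entry
  lies in \<open>B\<close>, so by \<open>L_zero\<close> their second entries agree modulo
  \<open>D\<close>. The choice made in \<open>qmap\<close> is therefore irrelevant.\<close>

lemma qmap_coset:
  assumes "(a,b) \<in> L"
  shows "qmap (B +>\<^bsub>M\<^esub> a) = D +>\<^bsub>N\<^esub> b"
proof -
  define b' where "b' = (SOME b. \<exists>a'. (a',b) \<in> L \<and> B +>\<^bsub>M\<^esub> a = B +>\<^bsub>M\<^esub> a')"
  have "\<exists>a'. (a',b') \<in> L \<and> B +>\<^bsub>M\<^esub> a = B +>\<^bsub>M\<^esub> a'"
    unfolding b'_def by (rule someI_ex) (use assms in blast)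
  then obtain a' where a': "(a',b') \<in> L" "B +>\<^bsub>M\<^esub> a = B +>\<^bsub>M\<^esub> a'" by blast
  then have "a' \<ominus>\<^bsub>M\<^esub> a \<in> B" using LD assms S.quot_eq_iff by metis
  then have "b' \<ominus>\<^bsub>N\<^esub> b \<in> D" using L_zero L_minus[OF a'(1) assms] by blast
  then have "D +>\<^bsub>N\<^esub> b' = D +>\<^bsub>N\<^esub> b" using LD a'(1) assms T.quot_eq_iff by blast
  then show ?thesis by (simp add: qmap_def b'_def)
qed

lemma quot_repE:
  assumes "x \<in> carrier S.quot"
  obtains a b where "(a,b) \<in> L" "x = B +>\<^bsub>M\<^esub> a"
  using assms L_total unfolding S.carrier_quot by blast

lemma qmap_lin: "qmap \<in> lin_maps R S.quot T.quot"
proof (rule lin_mapsI)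
  fix x assume "x \<in> carrier S.quot"
  then obtain a b where "(a,b) \<in> L" "x = B +>\<^bsub>M\<^esub> a" by (elim quot_repE)
  then show "qmap x \<in> carrier T.quot" using LD by (auto simp: qmap_coset T.carrier_quot)
next
  fix x y assume "x \<in> carrier S.quot" "y \<in> carrier S.quot"
  then obtain a b a' b' where "(a,b) \<in> L" "x = B +>\<^bsub>M\<^esub> a" "(a',b') \<in> L" "y = B +>\<^bsub>M\<^esub> a'"
    by (elim quot_repE)
  then show "qmap (x \<oplus>\<^bsub>S.quot\<^esub> y) = qmap x \<oplus>\<^bsub>T.quot\<^esub> qmap y"
    using LD by (simp add: qmap_coset S.quot_add T.quot_add L_add)
next
  fix r x assume r: "r \<in> carrier R" and "x \<in> carrier S.quot"
  then obtain a b where "(a,b) \<in> L" "x = B +>\<^bsub>M\<^esub> a" by (elim quot_repE)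
  then show "qmap (r \<odot>\<^bsub>S.quot\<^esub> x) = r \<odot>\<^bsub>T.quot\<^esub> qmap x"
    using LD r by (simp add: qmap_coset S.quot_smult T.quot_smult L_smult)
qed

text \<open>The hypotheses \<open>onto\<close> and \<open>inj\<close> are \<open>L_total\<close> and
  \<open>L_zero\<close> for the converse relation, so the induced map is invertible.\<close>

lemma qmap_iso:
  assumes onto: "\<And>b. b \<in> C \<Longrightarrow> \<exists>a. (a,b) \<in> L" and inj: "\<And>a b. (a,b) \<in> L \<Longrightarrow> b \<in> D \<Longrightarrow> a \<in> B"
  shows "mod_iso R S.quot T.quot"
  unfolding mod_iso_def
proof (intro bexI[OF _ qmap_lin] bij_betw_imageI inj_onI)
  fix x y assume "x \<in> carrier S.quot" "y \<in> carrier S.quot" and e: "qmap x = qmap y"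
  then obtain a b a' b' where ab: "(a,b) \<in> L" "x = B +>\<^bsub>M\<^esub> a" "(a',b') \<in> L" "y = B +>\<^bsub>M\<^esub> a'"
    by (elim quot_repE)
  then have "b \<ominus>\<^bsub>N\<^esub> b' \<in> D" using e LD T.quot_eq_iff by (simp add: qmap_coset)
  then have "a \<ominus>\<^bsub>M\<^esub> a' \<in> B" using L_minus ab inj by blast
  then show "x = y" using ab LD S.quot_eq_iff by blast
next
  show "qmap ` carrier S.quot = carrier T.quot"
  proof
    show "qmap ` carrier S.quot \<subseteq> carrier T.quot" using lin_maps_closed[OF qmap_lin] by blast
    show "carrier T.quot \<subseteq> qmap ` carrier S.quot"
    proof
      fix y assume "y \<in> carrier T.quot"
      then obtain a b where "(a,b) \<in> L" "y = D +>\<^bsub>N\<^esub> b" using onto unfolding T.carrier_quot by blast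
      then have "y = qmap (B +>\<^bsub>M\<^esub> a)" "a \<in> A" using LD by (auto simp: qmap_coset)
      then show "y \<in> qmap ` carrier S.quot" using S.quotI by blast
    qed
  qed
qed

end

section \<open>The spectral sequence of a filtered complex\<close>

text \<open>The total complex is one module \<open>T\<close>; \<open>G p n\<close> is the part of degree \<open>n\<close> and filtration at most \<open>p\<close>,
  and \<open>pr p q\<close> embeds \<open>G p (p + q) / G (p - 1) (p + q)\<close> into \<open>D p q\<close>.\<close>

locale filtered_complex =
  fixes R :: "'r ring" and T :: "('r,'t) module" and d :: "'t \<Rightarrow> 't"
    and G :: "int \<Rightarrow> int \<Rightarrow> 't set"
    and D :: "int \<Rightarrow> int \<Rightarrow> ('r,'e) module" and pr :: "int \<Rightarrow> int \<Rightarrow> 't \<Rightarrow> 'e"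
  assumes modT: "module R T" and modD: "module R (D p q)"
    and subG: "submodule (G p n) R T"
    and G_step: "G (p - 1) n \<subseteq> G p n"
    and d_lin: "d \<in> lin_maps R T T"
    and d_G: "x \<in> G p n \<Longrightarrow> d x \<in> G p (n - 1)"
    and d_d: "x \<in> carrier T \<Longrightarrow> d (d x) = \<zero>\<^bsub>T\<^esub>"
    and pr_lin: "pr p q \<in> lin_maps R T (D p q)"
    and pr_ker: "x \<in> G p (p + q) \<Longrightarrow> pr p q x = \<zero>\<^bsub>D p q\<^esub> \<longleftrightarrow> x \<in> G (p - 1) (p + q)"
    and G_neg: "p < 0 \<Longrightarrow> G p n = {\<zero>\<^bsub>T\<^esub>}"
    and G_top: "n \<le> p \<Longrightarrow> G p n = G n n"
    and D_triv: "\<not> (0 \<le> p \<and> 0 \<le> q) \<Longrightarrow> carrier (D p q) = {\<zero>\<^bsub>D p q\<^esub>}"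
begin

sublocale T: module R T by (rule modT)

lemmas G = submoduleD[OF subG modT]

lemma G_carrier: "x \<in> G p n \<Longrightarrow> x \<in> carrier T" using G(1) by blast

lemma G_mono: assumes "p \<le> p'" shows "G p n \<subseteq> G p' n"
proof -
  have "G p n \<subseteq> G (p + int k) n" for k
    by (induction k) (use G_step[of "p + 1 + int _" n] in \<open>auto simp: algebra_simps\<close>)
  from this[of "nat (p' - p)"] show ?thesis using assms by simp
qed

lemma pr_eq_iff:
  assumes "x \<in> G p (p + q)" "y \<in> G p (p + q)"
  shows "pr p q x = pr p q y \<longleftrightarrow> x \<ominus>\<^bsub>T\<^esub> y \<in> G (p - 1) (p + q)"
proof -
  interpret D: module R "D p q" by (rule modD)
  have c: "x \<in> carrier T" "y \<in> carrier T" using assms G_carrier by auto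
  have "pr p q (x \<ominus>\<^bsub>T\<^esub> y) = pr p q x \<ominus>\<^bsub>D p q\<^esub> pr p q y"
    by (rule lin_maps_minus[OF pr_lin modT modD c])
  then show ?thesis
    using pr_ker[OF G(6)[OF assms]] c lin_maps_closed[OF pr_lin]
    by (simp add: D.minus_eq_zero_iff)
qed

section \<open>Pages as subquotients, and their differentials\<close>

definition Z :: "int \<Rightarrow> int \<Rightarrow> int \<Rightarrow> 't set" where
  "Z r p n = {x \<in> G p n. d x \<in> G (p - r) (n - 1)}"

definition A :: "int \<Rightarrow> int \<Rightarrow> int \<Rightarrow> 'e set" where
  "A r p q = pr p q ` Z r p (p + q)"

text \<open>The parameters satisfy \<open>(p + r - 1) - (r - 1) = p\<close>: these are the
  boundaries of filtration \<open>p\<close> that come from at most \<open>r - 1\<close> steps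
  higher. For \<open>r + 1\<close> in place of \<open>r\<close> they give the image of the
  differential that arrives from column \<open>p + r\<close>.\<close>

definition B :: "int \<Rightarrow> int \<Rightarrow> int \<Rightarrow> 'e set" where
  "B r p q = pr p q ` d ` Z (r - 1) (p + r - 1) (p + q + 1)"

definition page :: "nat \<Rightarrow> int \<Rightarrow> int \<Rightarrow> ('r, 'e set) module" where
  "page r p q = quot_mod (D p q) (A (int r) p q) (B (int r) p q)"

lemma subZ: "submodule (Z r p n) R T"
  unfolding Z_def by (rule submodule_preimage[OF d_lin modT modT subG subG])

lemmas Z = submoduleD[OF subZ modT]

lemma Z_carrier: "x \<in> Z r p n \<Longrightarrow> x \<in> carrier T" using Z(1) by blast

lemma Z_mono: "p \<le> p' \<Longrightarrow> p - r \<le> p' - r' \<Longrightarrow> Z r p n \<subseteq> Z r' p' n"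
  using G_mono unfolding Z_def by blast

text \<open>As \<open>d\<close> squares to zero, a boundary of filtration \<open>p\<close> passes
  the condition of \<open>Z s\<close> for every \<open>s\<close>. Hence \<open>B r\<close> lies in
  \<open>A s\<close> for all \<open>r\<close> and \<open>s\<close>, which makes every page a
  subquotient.\<close>

lemma d_Z: "x \<in> Z (r - 1) (p + r - 1) (n + 1) \<Longrightarrow> d x \<in> Z s p n"
  using G(2) by (auto simp: Z_def d_d G_carrier)

lemma d_Z': assumes "x \<in> Z r p (p + q)" shows "d x \<in> Z s (p - r) ((p - r) + (q + r - 1))"
proof -
  have "(p - r) + (q + r - 1) = p + q - 1" by simp
  then show ?thesis using assms G(2) d_d[OF Z_carrier[OF assms]] by (simp only: mem_Collect_eq Z_def)
qed

lemma B_subset_A: "B r p q \<subseteq> A s p q"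
  unfolding A_def B_def using d_Z by blast

lemma page_subquot: "subquot R (D p q) (A r p q) (B s p q)"
proof (rule subquot.intro)
  show "submodule (A r p q) R (D p q)"
    unfolding A_def by (rule submodule_image[OF pr_lin modT modD subZ])
  show "submodule (B s p q) R (D p q)"
    unfolding B_def by (rule submodule_image[OF pr_lin modT modD submodule_image[OF d_lin modT modT subZ]])
qed (rule modD B_subset_A)+

text \<open>Both entries come from the same \<open>x\<close>, which its leading term does not
  determine; this is why the differential is a relation before it is a map.\<close>

definition drel :: "nat \<Rightarrow> int \<Rightarrow> int \<Rightarrow> ('e \<times> 'e) set" where
  "drel r p q = (\<lambda>x. (pr p q x, pr (p - int r) (q + int r - 1) (d x))) ` Z (int r) p (p + q)"

text \<open>The point is \<open>L_zero\<close>. If the leading term of \<open>x\<close> is also that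
  of some \<open>d y\<close>, then \<open>x - d y\<close> has filtration \<open>p - 1\<close> and
  the same boundary as \<open>x\<close>. So the leading term of \<open>d x\<close> lies in
  \<open>B r\<close> at the target, because \<open>p - 1 = (p - r) + r - 1\<close>.\<close>

lemma drel_rel:
  "subquot_rel R (D p q) (A (int r) p q) (B (int r) p q)
     (D (p - int r) (q + int r - 1)) (A (int r) (p - int r) (q + int r - 1)) (B (int r) (p - int r) (q + int r - 1))
     (drel r p q)"
proof -
  let ?p = "p - int r" and ?q = "q + int r - 1"
  interpret S: subquot R "D p q" "A (int r) p q" "B (int r) p q" by (rule page_subquot)
  interpret S': subquot R "D ?p ?q" "A (int r) ?p ?q" "B (int r) ?p ?q" by (rule page_subquot)
  have n: "?p + ?q = p + q - 1" by simp
  show ?thesis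
  proof unfold_locales
    have "d x \<in> Z (int r) ?p (?p + ?q)" if "x \<in> Z (int r) p (p + q)" for x
      using that by (rule d_Z')
    then show "drel r p q \<subseteq> A (int r) p q \<times> A (int r) ?p ?q"
      unfolding drel_def A_def by blast
  next
    fix a b a' b' assume "(a,b) \<in> drel r p q" "(a',b') \<in> drel r p q"
    then obtain x x' where x: "x \<in> Z (int r) p (p + q)" "a = pr p q x" "b = pr ?p ?q (d x)"
      and x': "x' \<in> Z (int r) p (p + q)" "a' = pr p q x'" "b' = pr ?p ?q (d x')"
      by (auto simp: drel_def)
    have c: "x \<in> carrier T" "x' \<in> carrier T" "d x \<in> carrier T" "d x' \<in> carrier T"
      using x(1) x'(1) Z_carrier lin_maps_closed[OF d_lin] by auto
    have "a \<oplus>\<^bsub>D p q\<^esub> a' = pr p q (x \<oplus>\<^bsub>T\<^esub> x')" "b \<oplus>\<^bsub>D ?p ?q\<^esub> b' = pr ?p ?q (d (x \<oplus>\<^bsub>T\<^esub> x'))"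
      using c x x' by (simp_all add: lin_maps_add[OF pr_lin] lin_maps_add[OF d_lin])
    then show "(a \<oplus>\<^bsub>D p q\<^esub> a', b \<oplus>\<^bsub>D ?p ?q\<^esub> b') \<in> drel r p q"
      using Z(3)[OF x(1) x'(1)] unfolding drel_def by blast
  next
    fix s a b assume s: "s \<in> carrier R" and "(a,b) \<in> drel r p q"
    then obtain x where x: "x \<in> Z (int r) p (p + q)" "a = pr p q x" "b = pr ?p ?q (d x)"
      by (auto simp: drel_def)
    have c: "x \<in> carrier T" "d x \<in> carrier T"
      using x(1) Z_carrier lin_maps_closed[OF d_lin] by auto
    have "s \<odot>\<^bsub>D p q\<^esub> a = pr p q (s \<odot>\<^bsub>T\<^esub> x)" "s \<odot>\<^bsub>D ?p ?q\<^esub> b = pr ?p ?q (d (s \<odot>\<^bsub>T\<^esub> x))"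
      using c x s by (simp_all add: lin_maps_smult[OF pr_lin] lin_maps_smult[OF d_lin])
    then show "(s \<odot>\<^bsub>D p q\<^esub> a, s \<odot>\<^bsub>D ?p ?q\<^esub> b) \<in> drel r p q"
      using Z(4)[OF s x(1)] unfolding drel_def by blast
  next
    fix a assume "a \<in> A (int r) p q"
    then show "\<exists>b. (a, b) \<in> drel r p q" unfolding drel_def A_def by blast
  next
    fix a b assume "(a,b) \<in> drel r p q" and a: "a \<in> B (int r) p q"
    then obtain x where x: "x \<in> Z (int r) p (p + q)" "a = pr p q x" "b = pr ?p ?q (d x)"
      by (auto simp: drel_def)
    obtain y where y: "y \<in> Z (int r - 1) (p + int r - 1) (p + q + 1)" "a = pr p q (d y)"
      using a unfolding B_def by blast
    let ?w = "x \<ominus>\<^bsub>T\<^esub> d y"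
    have dy: "d y \<in> Z (int r) p (p + q)" by (rule d_Z[OF y(1)])
    have c: "x \<in> carrier T" "y \<in> carrier T" "d y \<in> carrier T"
      using x(1) y(1) Z_carrier lin_maps_closed[OF d_lin] by auto
    have "?w \<in> G (p - 1) (p + q)"
      using pr_eq_iff[of x p q "d y"] x dy y by (simp add: Z_def)
    moreover have dw: "d ?w = d x"
      using c lin_maps_closed[OF d_lin, of x]
      by (simp add: lin_maps_minus[OF d_lin modT modT] d_d T.minus_zero_right)
    ultimately have "?w \<in> Z (int r - 1) (?p + int r - 1) (?p + ?q + 1)"
      using x(1) by (auto simp: Z_def)
    then show "b \<in> B (int r) ?p ?q" using dw x(3) unfolding B_def by (metis imageI)
  qed
qed

definition dpage :: "nat \<Rightarrow> int \<Rightarrow> int \<Rightarrow> 'e set \<Rightarrow> 'e set" where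
  "dpage r p q = subquot_rel.qmap (D p q) (B (int r) p q)
     (D (p - int r) (q + int r - 1)) (B (int r) (p - int r) (q + int r - 1)) (drel r p q)"

lemma dpage_coset:
  assumes "x \<in> Z (int r) p (p + q)"
  shows "dpage r p q (B (int r) p q +>\<^bsub>D p q\<^esub> pr p q x)
    = B (int r) (p - int r) (q + int r - 1) +>\<^bsub>D (p - int r) (q + int r - 1)\<^esub> pr (p - int r) (q + int r - 1) (d x)"
  unfolding dpage_def
  by (rule subquot_rel.qmap_coset[OF drel_rel]) (use assms in \<open>auto simp: drel_def\<close>)

lemma dpage_lin: "dpage r p q \<in> lin_maps R (page r p q) (page r (p - int r) (q + int r - 1))"
  unfolding dpage_def page_def by (rule subquot_rel.qmap_lin[OF drel_rel])

lemma module_page: "module R (page r p q)"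
  unfolding page_def by (rule subquot.module_quot[OF page_subquot])

lemma page_repE:
  assumes "c \<in> carrier (page r p q)"
  obtains x where "x \<in> Z (int r) p (p + q)" "c = B (int r) p q +>\<^bsub>D p q\<^esub> pr p q x"
proof -
  have "c \<in> (\<lambda>a. B (int r) p q +>\<^bsub>D p q\<^esub> a) ` A (int r) p q"
    using assms unfolding page_def subquot.carrier_quot[OF page_subquot] .
  then show thesis using that unfolding A_def by blast
qed

lemma dpage_dpage:
  assumes "c \<in> carrier (page r p q)"
  shows "dpage r (p - int r) (q + int r - 1) (dpage r p q c) = \<zero>\<^bsub>page r (p - 2 * int r) (q + 2 * int r - 2)\<^esub>"
proof -
  let ?p = "p - int r" and ?q = "q + int r - 1"
  have e: "?p - int r = p - 2 * int r" "?q + int r - 1 = q + 2 * int r - 2" by auto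
  interpret S: subquot R "D (p - 2 * int r) (q + 2 * int r - 2)" "A (int r) (p - 2 * int r) (q + 2 * int r - 2)" "B (int r) (p - 2 * int r) (q + 2 * int r - 2)"
    by (rule page_subquot)
  obtain x where x: "x \<in> Z (int r) p (p + q)" "c = B (int r) p q +>\<^bsub>D p q\<^esub> pr p q x"
    using assms by (rule page_repE)
  have dx: "d x \<in> Z (int r) ?p (?p + ?q)"
    using x(1) by (rule d_Z')
  show ?thesis
    using dpage_coset[OF x(1)] dpage_coset[OF dx] S.quot_zero_coset
    by (simp only: x(2) d_d[OF Z_carrier[OF x(1)]] e page_def lin_maps_zero[OF pr_lin modT modD])
qed

text \<open>Correction by elements of filtration \<open>p - 1\<close> changes no leading term in
  column \<open>p\<close>. If \<open>d x\<close> has the leading term of \<open>d w\<close> with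
  such a \<open>w\<close>, then \<open>x - w\<close> keeps the leading term of \<open>x\<close> and
  has a boundary one step lower. Conversely, an element \<open>y\<close> with the leading term of
  \<open>x\<close> and a lower boundary yields \<open>w = x - y\<close>, whose boundary has the
  leading term of \<open>d x\<close>.\<close>

lemma dpage_zero_iff:
  assumes x: "x \<in> Z (int r) p (p + q)"
  shows "dpage r p q (B (int r) p q +>\<^bsub>D p q\<^esub> pr p q x) = \<zero>\<^bsub>page r (p - int r) (q + int r - 1)\<^esub>
    \<longleftrightarrow> pr p q x \<in> A (int r + 1) p q"
proof -
  let ?p = "p - int r" and ?q = "q + int r - 1"
  interpret S: subquot R "D ?p ?q" "A (int r) ?p ?q" "B (int r) ?p ?q" by (rule page_subquot)
  have dx: "d x \<in> Z (int r) ?p (?p + ?q)"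
    using x by (rule d_Z')
  then have "pr ?p ?q (d x) \<in> A (int r) ?p ?q" unfolding A_def by blast
  then have 1: "dpage r p q (B (int r) p q +>\<^bsub>D p q\<^esub> pr p q x) = \<zero>\<^bsub>page r ?p ?q\<^esub> \<longleftrightarrow> pr ?p ?q (d x) \<in> B (int r) ?p ?q"
    using S.quot_eq_zero_iff by (simp add: dpage_coset[OF x] page_def)
  have c: "x \<in> carrier T" by (rule Z_carrier[OF x])
  have e: "?p + int r - 1 = p - 1" "?p + ?q + 1 = p + q" by auto
  have "pr p q x \<in> A (int r + 1) p q" if hyp: "pr ?p ?q (d x) \<in> B (int r) ?p ?q"
  proof -
    obtain w where w: "w \<in> Z (int r - 1) (p - 1) (p + q)" "pr ?p ?q (d x) = pr ?p ?q (d w)"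
      using hyp unfolding B_def e by blast
    have cw: "w \<in> carrier T" by (rule Z_carrier[OF w(1)])
    have "p - 1 - (int r - 1) = ?p" "p + q - 1 = ?p + ?q" by simp_all
    then have dwG: "d w \<in> G ?p (?p + ?q)" using w(1) by (simp only: Z_def mem_Collect_eq)
    have "d x \<ominus>\<^bsub>T\<^esub> d w \<in> G (?p - 1) (?p + ?q)"
      by (subst pr_eq_iff[symmetric]) (use dx dwG w in \<open>auto simp: Z_def\<close>)
    moreover have wG: "w \<in> G (p - 1) (p + q)" using w by (simp add: Z_def)
    moreover have "w \<in> G p (p + q)" using wG G_step by blast
    ultimately have "x \<ominus>\<^bsub>T\<^esub> w \<in> Z (int r + 1) p (p + q)"
      using x c cw G(6)[of x p "p+q" w] by (auto simp: Z_def lin_maps_minus[OF d_lin modT modT] algebra_simps)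
    moreover have "pr p q (x \<ominus>\<^bsub>T\<^esub> w) = pr p q x"
    proof -
      have "x \<ominus>\<^bsub>T\<^esub> w \<ominus>\<^bsub>T\<^esub> x = \<ominus>\<^bsub>T\<^esub> w" using c cw by (simp add: T.minus_minus_cancel)
      then show ?thesis using x wG \<open>w \<in> G p (p + q)\<close> G(5)[OF wG] G(6)
        by (subst pr_eq_iff) (auto simp: Z_def)
    qed
    ultimately show ?thesis unfolding A_def by (metis imageI)
  qed
  moreover have "pr ?p ?q (d x) \<in> B (int r) ?p ?q" if hyp: "pr p q x \<in> A (int r + 1) p q"
  proof -
    obtain y where y: "y \<in> Z (int r + 1) p (p + q)" "pr p q x = pr p q y"
      using hyp unfolding A_def by auto
    have cy: "y \<in> carrier T" by (rule Z_carrier[OF y(1)])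
    have w: "x \<ominus>\<^bsub>T\<^esub> y \<in> G (p - 1) (p + q)"
      by (subst pr_eq_iff[symmetric]) (use x y in \<open>auto simp: Z_def\<close>)
    have dy: "d y \<in> G (?p - 1) (?p + ?q)" using y(1) by (simp add: Z_def algebra_simps)
    have dyG: "d y \<in> G ?p (?p + ?q)" using dy G_step by blast
    have dxG: "d x \<in> G ?p (?p + ?q)" using dx by (simp add: Z_def)
    have dw: "d (x \<ominus>\<^bsub>T\<^esub> y) = d x \<ominus>\<^bsub>T\<^esub> d y" using c cy by (simp add: lin_maps_minus[OF d_lin modT modT])
    have "x \<ominus>\<^bsub>T\<^esub> y \<in> Z (int r - 1) (?p + int r - 1) (?p + ?q + 1)"
      using w G(6)[OF dxG dyG] by (simp add: Z_def dw add_diff_eq)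
    moreover have "pr ?p ?q (d (x \<ominus>\<^bsub>T\<^esub> y)) = pr ?p ?q (d x)"
    proof -
      have "d x \<ominus>\<^bsub>T\<^esub> d y \<ominus>\<^bsub>T\<^esub> d x = \<ominus>\<^bsub>T\<^esub> d y"
        using G_carrier[OF dxG] G_carrier[OF dyG] by (simp add: T.minus_minus_cancel)
      then show ?thesis using dxG dyG G(5)[OF dy] G(6)[OF dxG dyG]
        by (subst pr_eq_iff) (auto simp: dw)
    qed
    ultimately show ?thesis unfolding B_def by (metis imageI)
  qed
  ultimately show ?thesis using 1 by blast
qed

lemma A_antimono: "r \<le> s \<Longrightarrow> A s p q \<subseteq> A r p q"
  unfolding A_def using Z_mono[of p p s r] by auto

lemma B_mono: "r \<le> s \<Longrightarrow> B r p q \<subseteq> B s p q"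
  unfolding B_def using Z_mono[of "p + r - 1" "p + s - 1" "r - 1" "s - 1"] by auto

text \<open>A case of the third isomorphism theorem: inside page \<open>r\<close> the kernel
  consists of the classes of \<open>A (r + 1)\<close> and the image of the classes of
  \<open>B (r + 1)\<close>. Taking homology thus only shrinks \<open>A\<close> and enlarges
  \<open>B\<close>.\<close>

lemma page_Suc_iso:
  "mod_iso R (page (Suc r) p q)
        (quot_mod (page r p q) {x \<in> carrier (page r p q). dpage r p q x = \<zero>\<^bsub>page r (p - int r) (q + int r - 1)\<^esub>}
                  (dpage r (p + int r) (q - int r + 1) ` carrier (page r (p + int r) (q - int r + 1))))"
proof -
  let ?p = "p + int r" and ?q = "q - int r + 1"
  let ?C = "{x \<in> carrier (page r p q). dpage r p q x = \<zero>\<^bsub>page r (p - int r) (q + int r - 1)\<^esub>}"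
  let ?D = "dpage r ?p ?q ` carrier (page r ?p ?q)"
  let ?cl = "\<lambda>a. B (int r) p q +>\<^bsub>D p q\<^esub> a"
  let ?L = "(\<lambda>a. (a, ?cl a)) ` A (int r + 1) p q"
  interpret S: subquot R "D p q" "A (int r) p q" "B (int r) p q" by (rule page_subquot)
  interpret S1: subquot R "D p q" "A (int r + 1) p q" "B (int r + 1) p q" by (rule page_subquot)
  have dl: "dpage r ?p ?q \<in> lin_maps R (page r ?p ?q) (page r p q)"
    using dpage_lin[of r ?p ?q] by simp
  \<comment> \<open>The index shift in \<open>B\<close> pays off here: \<open>B (r + 1)\<close> at
    \<open>(p, q)\<close> is built from \<open>Z r\<close> in column \<open>p + r\<close>, which
    also supplies the representatives of the source page.\<close>
  have im: "?D = ?cl ` B (int r + 1) p q"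
  proof -
    have e: "dpage r ?p ?q (B (int r) ?p ?q +>\<^bsub>D ?p ?q\<^esub> pr ?p ?q y) = ?cl (pr p q (d y))"
      if "y \<in> Z (int r) ?p (p + q + 1)" for y
      using dpage_coset[of y r ?p ?q] that by (simp add: algebra_simps)
    have "carrier (page r ?p ?q) = (\<lambda>y. B (int r) ?p ?q +>\<^bsub>D ?p ?q\<^esub> pr ?p ?q y) ` Z (int r) ?p (p + q + 1)"
      unfolding page_def subquot.carrier_quot[OF page_subquot] by (simp add: A_def image_image algebra_simps)
    then have "?D = (\<lambda>y. ?cl (pr p q (d y))) ` Z (int r) ?p (p + q + 1)"
      using e by (simp add: image_image cong: image_cong)
    then show ?thesis by (simp add: B_def image_image)
  qed
  have A1A: "A (int r + 1) p q \<subseteq> A (int r) p q" by (rule A_antimono) simp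
  have ker: "?C = ?cl ` A (int r + 1) p q"
  proof (intro subset_antisym subsetI)
    fix c assume c: "c \<in> ?C"
    then obtain x where x: "x \<in> Z (int r) p (p + q)" "c = ?cl (pr p q x)" by (auto elim: page_repE)
    then show "c \<in> ?cl ` A (int r + 1) p q" using c dpage_zero_iff[OF x(1)] by blast
  next
    fix c assume "c \<in> ?cl ` A (int r + 1) p q"
    then obtain a where a: "a \<in> A (int r + 1) p q" "c = ?cl a" by blast
    then obtain x where x: "x \<in> Z (int r) p (p + q)" "a = pr p q x" using A1A unfolding A_def by blast
    then show "c \<in> ?C" using dpage_zero_iff[OF x(1)] a S.quotI A1A by (auto simp: page_def)
  qed
  have subC: "submodule ?C R (page r p q)"
    using submodule_preimage[OF dpage_lin module_page module_page module.carrier_is_submodule[OF module_page] submodule_zero_set[OF module_page]]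
    by simp
  have subD: "submodule ?D R (page r p q)"
    by (rule submodule_image[OF dl module_page module_page module.carrier_is_submodule[OF module_page]])
  interpret Q: subquot R "page r p q" ?C ?D
  proof (rule subquot.intro)
    show "?D \<subseteq> ?C" unfolding im ker using S1.BA by blast
  qed (fact module_page subC subD)+
  interpret L: subquot_rel R "D p q" "A (int r + 1) p q" "B (int r + 1) p q" "page r p q" ?C ?D ?L
  proof unfold_locales
    show "?L \<subseteq> A (int r + 1) p q \<times> ?C" unfolding ker by blast
    show "(a, b) \<in> ?L \<Longrightarrow> a \<in> B (int r + 1) p q \<Longrightarrow> b \<in> ?D" for a b unfolding im by blast
    show "a \<in> A (int r + 1) p q \<Longrightarrow> \<exists>b. (a, b) \<in> ?L" for a by blast
    show "(a \<oplus>\<^bsub>D p q\<^esub> a', b \<oplus>\<^bsub>page r p q\<^esub> b') \<in> ?L" if "(a,b) \<in> ?L" "(a',b') \<in> ?L" for a b a' b'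
    proof -
      have "a \<in> A (int r + 1) p q" "a' \<in> A (int r + 1) p q" "b = ?cl a" "b' = ?cl a'" using that by auto
      then show ?thesis using S1.A(3) A1A S.quot_add[of a a'] by (auto simp: page_def)
    qed
    show "(s \<odot>\<^bsub>D p q\<^esub> a, s \<odot>\<^bsub>page r p q\<^esub> b) \<in> ?L" if "s \<in> carrier R" "(a,b) \<in> ?L" for s a b
    proof -
      have "a \<in> A (int r + 1) p q" "b = ?cl a" using that by auto
      then show ?thesis using that(1) S1.A(4) A1A S.quot_smult[of s a] by (auto simp: page_def)
    qed
  qed
  have "mod_iso R S1.quot Q.quot"
  proof (rule L.qmap_iso)
    show "b \<in> ?C \<Longrightarrow> \<exists>a. (a, b) \<in> ?L" for b unfolding ker by blast
    fix a b assume "(a, b) \<in> ?L" "b \<in> ?D"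
    then obtain a' where a: "a \<in> A (int r + 1) p q" "a' \<in> B (int r + 1) p q" "?cl a = ?cl a'"
      unfolding im by auto
    then have aa: "a \<in> A (int r) p q" "a' \<in> A (int r) p q" using A1A S1.BA by auto
    then have "a \<ominus>\<^bsub>D p q\<^esub> a' \<in> B (int r + 1) p q"
      using a S.quot_eq_iff B_mono[of "int r" "int r + 1" p q] by auto
    then have "(a \<ominus>\<^bsub>D p q\<^esub> a') \<oplus>\<^bsub>D p q\<^esub> a' \<in> B (int r + 1) p q" using a(2) S1.B(3) by blast
    then show "a \<in> B (int r + 1) p q"
      using S.A_carrier[OF aa(1)] S.A_carrier[OF aa(2)] by (simp add: S.M.M.minus_plus_cancel)
  qed
  then show ?thesis by (simp add: page_def add.commute)
qed

theorem ss_pages_page: "ss_pages R page dpage"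
  unfolding ss_pages_def using module_page dpage_lin dpage_dpage page_Suc_iso by blast

lemma page_trivial:
  assumes "\<not> (0 \<le> p \<and> 0 \<le> q)" shows "carrier (page r p q) = {\<zero>\<^bsub>page r p q\<^esub>}"
proof -
  interpret S: subquot R "D p q" "A (int r) p q" "B (int r) p q" by (rule page_subquot)
  have "A (int r) p q = {\<zero>\<^bsub>D p q\<^esub>}" using S.A(1,2) D_triv[OF assms] by blast
  then show ?thesis unfolding page_def S.carrier_quot S.quot_zero_coset by simp
qed

section \<open>The filtration of the limit and its graded pieces\<close>

definition cyc :: "int \<Rightarrow> int \<Rightarrow> 't set" where
  "cyc p n = {x \<in> G p n. d x = \<zero>\<^bsub>T\<^esub>}"

lemma sub_cyc: "submodule (cyc p n) R T"
  using submodule_preimage[OF d_lin modT modT subG submodule_zero_set[OF modT]] by (simp add: cyc_def)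

text \<open>The maps \<open>h n\<close> present \<open>H n\<close> as cycles modulo boundaries of
  the total complex, so that any model of its homology can be inserted. The filtration of
  \<open>H n\<close> is formed by the images of the cycles of filtration \<open>p\<close>.\<close>

lemma converging:
  assumes H: "\<And>n. module R (H n)"
    and h_cl: "\<And>n x. x \<in> cyc (int n) (int n) \<Longrightarrow> h n x \<in> carrier (H n)"
    and h_add: "\<And>n x y. x \<in> cyc (int n) (int n) \<Longrightarrow> y \<in> cyc (int n) (int n) \<Longrightarrow> h n (x \<oplus>\<^bsub>T\<^esub> y) = h n x \<oplus>\<^bsub>H n\<^esub> h n y"
    and h_smult: "\<And>n a x. a \<in> carrier R \<Longrightarrow> x \<in> cyc (int n) (int n) \<Longrightarrow> h n (a \<odot>\<^bsub>T\<^esub> x) = a \<odot>\<^bsub>H n\<^esub> h n x"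
    and h_onto: "\<And>n. h n ` cyc (int n) (int n) = carrier (H n)"
    and h_ker: "\<And>n x. x \<in> cyc (int n) (int n) \<Longrightarrow> h n x = \<zero>\<^bsub>H n\<^esub> \<longleftrightarrow> x \<in> d ` G (int n + 1) (int n + 1)"
    and E2: "\<And>p q. mod_iso R (page 2 (int p) (int q)) (E2 p q)"
  shows "converging_ss R page dpage E2 H"
  unfolding converging_ss_def
proof (intro conjI allI)
  show "ss_pages R page dpage" by (rule ss_pages_page)
  fix p q
  show "0 \<le> p \<and> 0 \<le> q \<longrightarrow> mod_iso R (page 2 p q) (E2 (nat p) (nat q))"
    using E2[of "nat p" "nat q"] by auto
  show "\<not> (0 \<le> p \<and> 0 \<le> q) \<longrightarrow> carrier (page 2 p q) = {\<zero>\<^bsub>page 2 p q\<^esub>}"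
    using page_trivial by blast
next
  fix n
  define \<Phi> where "\<Phi> p = h n ` cyc p (int n)" for p
  interpret H: module R "H n" by (rule H)
  have cyc_le: "cyc p (int n) \<subseteq> cyc (int n) (int n)" if "p \<le> int n" for p
    using G_mono[OF that] by (auto simp: cyc_def)
  have cyc_mono: "cyc (p - 1) (int n) \<subseteq> cyc p (int n)" for p
    using G_step by (auto simp: cyc_def)
  have h0: "h n \<zero>\<^bsub>T\<^esub> = \<zero>\<^bsub>H n\<^esub>"
    using h_ker[of "\<zero>\<^bsub>T\<^esub>" n] G(2) lin_maps_zero[OF d_lin modT modT] by (force simp: cyc_def)
  have sub\<Phi>: "submodule (\<Phi> p) R (H n)" if p: "p \<le> int n" for p
    unfolding \<Phi>_def
  proof (rule submoduleI'[OF H])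
    note cyc = submoduleD[OF sub_cyc modT]
    show "h n ` cyc p (int n) \<subseteq> carrier (H n)" using cyc_le[OF p] h_cl by blast
    show "\<zero>\<^bsub>H n\<^esub> \<in> h n ` cyc p (int n)" using h0 cyc(2) by (metis imageI)
    fix a b assume "a \<in> h n ` cyc p (int n)" "b \<in> h n ` cyc p (int n)"
    then obtain x y where "x \<in> cyc p (int n)" "y \<in> cyc p (int n)" "a = h n x" "b = h n y" by blast
    moreover from this have "a \<oplus>\<^bsub>H n\<^esub> b = h n (x \<oplus>\<^bsub>T\<^esub> y)" using h_add[of x n y] subsetD[OF cyc_le[OF p]] by simp
    ultimately show "a \<oplus>\<^bsub>H n\<^esub> b \<in> h n ` cyc p (int n)" using cyc(3) by simp
  next
    note cyc = submoduleD[OF sub_cyc modT]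
    fix r a assume "r \<in> carrier R" "a \<in> h n ` cyc p (int n)"
    then obtain x where "r \<in> carrier R" "x \<in> cyc p (int n)" "a = h n x" by blast
    moreover from this have "r \<odot>\<^bsub>H n\<^esub> a = h n (r \<odot>\<^bsub>T\<^esub> x)" using h_smult[of r x n] subsetD[OF cyc_le[OF p]] by simp
    ultimately show "r \<odot>\<^bsub>H n\<^esub> a \<in> h n ` cyc p (int n)" using cyc(4) by simp
  qed
  show "\<exists>\<Phi>. \<Phi> (-1) = {\<zero>\<^bsub>H n\<^esub>} \<and> \<Phi> (int n) = carrier (H n)
        \<and> (\<forall>p. 0 \<le> p \<and> p \<le> int n \<longrightarrow>
              submodule (\<Phi> p) R (H n) \<and> \<Phi> (p - 1) \<subseteq> \<Phi> p
            \<and> mod_iso R (quot_mod (H n) (\<Phi> p) (\<Phi> (p - 1))) (E_inf page p (int n - p)))"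
  proof (intro exI[of _ \<Phi>] conjI allI impI)
    show "\<Phi> (-1) = {\<zero>\<^bsub>H n\<^esub>}"
      using G_neg[of "-1" "int n"] lin_maps_zero[OF d_lin modT modT] h0 by (auto simp: \<Phi>_def cyc_def)
    show "\<Phi> (int n) = carrier (H n)" using h_onto by (simp add: \<Phi>_def)
    fix p assume p: "0 \<le> p \<and> p \<le> int n"
    show "submodule (\<Phi> p) R (H n)" using sub\<Phi> p by simp
    show mono: "\<Phi> (p - 1) \<subseteq> \<Phi> p" unfolding \<Phi>_def using cyc_mono by blast
    define q where "q = int n - p"
    \<comment> \<open>From \<open>r \<ge> p + 1\<close> the filtration \<open>p - r\<close> is
      negative, so \<open>Z r\<close> consists of cycles. From \<open>r \<ge> q + 2\<close> the
      filtration \<open>p + r - 1\<close> reaches the degree \<open>p + q + 1\<close>, so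
      \<open>B r\<close> sees every boundary.\<close>
    define r where "r = nat (max (p + 1) (q + 2))"
    have n: "int n = p + q" by (simp add: q_def)
    have r: "p - int r < 0" "p + q + 1 \<le> p + int r - 1" using p by (auto simp: r_def q_def)
    interpret S: subquot R "H n" "\<Phi> p" "\<Phi> (p - 1)"
      by (rule subquot.intro[OF H sub\<Phi> sub\<Phi> mono]) (use p in auto)
    interpret S': subquot R "D p q" "A (int r) p q" "B (int r) p q" by (rule page_subquot)
    have Zcyc: "Z (int r) p (p + q) = cyc p (int n)"
      using G_neg[OF r(1)] by (auto simp: Z_def cyc_def n)
    have Bd: "B (int r) p q = pr p q ` (d ` G (int n + 1) (int n + 1) \<inter> G p (int n))"
      using G_top[OF r(2)] by (auto simp: B_def Z_def n)
    let ?L = "(\<lambda>z. (h n z, pr p q z)) ` cyc p (int n)"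
    have cn: "z \<in> cyc (int n) (int n)" "z \<in> carrier T" if "z \<in> cyc p (int n)" for z
      using that cyc_le[of p] p G_carrier by (auto simp: cyc_def)
    \<comment> \<open>Both sides say that subtracting a boundary brings \<open>z\<close> into
      filtration \<open>p - 1\<close>.\<close>
    have key: "h n z \<in> \<Phi> (p - 1) \<longleftrightarrow> pr p q z \<in> B (int r) p q" if z: "z \<in> cyc p (int n)" for z
    proof
      assume "h n z \<in> \<Phi> (p - 1)"
      then obtain z' where z': "z' \<in> cyc (p - 1) (int n)" "h n z = h n z'" by (auto simp: \<Phi>_def)
      then have z'p: "z' \<in> cyc p (int n)" using cyc_mono by blast
      have m: "z \<ominus>\<^bsub>T\<^esub> z' \<in> cyc (int n) (int n)"
        using submodule_minus[OF sub_cyc modT] cn z z'p by blast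
      have "h n (z \<ominus>\<^bsub>T\<^esub> z') = \<zero>\<^bsub>H n\<^esub>"
      proof -
        have "h n z = h n ((z \<ominus>\<^bsub>T\<^esub> z') \<oplus>\<^bsub>T\<^esub> z')"
          using cn(2)[OF z] cn(2)[OF z'p] by (simp add: T.minus_plus_cancel)
        also have "\<dots> = h n (z \<ominus>\<^bsub>T\<^esub> z') \<oplus>\<^bsub>H n\<^esub> h n z'" using h_add m cn(1)[OF z'p] by blast
        finally show ?thesis using z'(2) h_cl[OF m] h_cl[OF cn(1)[OF z]] H.M.add.r_cancel_one' by metis
      qed
      then have "z \<ominus>\<^bsub>T\<^esub> z' \<in> d ` G (int n + 1) (int n + 1)" using h_ker[OF m] by blast
      moreover have zG: "z \<in> G p (p + q)" "z' \<in> G p (p + q)" using z z'p by (auto simp: cyc_def n)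
      moreover have "z \<ominus>\<^bsub>T\<^esub> z' \<in> G p (p + q)" using G(6) zG by blast
      moreover have "pr p q (z \<ominus>\<^bsub>T\<^esub> z') = pr p q z"
      proof -
        have "z \<ominus>\<^bsub>T\<^esub> z' \<ominus>\<^bsub>T\<^esub> z = \<ominus>\<^bsub>T\<^esub> z'" using cn(2)[OF z] cn(2)[OF z'p] by (simp add: T.minus_minus_cancel)
        then show ?thesis
          using zG G(6)[OF zG] z'(1) G(5) by (subst pr_eq_iff) (auto simp: cyc_def n)
      qed
      ultimately show "pr p q z \<in> B (int r) p q" unfolding Bd n by (metis IntI imageI)
    next
      assume "pr p q z \<in> B (int r) p q"
      then obtain y where y: "y \<in> G (int n + 1) (int n + 1)" "d y \<in> G p (p + q)" "pr p q z = pr p q (d y)"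
        unfolding Bd n by blast
      have zG: "z \<in> G p (p + q)" using z by (auto simp: cyc_def n)
      have dy: "d y \<in> cyc (int n) (int n)"
        using y(1,2) d_d[OF G_carrier[OF y(1)]] p G_mono[of p "int n"] by (auto simp: cyc_def n)
      have "z \<ominus>\<^bsub>T\<^esub> d y \<in> G (p - 1) (p + q)" using pr_eq_iff zG y by blast
      then have w: "z \<ominus>\<^bsub>T\<^esub> d y \<in> cyc (p - 1) (int n)"
        using z dy cn(2)[OF z] G_carrier[OF y(2)]
        by (auto simp: cyc_def n lin_maps_minus[OF d_lin modT modT] T.minus_zero_right)
      then have w': "z \<ominus>\<^bsub>T\<^esub> d y \<in> cyc (int n) (int n)" using cyc_mono cn by blast
      have "h n z = h n ((z \<ominus>\<^bsub>T\<^esub> d y) \<oplus>\<^bsub>T\<^esub> d y)"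
        using cn(2)[OF z] G_carrier[OF y(2)] by (simp add: T.minus_plus_cancel)
      also have "\<dots> = h n (z \<ominus>\<^bsub>T\<^esub> d y) \<oplus>\<^bsub>H n\<^esub> h n (d y)" using h_add w' dy by blast
      also have "h n (d y) = \<zero>\<^bsub>H n\<^esub>" using h_ker[OF dy] y(1) by blast
      finally show "h n z \<in> \<Phi> (p - 1)" using w h_cl[OF w'] by (auto simp: \<Phi>_def)
    qed
    interpret L: subquot_rel R "H n" "\<Phi> p" "\<Phi> (p - 1)" "D p q" "A (int r) p q" "B (int r) p q" ?L
    proof unfold_locales
      show "?L \<subseteq> \<Phi> p \<times> A (int r) p q" unfolding \<Phi>_def A_def Zcyc by blast
      show "a \<in> \<Phi> p \<Longrightarrow> \<exists>b. (a, b) \<in> ?L" for a unfolding \<Phi>_def by blast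
      show "(a, b) \<in> ?L \<Longrightarrow> a \<in> \<Phi> (p - 1) \<Longrightarrow> b \<in> B (int r) p q" for a b using key by blast
      show "(a \<oplus>\<^bsub>H n\<^esub> a', b \<oplus>\<^bsub>D p q\<^esub> b') \<in> ?L" if "(a,b) \<in> ?L" "(a',b') \<in> ?L" for a b a' b'
      proof -
        obtain x x' where "x \<in> cyc p (int n)" "a = h n x" "b = pr p q x"
          "x' \<in> cyc p (int n)" "a' = h n x'" "b' = pr p q x'" using \<open>(a,b) \<in> ?L\<close> \<open>(a',b') \<in> ?L\<close> by blast
        then show ?thesis using submodule_add[OF sub_cyc modT] cn
          by (auto simp: h_add[symmetric] lin_maps_add[OF pr_lin, symmetric])
      qed
      show "(s \<odot>\<^bsub>H n\<^esub> a, s \<odot>\<^bsub>D p q\<^esub> b) \<in> ?L" if "s \<in> carrier R" "(a,b) \<in> ?L" for s a b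
      proof -
        obtain x where "x \<in> cyc p (int n)" "a = h n x" "b = pr p q x" using \<open>(a,b) \<in> ?L\<close> by blast
        then show ?thesis using submodule_smult[OF sub_cyc modT \<open>s \<in> carrier R\<close>] cn \<open>s \<in> carrier R\<close>
          by (auto simp: h_smult[symmetric] lin_maps_smult[OF pr_lin, symmetric])
      qed
    qed
    have "mod_iso R S.quot S'.quot"
    proof (rule L.qmap_iso)
      show "b \<in> A (int r) p q \<Longrightarrow> \<exists>a. (a, b) \<in> ?L" for b unfolding A_def Zcyc by blast
      show "(a, b) \<in> ?L \<Longrightarrow> b \<in> B (int r) p q \<Longrightarrow> a \<in> \<Phi> (p - 1)" for a b using key by blast
    qed
    then show "mod_iso R (quot_mod (H n) (\<Phi> p) (\<Phi> (p - 1))) (E_inf page p (int n - p))"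
      by (simp add: E_inf_def page_def r_def q_def)
  qed
qed

end

section \<open>Chain modules of a sheaf\<close>

text \<open>One construction serves for chain modules, where the index set is finite and the product
  is the direct sum, and for the total complex, indexed by all pairs of integers. The value
  \<open>undefined\<close> off \<open>I\<close> makes elements equal as soon as they agree on
  \<open>I\<close>.\<close>

definition pi_mod :: "'i set \<Rightarrow> ('i \<Rightarrow> ('r,'m) module) \<Rightarrow> ('r, 'i \<Rightarrow> 'm) module" where
  "pi_mod I M = \<lparr>carrier = {s. (\<forall>i\<in>I. s i \<in> carrier (M i)) \<and> (\<forall>i. i \<notin> I \<longrightarrow> s i = undefined)},
     monoid.mult = (\<lambda>s t. undefined), one = undefined,
     zero = (\<lambda>i. if i \<in> I then \<zero>\<^bsub>M i\<^esub> else undefined),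
     add = (\<lambda>s t i. if i \<in> I then s i \<oplus>\<^bsub>M i\<^esub> t i else undefined),
     smult = (\<lambda>a s i. if i \<in> I then a \<odot>\<^bsub>M i\<^esub> s i else undefined)\<rparr>"

lemma chain_mod_eq_pi_mod: "chain_mod Q G n = pi_mod (chains Q n) (\<lambda>\<sigma>. G (hd \<sigma>))"
  by (simp add: chain_mod_def pi_mod_def)

definition pgen :: "'i set \<Rightarrow> ('i \<Rightarrow> ('r,'m) module) \<Rightarrow> 'i \<Rightarrow> 'm \<Rightarrow> 'i \<Rightarrow> 'm" where
  "pgen I M i m = (\<lambda>j. if j \<in> I then (if j = i then m else \<zero>\<^bsub>M j\<^esub>) else undefined)"

lemma gen_eq_pgen: "gen Q G n \<sigma> m = pgen (chains Q n) (\<lambda>\<sigma>. G (hd \<sigma>)) \<sigma> m"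
  by (simp add: gen_def pgen_def)

lemma pi_mod_simps [simp]:
  "s \<in> carrier (pi_mod I M) \<longleftrightarrow> (\<forall>i\<in>I. s i \<in> carrier (M i)) \<and> (\<forall>i. i \<notin> I \<longrightarrow> s i = undefined)"
  "\<zero>\<^bsub>pi_mod I M\<^esub> = (\<lambda>i. if i \<in> I then \<zero>\<^bsub>M i\<^esub> else undefined)"
  "s \<oplus>\<^bsub>pi_mod I M\<^esub> t = (\<lambda>i. if i \<in> I then s i \<oplus>\<^bsub>M i\<^esub> t i else undefined)"
  "a \<odot>\<^bsub>pi_mod I M\<^esub> s = (\<lambda>i. if i \<in> I then a \<odot>\<^bsub>M i\<^esub> s i else undefined)"
  by (auto simp: pi_mod_def)

locale pi_module =
  fixes R :: "'r ring" and I :: "'i set" and M :: "'i \<Rightarrow> ('r,'m) module"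
  assumes cringR: "cring R" and modM: "\<And>i. i \<in> I \<Longrightarrow> module R (M i)"
begin

lemma module_pi: "module R (pi_mod I M)"
proof (rule moduleI)
  note am = abelian_group.axioms(1)[OF module.axioms(2)[OF modM]]
  note ab = abelian_monoid.a_closed[OF am] abelian_monoid.zero_closed[OF am] abelian_monoid.a_assoc[OF am]
    abelian_monoid.a_comm[OF am] abelian_monoid.a_lcomm[OF am] abelian_monoid.l_zero[OF am] abelian_monoid.r_zero[OF am]
  show "cring R" by (rule cringR)
  show "abelian_group (pi_mod I M)"
  proof (rule abelian_groupI)
    fix x assume "x \<in> carrier (pi_mod I M)"
    then have x: "x i \<in> carrier (M i)" if "i \<in> I" for i using that by simp
    let ?y = "\<lambda>i. if i \<in> I then \<ominus>\<^bsub>M i\<^esub> x i else undefined"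
    have "?y \<in> carrier (pi_mod I M)"
      using x abelian_group.a_inv_closed[OF module.axioms(2)[OF modM]] by simp
    moreover have "?y \<oplus>\<^bsub>pi_mod I M\<^esub> x = \<zero>\<^bsub>pi_mod I M\<^esub>"
      using x abelian_group.l_neg[OF module.axioms(2)[OF modM]] by auto
    ultimately show "\<exists>y\<in>carrier (pi_mod I M). y \<oplus>\<^bsub>pi_mod I M\<^esub> x = \<zero>\<^bsub>pi_mod I M\<^esub>" by blast
  qed (auto simp: ab fun_eq_iff)
qed (auto simp: fun_eq_iff module.smult_closed[OF modM] module.smult_l_distr[OF modM] module.smult_r_distr[OF modM]
    module.smult_assoc1[OF modM] module.smult_one[OF modM])

lemma eval_lin: "i \<in> I \<Longrightarrow> (\<lambda>s. s i) \<in> lin_maps R (pi_mod I M) (M i)"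
  by (rule lin_mapsI) auto

lemma pi_eqI: "s \<in> carrier (pi_mod I M) \<Longrightarrow> t \<in> carrier (pi_mod I M) \<Longrightarrow> (\<And>i. i \<in> I \<Longrightarrow> s i = t i) \<Longrightarrow> s = t"
  by (auto simp: fun_eq_iff) metis

lemma pgen_lin: assumes "i \<in> I" shows "pgen I M i \<in> lin_maps R (M i) (pi_mod I M)"
proof (rule lin_mapsI)
  note cl = abelian_groupE[OF module.axioms(2)[OF modM]]
  note l0 = abelian_monoid.l_zero[OF abelian_group.axioms(1)[OF module.axioms(2)[OF modM]]]
  show "pgen I M i x \<in> carrier (pi_mod I M)" if "x \<in> carrier (M i)" for x
    using that assms cl(2) by (auto simp: pgen_def)
  show "pgen I M i (x \<oplus>\<^bsub>M i\<^esub> y) = pgen I M i x \<oplus>\<^bsub>pi_mod I M\<^esub> pgen I M i y" for x y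
    by (auto simp: fun_eq_iff pgen_def l0 cl)
  show "pgen I M i (a \<odot>\<^bsub>M i\<^esub> x) = a \<odot>\<^bsub>pi_mod I M\<^esub> pgen I M i x" if "a \<in> carrier R" for a x
    using that by (auto simp: fun_eq_iff pgen_def module.smult_r_null[OF modM])
qed

lemma pi_finsum_eval:
  assumes "\<And>j. j \<in> A \<Longrightarrow> f j \<in> carrier (pi_mod I M)" "i \<in> I"
  shows "finsum (pi_mod I M) f A i = finsum (M i) (\<lambda>j. f j i) A"
  by (rule lin_maps_finsum[OF eval_lin[OF assms(2)] module_pi modM[OF assms(2)] assms(1)])

lemma pi_decomp:
  assumes "finite I" "s \<in> carrier (pi_mod I M)"
  shows "s = finsum (pi_mod I M) (\<lambda>j. pgen I M j (s j)) I"
proof -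
  interpret P: module R "pi_mod I M" by (rule module_pi)
  have g: "pgen I M j (s j) \<in> carrier (pi_mod I M)" if "j \<in> I" for j
    using assms(2) that by (intro lin_maps_closed[OF pgen_lin]) auto
  show ?thesis
  proof (rule pi_eqI)
    show "s \<in> carrier (pi_mod I M)" by fact
    show "finsum (pi_mod I M) (\<lambda>j. pgen I M j (s j)) I \<in> carrier (pi_mod I M)"
      using g by (intro P.finsum_closed) auto
    fix i assume i: "i \<in> I"
    interpret Mi: module R "M i" by (rule modM[OF i])
    have "finsum (pi_mod I M) (\<lambda>j. pgen I M j (s j)) I i = finsum (M i) (\<lambda>j. pgen I M j (s j) i) I"
      by (rule pi_finsum_eval[OF g i])
    also have "\<dots> = finsum (M i) (\<lambda>j. if i = j then s i else \<zero>\<^bsub>M i\<^esub>) I"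
      using assms(2) i by (intro Mi.finsum_cong') (auto simp: pgen_def)
    also have "\<dots> = s i" using assms i by (intro Mi.finsum_singleton) auto
    finally show "s i = finsum (pi_mod I M) (\<lambda>j. pgen I M j (s j)) I i" by simp
  qed
qed

text \<open>Every element is the finite sum of its components by \<open>pi_decomp\<close>. Together
  with \<open>linext_lin\<close> and \<open>linext_pgen\<close> this is the universal property of
  the direct sum, by which maps of chain modules are built and compared on generators.\<close>

lemma lin_maps_eqI:
  assumes "finite I" "f \<in> lin_maps R (pi_mod I M) N" "g \<in> lin_maps R (pi_mod I M) N" "module R N"
    and "\<And>i m. i \<in> I \<Longrightarrow> m \<in> carrier (M i) \<Longrightarrow> f (pgen I M i m) = g (pgen I M i m)"
    and s: "s \<in> carrier (pi_mod I M)"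
  shows "f s = g s"
proof -
  interpret N: module R N by fact
  have c: "pgen I M j (s j) \<in> carrier (pi_mod I M)" if "j \<in> I" for j
    using s that by (intro lin_maps_closed[OF pgen_lin]) auto
  have "f s = finsum N (\<lambda>j. f (pgen I M j (s j))) I"
    by (subst pi_decomp[OF assms(1) s]) (rule lin_maps_finsum[OF assms(2) module_pi assms(4) c])
  also have "\<dots> = finsum N (\<lambda>j. g (pgen I M j (s j))) I"
    using s lin_maps_closed[OF assms(3) c] by (intro N.finsum_cong') (auto simp: assms(5))
  also have "\<dots> = g s"
    by (subst (2) pi_decomp[OF assms(1) s]) (rule lin_maps_finsum[OF assms(3) module_pi assms(4) c, symmetric])
  finally show ?thesis .
qed

lemma linext_lin:
  assumes "module R N" "\<And>i. i \<in> I \<Longrightarrow> b i \<in> lin_maps R (M i) N"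
  shows "(\<lambda>s. finsum N (\<lambda>i. b i (s i)) I) \<in> lin_maps R (pi_mod I M) N"
  by (rule lin_maps_sum[OF lin_maps_comp[OF eval_lin assms(2)] module_pi assms(1)])

lemma linext_pgen:
  assumes "finite I" "module R N" "\<And>i. i \<in> I \<Longrightarrow> b i \<in> lin_maps R (M i) N" "i \<in> I" "m \<in> carrier (M i)"
  shows "finsum N (\<lambda>j. b j (pgen I M i m j)) I = b i m"
proof -
  interpret N: module R N by fact
  have "finsum N (\<lambda>j. b j (pgen I M i m j)) I = finsum N (\<lambda>j. if i = j then b j m else \<zero>\<^bsub>N\<^esub>) I"
    using assms(4,5) lin_maps_closed[OF assms(3)] lin_maps_zero[OF assms(3) modM assms(2)]
    by (intro N.finsum_cong') (auto simp: pgen_def)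
  also have "\<dots> = finsum N (\<lambda>j. if i = j then b i m else \<zero>\<^bsub>N\<^esub>) I"
    using lin_maps_closed[OF assms(3)] assms(4,5) by (intro N.finsum_cong') auto
  also have "\<dots> = b i m" using assms lin_maps_closed[OF assms(3)[OF assms(4)]]
    by (intro N.finsum_singleton) auto
  finally show ?thesis .
qed

end

section \<open>Signs and alternating sums\<close>

definition sg :: "('r,'m) module \<Rightarrow> nat \<Rightarrow> 'm \<Rightarrow> 'm" where
  "sg M i x = (if even i then x else \<ominus>\<^bsub>M\<^esub> x)"

lemma sg_lin: "module R M \<Longrightarrow> sg M i \<in> lin_maps R M M"
  unfolding sg_def using lin_maps_neg[OF lin_maps_id] lin_maps_id by (cases "even i") auto

lemma sg_nat: "f \<in> lin_maps R M N \<Longrightarrow> module R M \<Longrightarrow> module R N \<Longrightarrow> x \<in> carrier M \<Longrightarrow> f (sg M i x) = sg N i (f x)"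
  by (simp add: sg_def lin_maps_uminus)

lemma sg_0 [simp]: "sg M 0 x = x" by (simp add: sg_def)

lemma sg_closed: "module (R :: 'r ring) M \<Longrightarrow> x \<in> carrier M \<Longrightarrow> sg M i x \<in> carrier M"
  by (rule lin_maps_closed[OF sg_lin])

lemma sg_Suc: "module R M \<Longrightarrow> x \<in> carrier M \<Longrightarrow> sg M (Suc i) x = \<ominus>\<^bsub>M\<^esub> sg M i x"
  using abelian_group.minus_minus[OF module.axioms(2), of R M x] by (auto simp: sg_def)

lemma sg_sg: "module R M \<Longrightarrow> x \<in> carrier M \<Longrightarrow> sg M i (sg M j x) = sg M (i + j) x"
  using abelian_group.minus_minus[OF module.axioms(2), of R M x] by (auto simp: sg_def)

lemma sg_commute: "module R M \<Longrightarrow> x \<in> carrier M \<Longrightarrow> sg M i (sg M j x) = sg M j (sg M i x)"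
  by (simp add: sg_sg[of R] add.commute)

lemma sg_finsum:
  fixes R :: "'r ring"
  assumes "module R M" "\<And>i. i \<in> A \<Longrightarrow> g i \<in> carrier M"
  shows "sg M k (finsum M g A) = finsum M (\<lambda>i. sg M k (g i)) A"
  by (rule lin_maps_finsum[OF sg_lin[OF assms(1)] assms(1,1) assms(2)])

text \<open>This is the argument for \<open>d d = 0\<close> stripped of chains: \<open>g i j\<close>
  stands for face \<open>i\<close> of face \<open>j\<close>, and the simplicial identity matches the
  term at \<open>(i, j)\<close> with \<open>i < j\<close> to the term at \<open>(j - 1, i)\<close>,
  which has the opposite sign.\<close>

lemma simplicial_cancel:
  fixes R :: "'r ring"
  assumes "module R M" "\<And>i j. g i j \<in> carrier M"
    and "\<And>i j. i < j \<Longrightarrow> j \<le> Suc n \<Longrightarrow> g i j = g (j - 1) i"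
  shows "finsum M (\<lambda>j. sg M j (finsum M (\<lambda>i. sg M i (g i j)) {..n})) {..Suc n} = \<zero>\<^bsub>M\<^esub>"
  using assms(3)
proof (induction n)
  interpret M: module R M by fact
  note cl = sg_closed[OF assms(1)]
  case 0
  have "g 0 1 = g 0 0" using 0[of 0 1] by simp
  then show ?case using assms(2) by (simp add: cl M.finsum_insert Pi_def sg_Suc[OF assms(1)] M.l_neg)
next
  interpret M: module R M by fact
  note cl = sg_closed[OF assms(1)]
  case (Suc n)
  let ?f = "\<lambda>j. finsum M (\<lambda>i. sg M i (g i j)) {..n}"
  \<comment> \<open>Up to one common sign, \<open>?X\<close> is the contribution of the new row
    \<open>i = n + 1\<close>. By the identity the new column \<open>j = n + 2\<close> also sums to
    \<open>?X\<close>, with the opposite sign, and the induction hypothesis disposes of the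
    rest.\<close>
  let ?X = "finsum M (\<lambda>j. sg M j (g (Suc n) j)) {..Suc n}"
  have fc: "?f j \<in> carrier M" for j using assms(2) cl by (intro M.finsum_closed) auto
  have Xc: "?X \<in> carrier M" using assms(2) cl by (intro M.finsum_closed) auto
  have 1: "finsum M (\<lambda>i. sg M i (g i j)) {..Suc n} = sg M (Suc n) (g (Suc n) j) \<oplus>\<^bsub>M\<^esub> ?f j" for j
    using assms(2) cl by (intro M.finsum_Suc) auto
  have 2: "finsum M (\<lambda>i. sg M i (g i (Suc (Suc n)))) {..Suc n} = ?X"
    using assms(2) cl by (intro M.finsum_cong') (auto simp: Suc.prems)
  have "finsum M (\<lambda>j. sg M j (finsum M (\<lambda>i. sg M i (g i j)) {..Suc n})) {..Suc (Suc n)}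
     = sg M (Suc (Suc n)) ?X \<oplus>\<^bsub>M\<^esub> finsum M (\<lambda>j. sg M j (sg M (Suc n) (g (Suc n) j) \<oplus>\<^bsub>M\<^esub> ?f j)) {..Suc n}"
    unfolding 1[symmetric] 2[symmetric]
    using assms(2) cl fc by (intro M.finsum_Suc) (auto simp: 1)
  also have "finsum M (\<lambda>j. sg M j (sg M (Suc n) (g (Suc n) j) \<oplus>\<^bsub>M\<^esub> ?f j)) {..Suc n}
    = finsum M (\<lambda>j. sg M (Suc n) (sg M j (g (Suc n) j)) \<oplus>\<^bsub>M\<^esub> sg M j (?f j)) {..Suc n}"
    using assms(2) cl fc by (intro M.finsum_cong')
      (auto simp: lin_maps_add[OF sg_lin[OF assms(1)]] sg_commute[OF assms(1)])
  also have "\<dots> = finsum M (\<lambda>j. sg M (Suc n) (sg M j (g (Suc n) j))) {..Suc n} \<oplus>\<^bsub>M\<^esub> finsum M (\<lambda>j. sg M j (?f j)) {..Suc n}"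
    using assms(2) cl fc by (intro M.finsum_addf) auto
  also have "finsum M (\<lambda>j. sg M j (?f j)) {..Suc n} = \<zero>\<^bsub>M\<^esub>"
    by (rule Suc.IH) (use Suc.prems in auto)
  also have "finsum M (\<lambda>j. sg M (Suc n) (sg M j (g (Suc n) j))) {..Suc n} = sg M (Suc n) ?X"
    using assms(2) cl by (intro sg_finsum[OF assms(1), symmetric]) auto
  finally show ?case using Xc cl by (simp add: sg_Suc[OF assms(1), of _ "Suc n"] M.l_neg)
qed

section \<open>Chains, faces and the boundary on generators\<close>

lemma chains_altdef: "chains Q n = {\<sigma>. length \<sigma> = Suc n \<and> set \<sigma> \<subseteq> Q \<and> sorted_wrt (\<ge>) \<sigma>}"
proof -
  have "transp ((\<ge>) :: 'a \<Rightarrow> 'a \<Rightarrow> bool)" by (auto intro: transpI)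
  then show ?thesis by (auto simp: chains_def sorted_wrt_iff_nth_Suc_transp)
qed

lemma finite_chains: "finite Q \<Longrightarrow> finite (chains Q n)"
  by (rule finite_subset[OF _ finite_lists_length_eq[of Q "Suc n"]]) (auto simp: chains_altdef)

lemma chains_mono: "Q' \<subseteq> Q \<Longrightarrow> chains Q' n \<subseteq> chains Q n"
  by (auto simp: chains_altdef)

lemma chains_hd: "\<sigma> \<in> chains Q n \<Longrightarrow> hd \<sigma> \<in> Q"
  by (cases \<sigma>) (auto simp: chains_altdef)

lemma chains_face:
  assumes "\<sigma> \<in> chains Q (Suc n)" "i \<le> Suc n" shows "face i \<sigma> \<in> chains Q n"
proof -
  have i: "i < length \<sigma>" using assms by (auto simp: chains_altdef)
  have "sorted_wrt (\<ge>) (take i \<sigma> @ \<sigma> ! i # drop (Suc i) \<sigma>)"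
    using assms id_take_nth_drop[OF i] by (simp add: chains_altdef)
  moreover have "set (face i \<sigma>) \<subseteq> set \<sigma>"
    using set_take_subset set_drop_subset by (fastforce simp: face_def)
  ultimately show ?thesis using assms i
    by (auto simp: chains_altdef face_def sorted_wrt_append)
qed

lemma face_0: "face 0 \<sigma> = tl \<sigma>" by (simp add: face_def drop_Suc)

lemma face_Suc_Cons: "face (Suc i) (x # \<sigma>) = x # face i \<sigma>" by (simp add: face_def)

lemma face_face:
  assumes "i < j" "j < length \<sigma>" shows "face i (face j \<sigma>) = face (j - 1) (face i \<sigma>)"
  using assms
proof (induction i arbitrary: j \<sigma>)
  case 0
  then show ?case by (cases \<sigma>; cases j) (auto simp: face_0 face_Suc_Cons)
next
  case (Suc i)
  then obtain x \<tau> k where e: "\<sigma> = x # \<tau>" "j = Suc k" by (cases \<sigma>; cases j) auto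
  then obtain l where "k = Suc l" using Suc.prems by (cases k) auto
  then show ?case using Suc e by (auto simp: face_Suc_Cons)
qed

lemma hd_face_Suc: "\<sigma> \<noteq> [] \<Longrightarrow> hd (face (Suc i) \<sigma>) = hd \<sigma>"
  by (cases \<sigma>) (auto simp: face_Suc_Cons)

lemma hd_face_0: "Suc 0 < length \<sigma> \<Longrightarrow> hd (face 0 \<sigma>) = \<sigma> ! 1"
  by (cases \<sigma>) (auto simp: face_0 hd_conv_nth)

locale poset_sheaf =
  fixes R :: "'r ring" and Q :: "'a::order set" and G :: "'a \<Rightarrow> ('r,'m) module" and rho
  assumes cringR: "cring R" and finQ: "finite Q" and sheaf: "is_sheaf R Q G rho"
begin

lemma modG: "x \<in> Q \<Longrightarrow> module R (G x)"
  and rho_lin: "x \<in> Q \<Longrightarrow> y \<in> Q \<Longrightarrow> x \<le> y \<Longrightarrow> rho y x \<in> lin_maps R (G y) (G x)"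
  and rho_id: "x \<in> Q \<Longrightarrow> s \<in> carrier (G x) \<Longrightarrow> rho x x s = s"
  and rho_comp: "x \<in> Q \<Longrightarrow> y \<in> Q \<Longrightarrow> z \<in> Q \<Longrightarrow> x \<le> y \<Longrightarrow> y \<le> z \<Longrightarrow> s \<in> carrier (G z) \<Longrightarrow> rho y x (rho z y s) = rho z x s"
  using sheaf unfolding is_sheaf_def by auto

lemma fin: "finite (chains Q n)" by (rule finite_chains[OF finQ])

sublocale pi: pi_module R "chains Q n" "\<lambda>\<sigma>. G (hd \<sigma>)" for n
  by (rule pi_module.intro[OF cringR modG[OF chains_hd]])

abbreviation "CM n \<equiv> chain_mod Q G n"
abbreviation "gn n \<equiv> gen Q G n"

lemma module_CM: "module R (CM n)"
  unfolding chain_mod_eq_pi_mod by (rule pi.module_pi)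

lemma gen_lin: "\<sigma> \<in> chains Q n \<Longrightarrow> gn n \<sigma> \<in> lin_maps R (G (hd \<sigma>)) (CM n)"
  using pi.pgen_lin unfolding chain_mod_eq_pi_mod gen_eq_pgen[abs_def] .

lemma gen_closed: "\<sigma> \<in> chains Q n \<Longrightarrow> m \<in> carrier (G (hd \<sigma>)) \<Longrightarrow> gn n \<sigma> m \<in> carrier (CM n)"
  by (rule lin_maps_closed[OF gen_lin])

lemma CM_lin_eqI:
  assumes "f \<in> lin_maps R (CM n) N" "g \<in> lin_maps R (CM n) N" "module R N"
    and "\<And>\<sigma> m. \<sigma> \<in> chains Q n \<Longrightarrow> m \<in> carrier (G (hd \<sigma>)) \<Longrightarrow> f (gn n \<sigma> m) = g (gn n \<sigma> m)"
    and "s \<in> carrier (CM n)"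
  shows "f s = g s"
  using pi.lin_maps_eqI[OF fin assms[unfolded chain_mod_eq_pi_mod gen_eq_pgen[abs_def]]] by blast

lemma CM_linext_lin:
  assumes "module R N" "\<And>\<sigma>. \<sigma> \<in> chains Q n \<Longrightarrow> b \<sigma> \<in> lin_maps R (G (hd \<sigma>)) N"
  shows "(\<lambda>s. finsum N (\<lambda>\<sigma>. b \<sigma> (s \<sigma>)) (chains Q n)) \<in> lin_maps R (CM n) N"
  using pi.linext_lin[OF assms] unfolding chain_mod_eq_pi_mod .

lemma CM_linext_gen:
  assumes "module R N" "\<And>\<sigma>. \<sigma> \<in> chains Q n \<Longrightarrow> b \<sigma> \<in> lin_maps R (G (hd \<sigma>)) N"
    "\<sigma> \<in> chains Q n" "m \<in> carrier (G (hd \<sigma>))"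
  shows "finsum N (\<lambda>\<tau>. b \<tau> (gn n \<sigma> m \<tau>)) (chains Q n) = b \<sigma> m"
  using pi.linext_pgen[OF fin assms] unfolding gen_eq_pgen .

text \<open>With this coefficient the face of index 0 takes the same shape as the others, so that
  the boundary becomes a single alternating sum, ready for \<open>simplicial_cancel\<close>.\<close>

definition cf :: "nat \<Rightarrow> 'a list \<Rightarrow> 'm \<Rightarrow> 'm" where
  "cf i \<sigma> m = (if i = 0 then rho (\<sigma> ! 0) (\<sigma> ! 1) m else m)"

lemma chains_nth:
  assumes "\<sigma> \<in> chains Q n" "i \<le> n" shows "\<sigma> ! i \<in> Q"
  using assms by (auto simp: chains_altdef)

lemma chains_nth_le:
  assumes "\<sigma> \<in> chains Q n" "i \<le> j" "j \<le> n" shows "\<sigma> ! j \<le> \<sigma> ! i"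
  using assms by (cases "i = j") (auto simp: chains_altdef sorted_wrt_iff_nth_less)

lemma cf_lin:
  assumes "\<sigma> \<in> chains Q (Suc n)" "i \<le> Suc n"
  shows "cf i \<sigma> \<in> lin_maps R (G (hd \<sigma>)) (G (hd (face i \<sigma>)))"
proof (cases i)
  case 0
  have "\<sigma> \<noteq> []" "Suc 0 < length \<sigma>" using assms by (auto simp: chains_altdef)
  then show ?thesis using rho_lin[OF chains_nth[OF assms(1), of 1] chains_nth[OF assms(1), of 0] chains_nth_le[OF assms(1)]]
    by (simp add: 0 cf_def[abs_def] hd_face_0 hd_conv_nth)
next
  case (Suc k)
  have "\<sigma> \<noteq> []" using assms by (auto simp: chains_altdef)
  then show ?thesis using Suc by (simp add: cf_def[abs_def] hd_face_Suc lin_maps_id)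
qed

lemma cf_closed:
  assumes "\<sigma> \<in> chains Q (Suc n)" "i \<le> Suc n" "m \<in> carrier (G (hd \<sigma>))"
  shows "cf i \<sigma> m \<in> carrier (G (hd (face i \<sigma>)))"
  by (rule lin_maps_closed[OF cf_lin[OF assms(1,2)] assms(3)])

definition bd :: "nat \<Rightarrow> 'a list \<Rightarrow> 'm \<Rightarrow> 'a list \<Rightarrow> 'm" where
  "bd n \<sigma> m = finsum (CM n) (\<lambda>i. sg (CM n) i (gn n (face i \<sigma>) (cf i \<sigma> m))) {..Suc n}"

lemma bd_term_lin:
  assumes "\<sigma> \<in> chains Q (Suc n)" "i \<le> Suc n"
  shows "(\<lambda>m. sg (CM n) i (gn n (face i \<sigma>) (cf i \<sigma> m))) \<in> lin_maps R (G (hd \<sigma>)) (CM n)"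
  using lin_maps_comp[OF lin_maps_comp[OF cf_lin[OF assms] gen_lin[OF chains_face[OF assms]]] sg_lin[OF module_CM]] .

lemma bd_lin: assumes "\<sigma> \<in> chains Q (Suc n)" shows "bd n \<sigma> \<in> lin_maps R (G (hd \<sigma>)) (CM n)"
  unfolding bd_def[abs_def]
  by (rule lin_maps_sum[OF bd_term_lin[OF assms] modG[OF chains_hd[OF assms]] module_CM]) auto

text \<open>Linearity reduces the image of a boundary to the images of single faces. The proofs of
  \<open>d d = 0\<close>, of naturality and of the cone homotopy all pass through this.\<close>

lemma lin_maps_bd:
  assumes f: "f \<in> lin_maps R (CM n) M" and M: "module R M"
    and \<sigma>: "\<sigma> \<in> chains Q (Suc n)" and m: "m \<in> carrier (G (hd \<sigma>))"
    and g: "\<And>i. i \<le> Suc n \<Longrightarrow> f (gn n (face i \<sigma>) (cf i \<sigma> m)) = g i"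
  shows "f (bd n \<sigma> m) = finsum M (\<lambda>i. sg M i (g i)) {..Suc n}"
proof -
  interpret M: module R M by fact
  have tc: "gn n (face i \<sigma>) (cf i \<sigma> m) \<in> carrier (CM n)" if "i \<le> Suc n" for i
    by (rule gen_closed[OF chains_face[OF \<sigma> that] cf_closed[OF \<sigma> that m]])
  have gc: "g i \<in> carrier M" if "i \<le> Suc n" for i
    using lin_maps_closed[OF f tc[OF that]] g[OF that] by simp
  have "f (bd n \<sigma> m) = finsum M (\<lambda>i. f (sg (CM n) i (gn n (face i \<sigma>) (cf i \<sigma> m)))) {..Suc n}"
    unfolding bd_def by (rule lin_maps_finsum[OF f module_CM M]) (auto intro!: sg_closed[OF module_CM] tc)
  also have "\<dots> = finsum M (\<lambda>i. sg M i (g i)) {..Suc n}"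
    using gc sg_closed[OF M] by (intro M.finsum_cong') (auto simp: sg_nat[OF f module_CM M tc] g)
  finally show ?thesis .
qed

text \<open>Passes from the given boundary, in which the face of index 0 stands apart, to the
  uniform alternating sum \<open>bd\<close>.\<close>

lemma bdry_eq:
  assumes "s \<in> carrier (CM (Suc n))"
  shows "bdry Q G rho n s = finsum (CM n) (\<lambda>\<sigma>. bd n \<sigma> (s \<sigma>)) (chains Q (Suc n))"
proof -
  interpret C: module R "CM n" by (rule module_CM)
  have sc: "s \<sigma> \<in> carrier (G (hd \<sigma>))" if "\<sigma> \<in> chains Q (Suc n)" for \<sigma>
    using assms that by (simp add: chain_mod_eq_pi_mod)
  have "bd n \<sigma> (s \<sigma>) = gn n (face 0 \<sigma>) (rho (\<sigma> ! 0) (\<sigma> ! 1) (s \<sigma>))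
          \<oplus>\<^bsub>CM n\<^esub> finsum (CM n)
            (\<lambda>i. if even i then gn n (face i \<sigma>) (s \<sigma>) else \<ominus>\<^bsub>CM n\<^esub> gn n (face i \<sigma>) (s \<sigma>)) {1..Suc n}"
    if \<sigma>: "\<sigma> \<in> chains Q (Suc n)" for \<sigma>
  proof -
    let ?t = "\<lambda>i. sg (CM n) i (gn n (face i \<sigma>) (cf i \<sigma> (s \<sigma>)))"
    have t: "?t i \<in> carrier (CM n)" if "i \<le> Suc n" for i
      using lin_maps_closed[OF bd_term_lin[OF \<sigma> that] sc[OF \<sigma>]] .
    have "{..Suc n} = insert 0 {1..Suc n}" by auto
    then have "bd n \<sigma> (s \<sigma>) = finsum (CM n) ?t (insert 0 {1..Suc n})" by (simp only: bd_def)
    also have "\<dots> = ?t 0 \<oplus>\<^bsub>CM n\<^esub> finsum (CM n) ?t {1..Suc n}"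
      by (rule C.finsum_insert) (use t[of 0] t in auto)
    also have "finsum (CM n) ?t {1..Suc n} = finsum (CM n)
            (\<lambda>i. if even i then gn n (face i \<sigma>) (s \<sigma>) else \<ominus>\<^bsub>CM n\<^esub> gn n (face i \<sigma>) (s \<sigma>)) {1..Suc n}"
    proof (rule C.finsum_cong')
      show "?t i = (if even i then gn n (face i \<sigma>) (s \<sigma>) else \<ominus>\<^bsub>CM n\<^esub> gn n (face i \<sigma>) (s \<sigma>))"
        if "i \<in> {1..Suc n}" for i using that by (simp add: sg_def cf_def)
      then show "(\<lambda>i. if even i then gn n (face i \<sigma>) (s \<sigma>) else \<ominus>\<^bsub>CM n\<^esub> gn n (face i \<sigma>) (s \<sigma>)) \<in> {1..Suc n} \<rightarrow> carrier (CM n)"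
        using t by (intro Pi_I) (metis atLeastAtMost_iff)
    qed simp
    finally show ?thesis by (simp add: cf_def)
  qed
  then show ?thesis unfolding bdry_def
    using lin_maps_closed[OF bd_lin sc]
    by (intro C.finsum_cong') auto
qed

lemma bdry_lin: "bdry Q G rho n \<in> lin_maps R (CM (Suc n)) (CM n)"
proof -
  interpret C: module R "CM (Suc n)" by (rule module_CM)
  let ?f = "\<lambda>s. finsum (CM n) (\<lambda>\<sigma>. bd n \<sigma> (s \<sigma>)) (chains Q (Suc n))"
  have "?f \<in> lin_maps R (CM (Suc n)) (CM n)" by (rule CM_linext_lin[OF module_CM bd_lin])
  then show ?thesis
    by (intro lin_mapsI) (simp_all add: bdry_eq lin_maps_closed[of ?f] lin_maps_add[of ?f] lin_maps_smult[of ?f])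
qed

lemma bdry_closed: "s \<in> carrier (CM (Suc n)) \<Longrightarrow> bdry Q G rho n s \<in> carrier (CM n)"
  by (rule lin_maps_closed[OF bdry_lin])

lemma bdry_gen:
  assumes "\<sigma> \<in> chains Q (Suc n)" "m \<in> carrier (G (hd \<sigma>))"
  shows "bdry Q G rho n (gn (Suc n) \<sigma> m) = bd n \<sigma> m"
  using CM_linext_gen[OF module_CM bd_lin assms] bdry_eq[OF gen_closed[OF assms]] by simp

text \<open>Only \<open>i = 0\<close>, \<open>j = 1\<close> has content: one side restricts directly
  from \<open>x_0\<close> to \<open>x_2\<close>, the other by way of \<open>x_1\<close>, and
  \<open>rho\<close> is functorial. In the other cases the coefficient is restricted on both sides
  along the same step, or not at all.\<close>

lemma cf_cf:
  assumes "\<sigma> \<in> chains Q (Suc (Suc n))" "i < j" "j \<le> Suc (Suc n)" "m \<in> carrier (G (hd \<sigma>))"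
  shows "cf i (face j \<sigma>) (cf j \<sigma> m) = cf (j - 1) (face i \<sigma>) (cf i \<sigma> m)"
proof (cases i)
  case 0
  obtain x y z \<tau> where s: "\<sigma> = x # y # z # \<tau>" using assms(1)
    by (auto simp: chains_altdef length_Suc_conv)
  show ?thesis
  proof (cases "j = 1")
    case True
    have "x \<in> Q" "y \<in> Q" "z \<in> Q" "y \<le> x" "z \<le> y" using assms(1) s by (auto simp: chains_altdef)
    then show ?thesis using rho_comp assms(4) by (simp add: 0 True cf_def face_def s)
  next
    case False
    then obtain k where "j = Suc (Suc k)" using assms(2) 0 by (metis One_nat_def less_imp_Suc_add not0_implies_Suc add_0)
    then show ?thesis using 0 by (simp add: cf_def face_def s)
  qed
next
  case (Suc k)
  then show ?thesis using assms(2) by (auto simp: cf_def)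
qed

lemma bdry_bdry:
  assumes "s \<in> carrier (CM (Suc (Suc n)))"
  shows "bdry Q G rho n (bdry Q G rho (Suc n) s) = \<zero>\<^bsub>CM n\<^esub>"
proof (rule CM_lin_eqI[OF lin_maps_comp[OF bdry_lin bdry_lin] lin_maps_zero_map[OF module_CM] module_CM _ assms])
  fix \<sigma> m assume \<sigma>: "\<sigma> \<in> chains Q (Suc (Suc n))" and m: "m \<in> carrier (G (hd \<sigma>))"
  interpret C: module R "CM n" by (rule module_CM)
  \<comment> \<open>Zero outside the range of faces, because \<open>simplicial_cancel\<close> wants
    membership for all indices.\<close>
  define g where "g i j = (if i \<le> Suc n \<and> j \<le> Suc (Suc n) then gn n (face i (face j \<sigma>)) (cf i (face j \<sigma>) (cf j \<sigma> m)) else \<zero>\<^bsub>CM n\<^esub>)" for i j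
  have len: "length \<sigma> = Suc (Suc (Suc n))" using \<sigma> by (simp add: chains_altdef)
  have gc: "g i j \<in> carrier (CM n)" for i j
    unfolding g_def using \<sigma> m by (auto intro!: gen_closed cf_closed chains_face)
  have gs: "g i j = g (j - 1) i" if "i < j" "j \<le> Suc (Suc n)" for i j
  proof -
    have "j - 1 \<le> Suc n" "i \<le> Suc n" "i \<le> Suc (Suc n)" using that by auto
    then show ?thesis using that face_face[of i j \<sigma>] cf_cf[OF \<sigma> that m] len by (simp add: g_def)
  qed
  have "bdry Q G rho n (gn (Suc n) (face j \<sigma>) (cf j \<sigma> m)) = finsum (CM n) (\<lambda>i. sg (CM n) i (g i j)) {..Suc n}"
    if j: "j \<le> Suc (Suc n)" for j
    using lin_maps_bd[OF lin_maps_id module_CM chains_face[OF \<sigma> j] cf_closed[OF \<sigma> j m], of "\<lambda>i. g i j"] j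
    by (simp add: bdry_gen[OF chains_face[OF \<sigma> j] cf_closed[OF \<sigma> j m]] g_def)
  then have "bdry Q G rho n (bdry Q G rho (Suc n) (gn (Suc (Suc n)) \<sigma> m))
      = finsum (CM n) (\<lambda>j. sg (CM n) j (finsum (CM n) (\<lambda>i. sg (CM n) i (g i j)) {..Suc n})) {..Suc (Suc n)}"
    unfolding bdry_gen[OF \<sigma> m] by (rule lin_maps_bd[OF bdry_lin module_CM \<sigma> m])
  also have "\<dots> = \<zero>\<^bsub>CM n\<^esub>" by (rule simplicial_cancel[where R = R and g = g]) (use module_CM gc gs in blast)+
  finally show "bdry Q G rho n (bdry Q G rho (Suc n) (gn (Suc (Suc n)) \<sigma> m)) = \<zero>\<^bsub>CM n\<^esub>" .
qed

lemma sub_cycles: "submodule (cycles Q G rho n) R (CM n)"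
proof (cases n)
  case 0
  then show ?thesis using module.carrier_is_submodule[OF module_CM[of 0]] by (simp add: cycles_def)
next
  case (Suc k)
  then show ?thesis
    using submodule_preimage[OF bdry_lin module_CM module_CM module.carrier_is_submodule[OF module_CM] submodule_zero_set[OF module_CM], of k]
    by (simp add: cycles_def)
qed

lemma sub_boundaries: "submodule (boundaries Q G rho n) R (CM n)"
  unfolding boundaries_def
  by (rule submodule_image[OF bdry_lin module_CM module_CM module.carrier_is_submodule[OF module_CM]])

lemma boundaries_subset_cycles: "boundaries Q G rho n \<subseteq> cycles Q G rho n"
  using bdry_closed bdry_bdry by (cases n) (auto simp: boundaries_def cycles_def)

lemma HS_subquot: "subquot R (CM n) (cycles Q G rho n) (boundaries Q G rho n)"
  by (rule subquot.intro[OF module_CM sub_cycles sub_boundaries boundaries_subset_cycles])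

end

section \<open>Augmented double complexes with exact rows\<close>

text \<open>Bidegrees are integers and the modules vanish off the first quadrant, so that the shifts
  in pages and differentials need no boundary cases. The two differentials anticommute, which makes
  their plain sum a differential.\<close>

locale double_complex =
  fixes R :: "'r ring" and D :: "int \<Rightarrow> int \<Rightarrow> ('r,'e) module"
    and dh dv :: "int \<Rightarrow> int \<Rightarrow> 'e \<Rightarrow> 'e"
  assumes cringR: "cring R" and modD: "module R (D p q)"
    and dh_lin: "dh p q \<in> lin_maps R (D p q) (D (p - 1) q)"
    and dv_lin: "dv p q \<in> lin_maps R (D p q) (D p (q - 1))"
    and dh_dh: "x \<in> carrier (D p q) \<Longrightarrow> dh (p - 1) q (dh p q x) = \<zero>\<^bsub>D (p - 1 - 1) q\<^esub>"
    and dv_dv: "x \<in> carrier (D p q) \<Longrightarrow> dv p (q - 1) (dv p q x) = \<zero>\<^bsub>D p (q - 1 - 1)\<^esub>"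
    and dh_dv: "x \<in> carrier (D p q) \<Longrightarrow>
       dh p (q - 1) (dv p q x) \<oplus>\<^bsub>D (p - 1) (q - 1)\<^esub> dv (p - 1) q (dh p q x) = \<zero>\<^bsub>D (p - 1) (q - 1)\<^esub>"
    and D_triv: "\<not> (0 \<le> p \<and> 0 \<le> q) \<Longrightarrow> carrier (D p q) = {\<zero>\<^bsub>D p q\<^esub>}"
begin

abbreviation "ze p q \<equiv> \<zero>\<^bsub>D p q\<^esub>"
abbreviation "DD \<equiv> \<lambda>i. D (fst i) (snd i)"

text \<open>The product over all bidegrees keeps every total degree in one module. An element of a
  single degree still has only finitely many nonzero entries, since they lie in the first
  quadrant.\<close>

definition T :: "('r, int \<times> int \<Rightarrow> 'e) module" where "T = pi_mod UNIV DD"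

sublocale pi: pi_module R UNIV DD
  by (rule pi_module.intro[OF cringR modD])

lemma module_T: "module R T" unfolding T_def by (rule pi.module_pi)

lemma T_simps:
  "x \<in> carrier T \<longleftrightarrow> (\<forall>p q. x (p,q) \<in> carrier (D p q))"
  "\<zero>\<^bsub>T\<^esub> (p,q) = ze p q" "(x \<oplus>\<^bsub>T\<^esub> y) (p,q) = x (p,q) \<oplus>\<^bsub>D p q\<^esub> y (p,q)"
  "(a \<odot>\<^bsub>T\<^esub> x) (p,q) = a \<odot>\<^bsub>D p q\<^esub> x (p,q)"
  by (auto simp: T_def)

lemma pr_lin: "(\<lambda>x. x (p,q)) \<in> lin_maps R T (D p q)"
  using pi.eval_lin[of "(p,q)"] by (simp add: T_def)

lemma T_minus: "x \<in> carrier T \<Longrightarrow> y \<in> carrier T \<Longrightarrow> (x \<ominus>\<^bsub>T\<^esub> y) (p,q) = x (p,q) \<ominus>\<^bsub>D p q\<^esub> y (p,q)"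
  by (rule lin_maps_minus[OF pr_lin module_T modD])

lemma T_eqI: "(\<And>p q. x (p,q) = y (p,q)) \<Longrightarrow> x = y"
  by auto

text \<open>The shift makes the target literally \<open>D p q\<close>, since
  \<open>p + 1 - 1\<close> does not unify with \<open>p\<close>.\<close>

lemma dh_lin': "dh (p + 1) q \<in> lin_maps R (D (p + 1) q) (D p q)" using dh_lin[of "p + 1" q] by simp
lemma dv_lin': "dv p (q + 1) \<in> lin_maps R (D p (q + 1)) (D p q)" using dv_lin[of p "q + 1"] by simp

lemmas dhdv_zero = lin_maps_zero[OF dh_lin' modD modD] lin_maps_zero[OF dv_lin' modD modD]

definition dT :: "(int \<times> int \<Rightarrow> 'e) \<Rightarrow> int \<times> int \<Rightarrow> 'e" where
  "dT x = (\<lambda>(p,q). dh (p + 1) q (x (p + 1, q)) \<oplus>\<^bsub>D p q\<^esub> dv p (q + 1) (x (p, q + 1)))"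

lemma dT_entry: "dT x (p,q) = dh (p + 1) q (x (p + 1, q)) \<oplus>\<^bsub>D p q\<^esub> dv p (q + 1) (x (p, q + 1))"
  by (simp add: dT_def)

lemma zero_closed: "ze p q \<in> carrier (D p q)"
  using module_def[of R "D p q"] modD[of p q] abelian_monoid.zero_closed[of "D p q"] by (auto simp: abelian_group_def)

lemma zero_add: "x \<in> carrier (D p q) \<Longrightarrow> ze p q \<oplus>\<^bsub>D p q\<^esub> x = x" "x \<in> carrier (D p q) \<Longrightarrow> x \<oplus>\<^bsub>D p q\<^esub> ze p q = x"
proof -
  interpret D: module R "D p q" by (rule modD)
  show "x \<in> carrier (D p q) \<Longrightarrow> ze p q \<oplus>\<^bsub>D p q\<^esub> x = x" "x \<in> carrier (D p q) \<Longrightarrow> x \<oplus>\<^bsub>D p q\<^esub> ze p q = x" by auto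
qed

lemma dT_lin: "dT \<in> lin_maps R T T"
proof -
  have "(\<lambda>x. dT x (p,q)) \<in> lin_maps R T (D p q)" for p q
    unfolding dT_entry
    by (rule lin_maps_plus[OF lin_maps_comp[OF pr_lin dh_lin'] lin_maps_comp[OF pr_lin dv_lin'] modD])
  then show ?thesis
    by (intro lin_mapsI T_eqI) (auto simp: T_simps(1,3,4) lin_maps_def Pi_def)
qed

lemma dT_dT: assumes "x \<in> carrier T" shows "dT (dT x) = \<zero>\<^bsub>T\<^esub>"
proof (rule T_eqI)
  fix p q
  interpret D: module R "D p q" by (rule modD)
  let ?a = "x (p + 1 + 1, q)" and ?b = "x (p + 1, q + 1)" and ?c = "x (p, q + 1 + 1)"
  have xc: "x (p,q) \<in> carrier (D p q)" for p q using assms by (simp add: T_simps)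
  have 1: "dh (p + 1) q (dh (p + 1 + 1) q ?a) = ze p q" using dh_dh[OF xc[of "p+1+1" q]] by (simp only: add_diff_cancel_right')
  have 2: "dv p (q + 1) (dv p (q + 1 + 1) ?c) = ze p q" using dv_dv[OF xc[of p "q+1+1"]] by (simp only: add_diff_cancel_right')
  have 3: "dh (p + 1) q (dv (p + 1) (q + 1) ?b) \<oplus>\<^bsub>D p q\<^esub> dv p (q + 1) (dh (p + 1) (q + 1) ?b) = ze p q"
    using dh_dv[OF xc[of "p+1" "q+1"]] by (simp only: add_diff_cancel_right')
  note cl = lin_maps_closed[OF dh_lin'] lin_maps_closed[OF dv_lin'] xc
  have "dT (dT x) (p,q) = (ze p q \<oplus>\<^bsub>D p q\<^esub> dh (p + 1) q (dv (p + 1) (q + 1) ?b)) \<oplus>\<^bsub>D p q\<^esub> (dv p (q + 1) (dh (p + 1) (q + 1) ?b) \<oplus>\<^bsub>D p q\<^esub> ze p q)"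
    unfolding dT_entry
    by (subst lin_maps_add[OF dh_lin'] lin_maps_add[OF dv_lin'] 1 2; (intro cl)?)+ simp
  also have "\<dots> = ze p q" using 3 cl by simp
  finally show "dT (dT x) (p,q) = \<zero>\<^bsub>T\<^esub> (p,q)" by (simp add: T_simps)
qed

definition G :: "int \<Rightarrow> int \<Rightarrow> (int \<times> int \<Rightarrow> 'e) set" where
  "G p n = {x \<in> carrier T. \<forall>i j. \<not> (i \<le> p \<and> i + j = n) \<longrightarrow> x (i,j) = ze i j}"

lemma G_zero: "x \<in> G p n \<Longrightarrow> \<not> (i \<le> p \<and> i + j = n) \<Longrightarrow> x (i,j) = ze i j"
  by (simp add: G_def)

lemma entry_closed: "x \<in> carrier T \<Longrightarrow> x (i,j) \<in> carrier (D i j)" by (simp add: T_simps)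

lemma entry_triv: "x \<in> carrier T \<Longrightarrow> \<not> (0 \<le> i \<and> 0 \<le> j) \<Longrightarrow> x (i,j) = ze i j"
  using D_triv[of i j] entry_closed[of x i j] by auto

sublocale fc: filtered_complex R T dT G D "\<lambda>p q x. x (p,q)"
proof (rule filtered_complex.intro)
  fix p q n :: int and x
  show "module R T" "module R (D p q)" "dT \<in> lin_maps R T T" "(\<lambda>x. x (p,q)) \<in> lin_maps R T (D p q)"
    by (rule module_T modD dT_lin pr_lin)+
  show "submodule (G p n) R T"
  proof (rule submoduleI'[OF module_T])
    interpret T: module R T by (rule module_T)
    show "G p n \<subseteq> carrier T" "\<zero>\<^bsub>T\<^esub> \<in> G p n" by (auto simp: G_def T_simps(2))
    show "a \<oplus>\<^bsub>T\<^esub> b \<in> G p n" if "a \<in> G p n" "b \<in> G p n" for a b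
      using that by (auto simp: G_def T_simps(3) zero_add zero_closed)
    show "r \<odot>\<^bsub>T\<^esub> a \<in> G p n" if "r \<in> carrier R" "a \<in> G p n" for r a
      using that module.smult_r_null[OF modD] by (auto simp: G_def T_simps(4))
  qed
  show "G (p - 1) n \<subseteq> G p n" by (auto simp: G_def)
  show "x \<in> G p n \<Longrightarrow> dT x \<in> G p (n - 1)"
    using lin_maps_closed[OF dT_lin, of x]
    by (auto simp: G_def dT_entry dhdv_zero zero_add zero_closed)
  show "x \<in> carrier T \<Longrightarrow> dT (dT x) = \<zero>\<^bsub>T\<^esub>" by (rule dT_dT)
  show "(x (p,q) = ze p q) = (x \<in> G (p - 1) (p + q))" if x: "x \<in> G p (p + q)"
  proof
    assume 0: "x (p,q) = ze p q"
    have "x (i,j) = ze i j" if "\<not> (i \<le> p - 1 \<and> i + j = p + q)" for i j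
    proof (cases "i = p \<and> j = q")
      case True then show ?thesis using 0 by simp
    next
      case False then show ?thesis using that G_zero[OF x, of i j] by auto
    qed
    then show "x \<in> G (p - 1) (p + q)" using x by (simp add: G_def)
  qed (simp add: G_def)
  show "G p n = {\<zero>\<^bsub>T\<^esub>}" if "p < 0"
  proof -
    interpret T: module R T by (rule module_T)
    have "x = \<zero>\<^bsub>T\<^esub>" if "x \<in> G p n" for x
    proof (rule T_eqI)
      fix i j show "x (i,j) = \<zero>\<^bsub>T\<^esub> (i,j)"
        using that \<open>p < 0\<close> entry_triv[of x i j] by (cases "i \<le> p \<and> i + j = n") (auto simp: T_simps(2) G_def)
    qed
    moreover have "\<zero>\<^bsub>T\<^esub> \<in> G p n" by (auto simp: G_def T_simps(2))
    ultimately show ?thesis by blast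
  qed
  show "G p n = G n n" if "n \<le> p"
  proof -
    \<comment> \<open>In degree \<open>n\<close> a column \<open>i > n\<close> forces
      \<open>j < 0\<close>, where the module is zero.\<close>
    have *: "x (i,j) = ze i j" if "x \<in> G p n" "\<not> (i \<le> n \<and> i + j = n)" for x i j
      using that G_zero[OF that(1), of i j] entry_triv[of x i j] by (cases "i + j = n") (auto simp: G_def)
    have "x \<in> G n n" if x: "x \<in> G p n" for x
    proof -
      have "x \<in> carrier T" using x by (simp add: G_def)
      then show ?thesis unfolding G_def[of n n] using *[OF x] by blast
    qed
    moreover have "G n n \<subseteq> G p n" using that by (auto simp: G_def)
    ultimately show ?thesis by blast
  qed
  show "\<not> (0 \<le> p \<and> 0 \<le> q) \<Longrightarrow> carrier (D p q) = {ze p q}" by (rule D_triv)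
qed

definition single :: "int \<Rightarrow> int \<Rightarrow> 'e \<Rightarrow> int \<times> int \<Rightarrow> 'e" where
  "single p q v = (\<lambda>(i,j). if i = p \<and> j = q then v else ze i j)"

lemma single_entry: "single p q v (i,j) = (if i = p \<and> j = q then v else ze i j)"
  by (simp add: single_def)

lemma single_G: "v \<in> carrier (D p q) \<Longrightarrow> p \<le> p' \<Longrightarrow> p + q = n \<Longrightarrow> single p q v \<in> G p' n"
  by (auto simp: G_def T_simps(1) single_entry zero_closed)

lemma dT_single_h: assumes "v \<in> carrier (D (p + 1) q)" shows "dT (single (p + 1) q v) (p, q) = dh (p + 1) q v"
  using lin_maps_closed[OF dh_lin' assms] by (simp add: dT_entry single_entry dhdv_zero zero_add)

lemma dT_single_other:
  assumes "\<not> (i = p - 1 \<and> j = q)" "\<not> (i = p \<and> j = q - 1)" shows "dT (single p q v) (i, j) = ze i j"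
  using assms by (auto simp: dT_entry single_entry dhdv_zero zero_add zero_closed)

text \<open>A boundary of filtration \<open>p - 2\<close> has to vanish at \<open>(p, q - 1)\<close>
  and \<open>(p - 1, q)\<close>, and this involves only the entries of \<open>X\<close> at
  \<open>(p, q)\<close> and \<open>(p - 1, q + 1)\<close>. Conversely, these two entries alone
  already make up a suitable \<open>X\<close>.\<close>

lemma A2_iff:
  "x \<in> fc.A 2 p q \<longleftrightarrow> x \<in> carrier (D p q) \<and> dv p q x = ze p (q - 1) \<and>
     (\<exists>x'\<in>carrier (D (p - 1) (q + 1)). dh p q x \<oplus>\<^bsub>D (p - 1) q\<^esub> dv (p - 1) (q + 1) x' = ze (p - 1) q)"
  (is "_ \<longleftrightarrow> ?R")
proof
  assume "x \<in> fc.A 2 p q"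
  then obtain X where X: "X \<in> G p (p + q)" "dT X \<in> G (p - 2) (p + q - 1)" "x = X (p,q)"
    by (auto simp: fc.A_def fc.Z_def)
  have XT: "X \<in> carrier T" using X(1) by (simp add: G_def)
  have "X (p + 1, q - 1) = ze (p + 1) (q - 1)" using G_zero[OF X(1)] by simp
  moreover have "dT X (p, q - 1) = ze p (q - 1)" using G_zero[OF X(2)] by simp
  moreover have "dv p q x \<in> carrier (D p (q - 1))" using lin_maps_closed[OF dv_lin entry_closed[OF XT]] X(3) by simp
  ultimately have "dv p q x = ze p (q - 1)" by (simp add: dT_entry dhdv_zero zero_add X(3))
  moreover have "dT X (p - 1, q) = ze (p - 1) q" using G_zero[OF X(2)] by simp
  then have "dh p q x \<oplus>\<^bsub>D (p - 1) q\<^esub> dv (p - 1) (q + 1) (X (p - 1, q + 1)) = ze (p - 1) q"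
    by (simp add: dT_entry X(3))
  ultimately show ?R
    using entry_closed[OF XT] X(3) by blast
next
  assume ?R
  then obtain x' where x: "x \<in> carrier (D p q)" "dv p q x = ze p (q - 1)"
    "x' \<in> carrier (D (p - 1) (q + 1))" "dh p q x \<oplus>\<^bsub>D (p - 1) q\<^esub> dv (p - 1) (q + 1) x' = ze (p - 1) q" by blast
  define X where "X = single p q x \<oplus>\<^bsub>T\<^esub> single (p - 1) (q + 1) x'"
  have X: "X \<in> G p (p + q)" unfolding X_def by (intro fc.G(3) single_G) (use x in auto)
  have Xpq: "X (p,q) = x" using x(1) by (simp add: X_def T_simps(3) single_entry zero_add)
  have Xpq': "X (p - 1, q + 1) = x'" using x(3) by (simp add: X_def T_simps(3) single_entry zero_add)
  have dX: "dT X \<in> G p (p + q - 1)" by (rule fc.d_G[OF X])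
  have "dT X (i,j) = ze i j" if ij: "\<not> (i \<le> p - 2 \<and> i + j = p + q - 1)" for i j
  proof -
    \<comment> \<open>In degree \<open>p + q - 1\<close>, the columns \<open>p\<close> and
      \<open>p - 1\<close> are all that separates filtration \<open>p\<close> from filtration
      \<open>p - 2\<close>.\<close>
    consider "\<not> (i \<le> p \<and> i + j = p + q - 1)" | "i = p" "j = q - 1" | "i = p - 1" "j = q" using ij by force
    then show ?thesis
    proof cases
      case 1 then show ?thesis using G_zero[OF dX] by blast
    next
      case 2
      have "X (p + 1, q - 1) = ze (p + 1) (q - 1)" using G_zero[OF X] by simp
      then show ?thesis using 2 x(2) Xpq by (simp add: dT_entry dhdv_zero zero_add zero_closed)
    next
      case 3 then show ?thesis using x(4) Xpq Xpq' by (simp add: dT_entry)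
    qed
  qed
  then have "dT X \<in> G (p - 2) (p + q - 1)" using dX by (simp add: G_def)
  then have "X \<in> fc.Z 2 p (p + q)" using X by (simp add: fc.Z_def)
  then show "x \<in> fc.A 2 p q" using Xpq unfolding fc.A_def by blast
qed

text \<open>For \<open>Y\<close> of filtration \<open>p + 1\<close>, the boundary has filtration
  \<open>p\<close> exactly when the entry of \<open>Y\<close> in column \<open>p + 1\<close> is a
  vertical cycle. The entry of the boundary at \<open>(p, q)\<close> then depends on the columns
  \<open>p + 1\<close> and \<open>p\<close> of \<open>Y\<close> alone.\<close>

lemma B2_iff:
  "x \<in> fc.B 2 p q \<longleftrightarrow> (\<exists>y\<in>carrier (D (p + 1) q). \<exists>y'\<in>carrier (D p (q + 1)).
     dv (p + 1) q y = ze (p + 1) (q - 1) \<and> x = dh (p + 1) q y \<oplus>\<^bsub>D p q\<^esub> dv p (q + 1) y')"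
  (is "_ \<longleftrightarrow> ?R")
proof
  assume "x \<in> fc.B 2 p q"
  then obtain Y where Y: "Y \<in> G (p + 1) (p + q + 1)" "dT Y \<in> G p (p + q)" "x = dT Y (p,q)"
    by (auto simp: fc.B_def fc.Z_def add.commute)
  have YT: "Y \<in> carrier T" using Y(1) by (simp add: G_def)
  have "Y (p + 1 + 1, q - 1) = ze (p + 1 + 1) (q - 1)" by (rule G_zero[OF Y(1)]) simp
  moreover have "dT Y (p + 1, q - 1) = ze (p + 1) (q - 1)" by (rule G_zero[OF Y(2)]) simp
  moreover have "dv (p + 1) q (Y (p + 1, q)) \<in> carrier (D (p + 1) (q - 1))" by (rule lin_maps_closed[OF dv_lin entry_closed[OF YT]])
  ultimately have "dv (p + 1) q (Y (p + 1, q)) = ze (p + 1) (q - 1)"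
    by (simp only: dT_entry dhdv_zero zero_add diff_add_cancel)
  then show ?R
    using entry_closed[OF YT] Y(3) dT_entry by blast
next
  assume ?R
  then obtain y y' where y: "y \<in> carrier (D (p + 1) q)" "dv (p + 1) q y = ze (p + 1) (q - 1)"
    "y' \<in> carrier (D p (q + 1))" "x = dh (p + 1) q y \<oplus>\<^bsub>D p q\<^esub> dv p (q + 1) y'" by blast
  define Y where "Y = single (p + 1) q y \<oplus>\<^bsub>T\<^esub> single p (q + 1) y'"
  have Y: "Y \<in> G (p + 1) (p + q + 1)" unfolding Y_def by (intro fc.G(3) single_G) (use y in auto)
  have Y1: "Y (p + 1,q) = y" using y(1) by (simp add: Y_def T_simps(3) single_entry zero_add)
  have Y2: "Y (p, q + 1) = y'" using y(3) by (simp add: Y_def T_simps(3) single_entry zero_add)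
  have dY: "dT Y \<in> G (p + 1) (p + q)" using fc.d_G[OF Y] by simp
  have "dT Y (p + 1, q - 1) = ze (p + 1) (q - 1)"
  proof -
    have "Y (p + 1 + 1, q - 1) = ze (p + 1 + 1) (q - 1)" by (rule G_zero[OF Y]) simp
    then show ?thesis using y(2) Y1 zero_closed zero_add by (simp only: dT_entry dhdv_zero diff_add_cancel)
  qed
  \<comment> \<open>This is \<open>pr_ker\<close> in column \<open>p + 1\<close>: a vanishing
    leading entry lowers the filtration by one.\<close>
  then have "dT Y \<in> G p (p + q)"
    using fc.pr_ker[of "dT Y" "p + 1" "q - 1"] dY by simp
  then have "Y \<in> fc.Z (2 - 1) (p + 2 - 1) (p + q + 1)" using Y by (simp add: fc.Z_def add.commute)
  moreover have "x = dT Y (p,q)" using y(4) Y1 Y2 by (simp add: dT_entry)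
  ultimately show "x \<in> fc.B 2 p q" unfolding fc.B_def by blast
qed

end

locale augmented_double_complex = double_complex R D dh dv
  for R :: "'r ring" and D :: "int \<Rightarrow> int \<Rightarrow> ('r,'e) module" and dh dv +
  fixes S :: "int \<Rightarrow> ('r,'s) module" and dS :: "int \<Rightarrow> 's \<Rightarrow> 's" and eps :: "int \<Rightarrow> 'e \<Rightarrow> 's"
  assumes modS: "module R (S q)" and dS_lin: "dS q \<in> lin_maps R (S q) (S (q - 1))"
    and dS_dS: "s \<in> carrier (S q) \<Longrightarrow> dS (q - 1) (dS q s) = \<zero>\<^bsub>S (q - 1 - 1)\<^esub>"
    and eps_lin: "eps q \<in> lin_maps R (D 0 q) (S q)"
    and eps_dv: "x \<in> carrier (D 0 q) \<Longrightarrow> eps (q - 1) (dv 0 q x) = dS q (eps q x)"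
    and eps_dh: "x \<in> carrier (D 1 q) \<Longrightarrow> eps q (dh 1 q x) = \<zero>\<^bsub>S q\<^esub>"
    and eps_onto: "s \<in> carrier (S q) \<Longrightarrow> \<exists>x\<in>carrier (D 0 q). eps q x = s"
    and exact_0: "x \<in> carrier (D 0 q) \<Longrightarrow> eps q x = \<zero>\<^bsub>S q\<^esub> \<Longrightarrow> \<exists>y\<in>carrier (D 1 q). dh 1 q y = x"
    and exact_pos: "0 < p \<Longrightarrow> x \<in> carrier (D p q) \<Longrightarrow> dh p q x = \<zero>\<^bsub>D (p - 1) q\<^esub> \<Longrightarrow> \<exists>y\<in>carrier (D (p + 1) q). dh (p + 1) q y = x"
begin

text \<open>A zigzag from left to right. Vanishing of the earlier columns makes the entry in column
  \<open>k\<close> horizontally closed, so exactness writes it as \<open>dh v\<close>; subtracting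
  the total boundary of \<open>v\<close> clears column \<open>k\<close>, and after column
  \<open>m\<close> nothing is left. As \<open>v\<close> sits in column \<open>k + 1\<close>, the
  solution vanishes up to column \<open>k\<close>; for \<open>k = 0\<close> it is thus invisible to
  the augmentation.\<close>

lemma fill:
  assumes "w \<in> G m m" "dT w = \<zero>\<^bsub>T\<^esub>" "0 \<le> k" "\<And>i j. i < k \<Longrightarrow> w (i,j) = ze i j"
    and "k = 0 \<Longrightarrow> eps m (w (0,m)) = \<zero>\<^bsub>S m\<^esub>"
  shows "\<exists>y\<in>G (m + 1) (m + 1). dT y = w \<and> (\<forall>i j. i \<le> k \<longrightarrow> y (i,j) = ze i j)"
  using assms
proof (induction "nat (m + 1 - k)" arbitrary: w k)
  case 0
  have "w = \<zero>\<^bsub>T\<^esub>"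
  proof (rule T_eqI)
    fix i j show "w (i,j) = \<zero>\<^bsub>T\<^esub> (i,j)"
      using 0(1,5) G_zero[OF 0(2), of i j] by (cases "i < k") (auto simp: T_simps(2))
  qed
  then have "dT \<zero>\<^bsub>T\<^esub> = w" using lin_maps_zero[OF dT_lin module_T module_T] by simp
  then show ?case using fc.G(2)[of "m + 1" "m + 1"] T_simps(2) by blast
next
  case (Suc u)
  have wT: "w \<in> carrier T" using Suc.prems(1) by (simp add: G_def)
  let ?x = "w (k, m - k)"
  have xc: "?x \<in> carrier (D k (m - k))" by (rule entry_closed[OF wT])
  \<comment> \<open>In column 0 the vanishing of the augmentation takes the place of horizontal
    closedness.\<close>
  obtain v where v: "v \<in> carrier (D (k + 1) (m - k))" "dh (k + 1) (m - k) v = ?x"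
  proof (cases "k = 0")
    case True
    then show thesis using that exact_0[OF xc[unfolded True]] Suc.prems(5) by auto
  next
    case False
    have "dT w (k - 1, m - k) = ze (k - 1) (m - k)" using Suc.prems(2) by (simp add: T_simps(2))
    moreover have "w (k - 1, m - k + 1) = ze (k - 1) (m - k + 1)" using Suc.prems(4) by simp
    moreover have "dh k (m - k) ?x \<in> carrier (D (k - 1) (m - k))" by (rule lin_maps_closed[OF dh_lin xc])
    ultimately have "dh k (m - k) ?x = ze (k - 1) (m - k)"
      by (simp only: dT_entry dhdv_zero zero_add diff_add_cancel)
    then show thesis using that exact_pos[OF _ xc] False Suc.prems(3) by auto
  qed
  let ?y0 = "single (k + 1) (m - k) v"
  have km: "k \<le> m" using Suc.hyps(2) by linarith
  have y0: "?y0 \<in> G (m + 1) (m + 1)" by (rule single_G[OF v(1)]) (use km in auto)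
  have y0T: "?y0 \<in> carrier T" by (rule fc.G_carrier[OF y0])
  have dy0: "dT ?y0 \<in> G m m" using fc.d_G[OF y0] fc.G_top[of m "m + 1"] by simp
  have dy0T: "dT ?y0 \<in> carrier T" by (rule fc.G_carrier[OF dy0])
  let ?w = "w \<ominus>\<^bsub>T\<^esub> dT ?y0"
  have w1: "?w \<in> G m m" by (rule fc.G(6)[OF Suc.prems(1) dy0])
  have w2: "dT ?w = \<zero>\<^bsub>T\<^esub>"
    using Suc.prems(2) dT_dT[OF y0T] by (simp add: lin_maps_minus[OF dT_lin module_T module_T wT dy0T] fc.T.minus_zero_right)
  have w3: "?w (i,j) = ze i j" if ik: "i < k + 1" for i j
  proof -
    interpret D: module R "D i j" by (rule modD)
    consider "i = k" "j = m - k" | "i = k" "j \<noteq> m - k" | "i < k" using ik by force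
    then have "w (i,j) = dT ?y0 (i,j)"
    proof cases
      case 1 then show ?thesis using dT_single_h[OF v(1)] v(2) by simp
    next
      case 2
      then have "\<not> (i \<le> m \<and> i + j = m)" by auto
      then show ?thesis using G_zero[OF Suc.prems(1)] G_zero[OF dy0] by simp
    next
      case 3
      then show ?thesis using Suc.prems(4) dT_single_other[of i "k + 1" j "m - k" v] by simp
    qed
    then show ?thesis using entry_closed[OF dy0T, of i j] by (simp add: T_minus[OF wT dy0T] D.minus_eq_zero_iff)
  qed
  have "\<exists>y\<in>G (m + 1) (m + 1). dT y = ?w \<and> (\<forall>i j. i \<le> k + 1 \<longrightarrow> y (i,j) = ze i j)"
    by (rule Suc.hyps(1)[OF _ w1 w2 _ w3]) (use Suc.hyps(2) Suc.prems(3) in auto)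
  then obtain y where y: "y \<in> G (m + 1) (m + 1)" "dT y = ?w" "\<And>i j. i \<le> k + 1 \<Longrightarrow> y (i,j) = ze i j" by blast
  have yT: "y \<in> carrier T" by (rule fc.G_carrier[OF y(1)])
  have "dT (y \<oplus>\<^bsub>T\<^esub> ?y0) = w"
    using y(2) wT dy0T by (simp add: lin_maps_add[OF dT_lin yT y0T] fc.T.minus_plus_cancel)
  moreover have "(y \<oplus>\<^bsub>T\<^esub> ?y0) (i,j) = ze i j" if "i \<le> k" for i j
    using that y(3) by (simp add: T_simps(3) single_entry zero_add zero_closed)
  ultimately show ?case using fc.G(3)[OF y(1) y0] by blast
qed

definition "cycS q = {s \<in> carrier (S q). dS q s = \<zero>\<^bsub>S (q - 1)\<^esub>}"
definition "bndS q = dS (q + 1) ` carrier (S (q + 1))"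

lemma dS_lin': "dS (q + 1) \<in> lin_maps R (S (q + 1)) (S q)" using dS_lin[of "q + 1"] by simp

lemma S_subquot: "subquot R (S q) (cycS q) (bndS q)"
proof (rule subquot.intro[OF modS])
  show "submodule (cycS q) R (S q)"
    using submodule_preimage[OF dS_lin modS modS module.carrier_is_submodule[OF modS] submodule_zero_set[OF modS]]
    by (simp add: cycS_def)
  show "submodule (bndS q) R (S q)"
    unfolding bndS_def by (rule submodule_image[OF dS_lin' modS modS module.carrier_is_submodule[OF modS]])
  show "bndS q \<subseteq> cycS q" using dS_dS[of _ "q + 1"] lin_maps_closed[OF dS_lin'] by (auto simp: cycS_def bndS_def)
qed

text \<open>Horizontal boundaries are killed by \<open>eps\<close>, so only the vertical part of
  \<open>dT\<close> reaches \<open>S\<close>; the augmentation is thus a chain map on the total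
  complex.\<close>

lemma eps_dT:
  assumes "x \<in> carrier T"
  shows "eps q (dT x (0, q)) = dS (q + 1) (eps (q + 1) (x (0, q + 1)))"
proof -
  interpret S: module R "S q" by (rule modS)
  have a: "dh 1 q (x (1, q)) \<in> carrier (D 0 q)" using lin_maps_closed[OF dh_lin entry_closed[OF assms], of 1 q] by simp
  have b: "dv 0 (q + 1) (x (0, q + 1)) \<in> carrier (D 0 q)" by (rule lin_maps_closed[OF dv_lin' entry_closed[OF assms]])
  have "dS (q + 1) (eps (q + 1) (x (0, q + 1))) \<in> carrier (S q)"
    by (rule lin_maps_closed[OF dS_lin' lin_maps_closed[OF eps_lin entry_closed[OF assms]]])
  then show ?thesis
    using eps_dv[OF entry_closed[OF assms], of "q + 1"] eps_dh[OF entry_closed[OF assms], of q]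
    by (simp add: dT_entry lin_maps_add[OF eps_lin a b])
qed

text \<open>The edge map; entries outside column 0 do not enter.\<close>

definition "hS n x = bndS (int n) +>\<^bsub>S (int n)\<^esub> eps (int n) (x (0, int n))"

lemma cyc_eps:
  assumes "x \<in> fc.cyc n n" shows "x \<in> carrier T" "eps n (x (0, n)) \<in> cycS n"
proof -
  show x: "x \<in> carrier T" using assms fc.G_carrier by (auto simp: fc.cyc_def)
  have "dT x (0, n - 1) = ze 0 (n - 1)" using assms by (simp add: fc.cyc_def T_simps(2))
  then have "dS n (eps n (x (0, n))) = \<zero>\<^bsub>S (n - 1)\<^esub>"
    using eps_dT[OF x, of "n - 1"] lin_maps_zero[OF eps_lin modD modS] by simp
  then show "eps n (x (0, n)) \<in> cycS n"
    using lin_maps_closed[OF eps_lin entry_closed[OF x]] by (simp add: cycS_def)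
qed

text \<open>The augmentation is an isomorphism on homology by \<open>fill\<close>, applied once to
  lift cycles of \<open>S\<close> and once to show that a cycle with trivial class is a
  boundary.\<close>

theorem converging_augmented:
  assumes E2: "\<And>p q. mod_iso R (fc.page 2 (int p) (int q)) (E2 p q)"
  shows "converging_ss R fc.page fc.dpage E2 (\<lambda>n. quot_mod (S (int n)) (cycS (int n)) (bndS (int n)))"
proof (rule fc.converging[where h = hS, OF _ _ _ _ _ _ E2])
  fix n :: nat and x y a
  interpret Q: subquot R "S (int n)" "cycS (int n)" "bndS (int n)" by (rule S_subquot)
  show "module R Q.quot" by (rule Q.module_quot)
  show "hS n x \<in> carrier Q.quot" if "x \<in> fc.cyc (int n) (int n)"
    unfolding hS_def by (rule Q.quotI[OF cyc_eps(2)[OF that]])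
  show "hS n (x \<oplus>\<^bsub>T\<^esub> y) = hS n x \<oplus>\<^bsub>Q.quot\<^esub> hS n y" if "x \<in> fc.cyc (int n) (int n)" "y \<in> fc.cyc (int n) (int n)"
    using cyc_eps[OF that(1)] cyc_eps[OF that(2)]
    by (simp add: hS_def Q.quot_add T_simps(3) lin_maps_add[OF eps_lin] entry_closed)
  show "hS n (a \<odot>\<^bsub>T\<^esub> x) = a \<odot>\<^bsub>Q.quot\<^esub> hS n x" if "a \<in> carrier R" "x \<in> fc.cyc (int n) (int n)"
    using cyc_eps[OF that(2)] that(1)
    by (simp add: hS_def Q.quot_smult T_simps(4) lin_maps_smult[OF eps_lin] entry_closed)
  show "hS n ` fc.cyc (int n) (int n) = carrier Q.quot"
  proof (intro subset_antisym subsetI)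
    fix c assume "c \<in> hS n ` fc.cyc (int n) (int n)"
    then show "c \<in> carrier Q.quot" using Q.quotI[OF cyc_eps(2)] by (auto simp: hS_def)
  next
    fix c assume "c \<in> carrier Q.quot"
    then obtain s where s: "s \<in> cycS (int n)" "c = bndS (int n) +>\<^bsub>S (int n)\<^esub> s" by (auto simp: Q.carrier_quot)
    then obtain v where v: "v \<in> carrier (D 0 (int n))" "eps (int n) v = s" using eps_onto[of s "int n"] by (auto simp: cycS_def)
    \<comment> \<open>The lift of \<open>s\<close> placed in column 0 need not be a cycle, but its
      boundary has augmentation \<open>dS s = 0\<close>. So \<open>fill\<close> supplies a
      \<open>y\<close> with the same boundary and no entry in column 0, and the difference is a
      cycle over \<open>s\<close>.\<close>
    let ?X = "single 0 (int n) v"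
    have X: "?X \<in> G (int n) (int n)" by (rule single_G[OF v(1)]) auto
    have XT: "?X \<in> carrier T" by (rule fc.G_carrier[OF X])
    have w: "dT ?X \<in> G (int n - 1) (int n - 1)" using fc.d_G[OF X] fc.G_top[of "int n - 1" "int n"] by simp
    have "eps (int n - 1) (dT ?X (0, int n - 1)) = \<zero>\<^bsub>S (int n - 1)\<^esub>"
      using eps_dT[OF XT, of "int n - 1"] s(1) v(2) by (simp add: single_entry cycS_def)
    moreover have "dT ?X (i,j) = ze i j" if "i < 0" for i j
      using entry_triv[OF fc.G_carrier[OF w], of i j] that by simp
    ultimately obtain y where y: "y \<in> G (int n) (int n)" "dT y = dT ?X" "\<And>i j. i \<le> 0 \<Longrightarrow> y (i,j) = ze i j"
      using fill[OF w dT_dT[OF XT], of 0] by auto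
    have yT: "y \<in> carrier T" by (rule fc.G_carrier[OF y(1)])
    let ?z = "?X \<ominus>\<^bsub>T\<^esub> y"
    have "dT ?z = \<zero>\<^bsub>T\<^esub>"
      using lin_maps_closed[OF dT_lin XT] by (simp add: lin_maps_minus[OF dT_lin module_T module_T XT yT] y(2) fc.T.minus_eq_zero_iff)
    then have "?z \<in> fc.cyc (int n) (int n)" using fc.G(6)[OF X y(1)] by (simp add: fc.cyc_def)
    moreover have "?z (0, int n) = v"
    proof -
      interpret D: module R "D 0 (int n)" by (rule modD)
      show ?thesis using v(1) y(3) by (simp add: T_minus[OF XT yT] single_entry D.minus_zero_right)
    qed
    ultimately show "c \<in> hS n ` fc.cyc (int n) (int n)" using s(2) v(2)
      by (intro image_eqI[of _ _ ?z]) (simp_all add: hS_def)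
  qed
  show "hS n x = \<zero>\<^bsub>Q.quot\<^esub> \<longleftrightarrow> x \<in> dT ` G (int n + 1) (int n + 1)" if x: "x \<in> fc.cyc (int n) (int n)"
  proof -
    have xT: "x \<in> carrier T" by (rule cyc_eps(1)[OF x])
    have "hS n x = \<zero>\<^bsub>Q.quot\<^esub> \<longleftrightarrow> eps (int n) (x (0, int n)) \<in> bndS (int n)"
      unfolding hS_def by (rule Q.quot_eq_zero_iff[OF cyc_eps(2)[OF x]])
    also have "\<dots> \<longleftrightarrow> x \<in> dT ` G (int n + 1) (int n + 1)"
    proof
      assume "x \<in> dT ` G (int n + 1) (int n + 1)"
      then obtain y where y: "y \<in> G (int n + 1) (int n + 1)" "x = dT y" by blast
      then show "eps (int n) (x (0, int n)) \<in> bndS (int n)"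
        using eps_dT[OF fc.G_carrier[OF y(1)]] lin_maps_closed[OF eps_lin entry_closed[OF fc.G_carrier[OF y(1)]]]
        by (simp add: bndS_def)
    next
      assume "eps (int n) (x (0, int n)) \<in> bndS (int n)"
      then obtain v where v: "v \<in> carrier (D 0 (int n + 1))" "eps (int n) (x (0, int n)) = dS (int n + 1) (eps (int n + 1) v)"
        using eps_onto[of _ "int n + 1"] unfolding bndS_def by blast
      \<comment> \<open>The total boundary of \<open>v\<close>, placed in column 0, has the same
        augmentation as \<open>x\<close>, so \<open>fill\<close> applies to the difference.\<close>
      let ?X = "single 0 (int n + 1) v"
      have X: "?X \<in> G (int n + 1) (int n + 1)" by (rule single_G[OF v(1)]) auto
      have XT: "?X \<in> carrier T" by (rule fc.G_carrier[OF X])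
      have dX: "dT ?X \<in> G (int n) (int n)" using fc.d_G[OF X] fc.G_top[of "int n" "int n + 1"] by simp
      have dXT: "dT ?X \<in> carrier T" by (rule fc.G_carrier[OF dX])
      let ?w = "x \<ominus>\<^bsub>T\<^esub> dT ?X"
      have w: "?w \<in> G (int n) (int n)" using fc.G(6)[OF _ dX] x by (simp add: fc.cyc_def)
      have dw: "dT ?w = \<zero>\<^bsub>T\<^esub>"
        using x dT_dT[OF XT] by (simp add: fc.cyc_def lin_maps_minus[OF dT_lin module_T module_T xT dXT] fc.T.minus_zero_right)
      have "eps (int n) (?w (0, int n)) = \<zero>\<^bsub>S (int n)\<^esub>"
      proof -
        have "eps (int n) (dT ?X (0, int n)) = eps (int n) (x (0, int n))"
          using eps_dT[OF XT, of "int n"] v(2) by (simp add: single_entry)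
        then show ?thesis
          using lin_maps_closed[OF eps_lin entry_closed[OF xT], of "int n"]
          by (simp add: T_minus[OF xT dXT] lin_maps_minus[OF eps_lin modD modS entry_closed[OF xT] entry_closed[OF dXT]] abelian_group.minus_eq_zero_iff[OF module.axioms(2)[OF modS]])
      qed
      moreover have "?w (i,j) = ze i j" if "i < 0" for i j
        using entry_triv[OF fc.G_carrier[OF w], of i j] that by simp
      ultimately obtain y where y: "y \<in> G (int n + 1) (int n + 1)" "dT y = ?w"
        using fill[OF w dw, of 0] by auto
      have "dT (y \<oplus>\<^bsub>T\<^esub> ?X) = x"
        using y(2) xT dXT by (simp add: lin_maps_add[OF dT_lin fc.G_carrier[OF y(1)] XT] fc.T.minus_plus_cancel)
      then show "x \<in> dT ` G (int n + 1) (int n + 1)" using fc.G(3)[OF y(1) X] by blast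
    qed
    finally show ?thesis .
  qed
qed

end

section \<open>Functoriality of the chain modules\<close>

definition chmap :: "'a::order set \<Rightarrow> ('a \<Rightarrow> 'm \<Rightarrow> 'n) \<Rightarrow> nat \<Rightarrow> ('a list \<Rightarrow> 'm) \<Rightarrow> 'a list \<Rightarrow> 'n" where
  "chmap Q f n s = (\<lambda>\<sigma>. if \<sigma> \<in> chains Q n then f (hd \<sigma>) (s \<sigma>) else undefined)"

locale sheaf_hom = A: poset_sheaf R Q G rho + B: poset_sheaf R Q G' rho'
  for R :: "'r ring" and Q :: "'a::order set" and G :: "'a \<Rightarrow> ('r,'m) module" and rho
    and G' :: "'a \<Rightarrow> ('r,'n) module" and rho' +
  fixes f :: "'a \<Rightarrow> 'm \<Rightarrow> 'n"
  assumes f_lin: "x \<in> Q \<Longrightarrow> f x \<in> lin_maps R (G x) (G' x)"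
    and f_nat: "x \<in> Q \<Longrightarrow> y \<in> Q \<Longrightarrow> x \<le> y \<Longrightarrow> s \<in> carrier (G y) \<Longrightarrow> f x (rho y x s) = rho' y x (f y s)"
begin

lemma chmap_lin: "chmap Q f n \<in> lin_maps R (A.CM n) (B.CM n)"
  by (rule lin_mapsI)
    (auto simp: chmap_def chain_mod_eq_pi_mod fun_eq_iff chains_hd lin_maps_closed[OF f_lin]
      lin_maps_add[OF f_lin] lin_maps_smult[OF f_lin])

lemma chmap_gen: "\<sigma> \<in> chains Q n \<Longrightarrow> m \<in> carrier (G (hd \<sigma>)) \<Longrightarrow> chmap Q f n (A.gn n \<sigma> m) = B.gn n \<sigma> (f (hd \<sigma>) m)"
  using lin_maps_zero[OF f_lin A.modG B.modG] by (auto simp: chmap_def gen_def fun_eq_iff chains_hd)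

text \<open>Naturality \<open>f_nat\<close> enters in the face of index 0 only; the other faces keep
  the coefficient.\<close>

lemma chmap_bdry:
  assumes "s \<in> carrier (A.CM (Suc n))"
  shows "chmap Q f n (bdry Q G rho n s) = bdry Q G' rho' n (chmap Q f (Suc n) s)"
proof (rule A.CM_lin_eqI[OF lin_maps_comp[OF A.bdry_lin chmap_lin] lin_maps_comp[OF chmap_lin B.bdry_lin] B.module_CM _ assms])
  fix \<sigma> m assume \<sigma>: "\<sigma> \<in> chains Q (Suc n)" and m: "m \<in> carrier (G (hd \<sigma>))"
  have fm: "f (hd \<sigma>) m \<in> carrier (G' (hd \<sigma>))" by (rule lin_maps_closed[OF f_lin[OF chains_hd[OF \<sigma>]] m])
  have cf: "f (hd (face i \<sigma>)) (A.cf i \<sigma> m) = B.cf i \<sigma> (f (hd \<sigma>) m)" if "i \<le> Suc n" for i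
  proof (cases i)
    case 0
    obtain x y \<tau> where s: "\<sigma> = x # y # \<tau>" using \<sigma> by (auto simp: chains_altdef length_Suc_conv)
    have "x \<in> Q" "y \<in> Q" "y \<le> x" using \<sigma> s by (auto simp: chains_altdef)
    then show ?thesis using f_nat m by (simp add: 0 s A.cf_def B.cf_def face_0)
  next
    case (Suc k)
    have "\<sigma> \<noteq> []" using \<sigma> by (auto simp: chains_altdef)
    then show ?thesis using Suc by (simp add: hd_face_Suc A.cf_def B.cf_def)
  qed
  have "chmap Q f n (A.bd n \<sigma> m) = B.bd n \<sigma> (f (hd \<sigma>) m)"
    unfolding B.bd_def
    by (rule A.lin_maps_bd[OF chmap_lin B.module_CM \<sigma> m])
      (simp add: chmap_gen[OF chains_face[OF \<sigma>] A.cf_closed[OF \<sigma> _ m]] cf)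
  then show "chmap Q f n (bdry Q G rho n (A.gn (Suc n) \<sigma> m)) = bdry Q G' rho' n (chmap Q f (Suc n) (A.gn (Suc n) \<sigma> m))"
    by (simp add: A.bdry_gen[OF \<sigma> m] chmap_gen[OF \<sigma> m] B.bdry_gen[OF \<sigma> fm])
qed

end

context poset_sheaf
begin

lemma restrict: assumes "S \<subseteq> Q" shows "poset_sheaf R S G rho"
  by (rule poset_sheaf.intro[OF cringR finite_subset[OF assms finQ]])
    (auto simp: is_sheaf_def subsetD[OF assms] modG rho_id rho_comp intro!: rho_lin)

lemma ext_lin:
  assumes "S' \<subseteq> S" "S \<subseteq> Q" shows "ext_chain S' S G n \<in> lin_maps R (chain_mod S' G n) (chain_mod S G n)"
proof -
  have z: "\<zero>\<^bsub>G (hd \<sigma>)\<^esub> \<in> carrier (G (hd \<sigma>))" "\<zero>\<^bsub>G (hd \<sigma>)\<^esub> \<oplus>\<^bsub>G (hd \<sigma>)\<^esub> \<zero>\<^bsub>G (hd \<sigma>)\<^esub> = \<zero>\<^bsub>G (hd \<sigma>)\<^esub>"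
    "a \<in> carrier R \<Longrightarrow> a \<odot>\<^bsub>G (hd \<sigma>)\<^esub> \<zero>\<^bsub>G (hd \<sigma>)\<^esub> = \<zero>\<^bsub>G (hd \<sigma>)\<^esub>" if "\<sigma> \<in> chains S n" for \<sigma> a
  proof -
    interpret M: module R "G (hd \<sigma>)" by (rule modG) (use chains_hd[OF that] assms in blast)
    show "\<zero>\<^bsub>G (hd \<sigma>)\<^esub> \<in> carrier (G (hd \<sigma>))" "\<zero>\<^bsub>G (hd \<sigma>)\<^esub> \<oplus>\<^bsub>G (hd \<sigma>)\<^esub> \<zero>\<^bsub>G (hd \<sigma>)\<^esub> = \<zero>\<^bsub>G (hd \<sigma>)\<^esub>"
    "a \<in> carrier R \<Longrightarrow> a \<odot>\<^bsub>G (hd \<sigma>)\<^esub> \<zero>\<^bsub>G (hd \<sigma>)\<^esub> = \<zero>\<^bsub>G (hd \<sigma>)\<^esub>" by auto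
  qed
  have sub: "\<sigma> \<in> chains S n" if "\<sigma> \<in> chains S' n" for \<sigma> using chains_mono[OF assms(1)] that by blast
  show ?thesis
    by (rule lin_mapsI) (auto simp: ext_chain_def chain_mod_eq_pi_mod fun_eq_iff z sub)
qed

lemma ext_gen:
  assumes "S' \<subseteq> S" "\<sigma> \<in> chains S' n" shows "ext_chain S' S G n (gen S' G n \<sigma> m) = gen S G n \<sigma> m"
  using chains_mono[OF assms(1)] assms(2) by (auto simp: ext_chain_def gen_def fun_eq_iff)

lemma ext_self: "s \<in> carrier (chain_mod S G n) \<Longrightarrow> ext_chain S S G n s = s"
  by (auto simp: ext_chain_def chain_mod_eq_pi_mod fun_eq_iff)

lemma ext_ext:
  assumes "S'' \<subseteq> S'" "S' \<subseteq> S" shows "ext_chain S' S G n (ext_chain S'' S' G n s) = ext_chain S'' S G n s"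
  using chains_mono[OF assms(1), of n] chains_mono[OF assms(2), of n] by (auto simp: ext_chain_def fun_eq_iff)

lemma ext_bdry:
  assumes sub: "S' \<subseteq> S" "S \<subseteq> Q" and "s \<in> carrier (chain_mod S' G (Suc n))"
  shows "ext_chain S' S G n (bdry S' G rho n s) = bdry S G rho n (ext_chain S' S G (Suc n) s)"
proof -
  interpret S: poset_sheaf R S G rho by (rule restrict[OF sub(2)])
  interpret S': poset_sheaf R S' G rho by (rule restrict) (use sub in blast)
  note el = ext_lin[OF sub]
  show ?thesis
  proof (rule S'.CM_lin_eqI[OF lin_maps_comp[OF S'.bdry_lin el] lin_maps_comp[OF el S.bdry_lin] S.module_CM _ assms(3)])
    fix \<sigma> m assume \<sigma>: "\<sigma> \<in> chains S' (Suc n)" and m: "m \<in> carrier (G (hd \<sigma>))"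
    have \<sigma>S: "\<sigma> \<in> chains S (Suc n)" using \<sigma> chains_mono[OF sub(1)] by blast
    have "ext_chain S' S G n (S'.bd n \<sigma> m) = S.bd n \<sigma> m"
      unfolding S.bd_def
      by (rule S'.lin_maps_bd[OF el S.module_CM \<sigma> m]) (simp add: ext_gen[OF sub(1) chains_face[OF \<sigma>]])
    then show "ext_chain S' S G n (bdry S' G rho n (S'.gn (Suc n) \<sigma> m)) = bdry S G rho n (ext_chain S' S G (Suc n) (S'.gn (Suc n) \<sigma> m))"
      by (simp add: S'.bdry_gen[OF \<sigma> m] ext_gen[OF sub(1) \<sigma>] S.bdry_gen[OF \<sigma>S m])
  qed
qed

lemma ext_cycles:
  assumes sub: "S' \<subseteq> S" "S \<subseteq> Q" and "s \<in> cycles S' G rho n"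
  shows "ext_chain S' S G n s \<in> cycles S G rho n"
proof (cases n)
  case 0
  then show ?thesis using assms(3) lin_maps_closed[OF ext_lin[OF sub]] by (simp add: cycles_def)
next
  case (Suc k)
  interpret S: poset_sheaf R S G rho by (rule restrict[OF sub(2)])
  interpret S': poset_sheaf R S' G rho by (rule restrict) (use sub in blast)
  have s: "s \<in> carrier (chain_mod S' G (Suc k))" "bdry S' G rho k s = \<zero>\<^bsub>chain_mod S' G k\<^esub>"
    using assms(3) Suc by (auto simp: cycles_def)
  have "bdry S G rho k (ext_chain S' S G (Suc k) s) = \<zero>\<^bsub>chain_mod S G k\<^esub>"
    using ext_bdry[OF sub s(1)] s(2) lin_maps_zero[OF ext_lin[OF sub] S'.module_CM S.module_CM] by simp
  then show ?thesis using Suc lin_maps_closed[OF ext_lin[OF sub] s(1)] by (simp add: cycles_def)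
qed

lemma ext_boundaries:
  assumes sub: "S' \<subseteq> S" "S \<subseteq> Q" and "s \<in> boundaries S' G rho n"
  shows "ext_chain S' S G n s \<in> boundaries S G rho n"
  using assms(3) ext_bdry[OF sub] lin_maps_closed[OF ext_lin[OF sub]] by (auto simp: boundaries_def)

text \<open>The map \<open>HS_map\<close> adds the boundaries of \<open>S\<close> to the image of a
  whole class. By \<open>ext_boundaries\<close> the boundaries of \<open>S'\<close> land among those
  of \<open>S\<close>, so the result is a single coset.\<close>

lemma HS_map_coset:
  assumes sub: "S' \<subseteq> S" "S \<subseteq> Q" and s: "s \<in> cycles S' G rho n"
  shows "HS_map S' S G rho n (boundaries S' G rho n +>\<^bsub>chain_mod S' G n\<^esub> s)
    = boundaries S G rho n +>\<^bsub>chain_mod S G n\<^esub> ext_chain S' S G n s"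
proof -
  let ?e = "ext_chain S' S G n"
  interpret S: poset_sheaf R S G rho by (rule restrict[OF sub(2)])
  interpret S': poset_sheaf R S' G rho by (rule restrict) (use sub in blast)
  interpret H: subquot R "S.CM n" "cycles S G rho n" "boundaries S G rho n" by (rule S.HS_subquot)
  interpret H': subquot R "S'.CM n" "cycles S' G rho n" "boundaries S' G rho n" by (rule S'.HS_subquot)
  have sc: "s \<in> carrier (S'.CM n)" by (rule H'.A_carrier[OF s])
  have ec: "?e s \<in> carrier (S.CM n)" by (rule lin_maps_closed[OF ext_lin[OF sub] sc])
  have bc: "b \<in> carrier (S.CM n)" if "b \<in> boundaries S G rho n" for b using that H.B(1) by blast
  have bc': "b \<in> carrier (S'.CM n)" if "b \<in> boundaries S' G rho n" for b using that H'.B(1) by blast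
  show ?thesis unfolding HS_map_def
  proof (intro subset_antisym subsetI)
    fix u assume "u \<in> boundaries S G rho n <+>\<^bsub>S.CM n\<^esub> ?e ` (boundaries S' G rho n +>\<^bsub>S'.CM n\<^esub> s)"
    then obtain b b' where b: "b \<in> boundaries S G rho n" "b' \<in> boundaries S' G rho n" "u = b \<oplus>\<^bsub>S.CM n\<^esub> ?e (b' \<oplus>\<^bsub>S'.CM n\<^esub> s)"
      by (auto simp: set_add_def' a_r_coset_def')
    have "?e b' \<in> boundaries S G rho n" by (rule ext_boundaries[OF sub b(2)])
    moreover from this have "u = (b \<oplus>\<^bsub>S.CM n\<^esub> ?e b') \<oplus>\<^bsub>S.CM n\<^esub> ?e s"
      using b ec bc by (simp add: lin_maps_add[OF ext_lin[OF sub] bc'[OF b(2)] sc] H.M.M.a_assoc)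
    ultimately show "u \<in> boundaries S G rho n +>\<^bsub>S.CM n\<^esub> ?e s" using H.B(3)[OF b(1)] by (auto simp: a_r_coset_def')
  next
    fix u assume "u \<in> boundaries S G rho n +>\<^bsub>S.CM n\<^esub> ?e s"
    then obtain b where b: "b \<in> boundaries S G rho n" "u = b \<oplus>\<^bsub>S.CM n\<^esub> ?e (\<zero>\<^bsub>S'.CM n\<^esub> \<oplus>\<^bsub>S'.CM n\<^esub> s)"
      using sc by (auto simp: a_r_coset_def')
    then show "u \<in> boundaries S G rho n <+>\<^bsub>S.CM n\<^esub> ?e ` (boundaries S' G rho n +>\<^bsub>S'.CM n\<^esub> s)"
      using H'.B(2) by (fastforce simp: set_add_def' a_r_coset_def')
  qed
qed

end

section \<open>The double complex of a covering\<close>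

locale covering = P: poset_sheaf R P F rho
  for R :: "'r ring" and P :: "'a::order set" and F :: "'a \<Rightarrow> ('r,'m) module" and rho +
  fixes K :: "'k set" and Pa :: "'k \<Rightarrow> 'a set"
  assumes finK: "finite K" and upper: "\<And>\<alpha>. \<alpha> \<in> K \<Longrightarrow> upper_convex P (Pa \<alpha>)"
    and cover: "P = (\<Union>\<alpha>\<in>K. Pa \<alpha>)"
begin

abbreviation "N \<equiv> nerve K Pa"
abbreviation "PX' \<equiv> PX Pa"

lemma finN: "finite N"
  by (rule finite_subset[of _ "Pow K"]) (use finK in \<open>auto simp: nerve_def\<close>)

lemma PX_sub: "X \<in> N \<Longrightarrow> PX' X \<subseteq> P"
  using cover by (auto simp: nerve_def PX_def)

lemma PX_anti: "X \<subseteq> Y \<Longrightarrow> PX' Y \<subseteq> PX' X"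
  by (auto simp: PX_def)

lemma sheafX: "X \<in> N \<Longrightarrow> poset_sheaf R (PX' X) F rho"
  by (rule P.restrict[OF PX_sub])

definition "Gq q X = chain_mod (PX' X) F q"
definition "Ext q Y X = ext_chain (PX' Y) (PX' X) F q"

lemma module_Gq: "X \<in> N \<Longrightarrow> module R (Gq q X)"
  unfolding Gq_def by (rule poset_sheaf.module_CM[OF sheafX])

lemma Ext_lin: "X \<in> N \<Longrightarrow> X \<subseteq> Y \<Longrightarrow> Ext q Y X \<in> lin_maps R (Gq q Y) (Gq q X)"
  unfolding Gq_def Ext_def by (rule P.ext_lin[OF PX_anti PX_sub])

lemma sheaf_Gq: "poset_sheaf R N (Gq q) (Ext q)"
proof (rule poset_sheaf.intro[OF P.cringR finN])
  show "is_sheaf R N (Gq q) (Ext q)"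
    unfolding is_sheaf_def
    by (auto intro!: module_Gq Ext_lin) (auto simp: Gq_def Ext_def P.ext_self P.ext_ext[OF PX_anti PX_anti])
qed

sublocale Nq: poset_sheaf R N "Gq q" "Ext q" for q by (rule sheaf_Gq)

abbreviation "DM q p \<equiv> chain_mod N (Gq q) p"
abbreviation "bN q p \<equiv> bdry N (Gq q) (Ext q) p"
abbreviation "gN q p \<equiv> gen N (Gq q) p"
abbreviation "bX q X \<equiv> bdry (PX' X) F rho q"
abbreviation "gX q X \<equiv> gen (PX' X) F q"

text \<open>Extension by zero is a chain map, so the boundaries in the various \<open>P_X\<close>
  form a morphism of sheaves on the nerve. Applying \<open>chmap\<close> then yields a vertical map
  that commutes with the horizontal one.\<close>

lemma hom_bX: "sheaf_hom R N (Gq (Suc q)) (Ext (Suc q)) (Gq q) (Ext q) (bX q)"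
proof (rule sheaf_hom.intro[OF sheaf_Gq sheaf_Gq], rule sheaf_hom_axioms.intro)
  show "bX q X \<in> lin_maps R (Gq (Suc q) X) (Gq q X)" if "X \<in> N" for X
    unfolding Gq_def by (rule poset_sheaf.bdry_lin[OF sheafX[OF that]])
  show "bX q X (Ext (Suc q) Y X s) = Ext q Y X (bX q Y s)" if "X \<in> N" "Y \<in> N" "X \<subseteq> Y" "s \<in> carrier (Gq (Suc q) Y)" for X Y s
    using P.ext_bdry[OF PX_anti[OF that(3)] PX_sub[OF that(1)]] that(4) by (simp add: Gq_def Ext_def)
qed

definition "vM q p = chmap N (bX q) p"

lemma vM_lin: "vM q p \<in> lin_maps R (DM (Suc q) p) (DM q p)"
  unfolding vM_def by (rule sheaf_hom.chmap_lin[OF hom_bX])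

lemma vM_gen: "\<tau> \<in> chains N p \<Longrightarrow> u \<in> carrier (Gq (Suc q) (hd \<tau>)) \<Longrightarrow> vM q p (gN (Suc q) p \<tau> u) = gN q p \<tau> (bX q (hd \<tau>) u)"
  unfolding vM_def by (rule sheaf_hom.chmap_gen[OF hom_bX])

lemma vM_bN: "s \<in> carrier (DM (Suc q) (Suc p)) \<Longrightarrow> vM q p (bN (Suc q) p s) = bN q p (vM q (Suc p) s)"
  unfolding vM_def by (rule sheaf_hom.chmap_bdry[OF hom_bX])

lemma vM_vM:
  assumes "s \<in> carrier (DM (Suc (Suc q)) p)" shows "vM q p (vM (Suc q) p s) = \<zero>\<^bsub>DM q p\<^esub>"
proof -
  have "bX q X (bX (Suc q) X u) = \<zero>\<^bsub>Gq q X\<^esub>" if "X \<in> N" "u \<in> carrier (Gq (Suc (Suc q)) X)" for X u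
    using poset_sheaf.bdry_bdry[OF sheafX[OF that(1)]] that(2) by (simp add: Gq_def)
  then show ?thesis using assms
    by (intro ext) (simp add: vM_def chmap_def chain_mod_eq_pi_mod[of N] chains_hd)
qed

text \<open>Off the first quadrant the chains of the empty poset serve as the zero module;
  \<open>Gq 0\<close> and the degree 0 are placeholders there.\<close>

definition D :: "int \<Rightarrow> int \<Rightarrow> ('r, 'k set list \<Rightarrow> 'a list \<Rightarrow> 'm) module" where
  "D p q = (if 0 \<le> p \<and> 0 \<le> q then DM (nat q) (nat p) else chain_mod {} (Gq 0) 0)"

definition dh where
  "dh p q x = (if 1 \<le> p \<and> 0 \<le> q then bN (nat q) (nat p - 1) x else \<zero>\<^bsub>D (p - 1) q\<^esub>)"

text \<open>The sign of the column turns the commuting squares of \<open>vM_bN\<close> into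
  anticommuting ones.\<close>

definition dv where
  "dv p q x = (if 0 \<le> p \<and> 1 \<le> q then sg (D p (q - 1)) (nat p) (vM (nat q - 1) (nat p) x) else \<zero>\<^bsub>D p (q - 1)\<^esub>)"

lemma chains_empty [simp]: "chains {} n = {}" by (auto simp: chains_def)

lemma chain_mod_empty: "module R (chain_mod {} G n)" "carrier (chain_mod {} G n) = {\<zero>\<^bsub>chain_mod {} G n\<^esub>}"
proof -
  interpret pi_module R "{}" "\<lambda>\<sigma>. G (hd \<sigma>)" by (rule pi_module.intro[OF P.cringR]) simp
  show "module R (chain_mod {} G n)" using module_pi by (simp add: chain_mod_eq_pi_mod)
  show "carrier (chain_mod {} G n) = {\<zero>\<^bsub>chain_mod {} G n\<^esub>}"
    by (auto simp: chain_mod_eq_pi_mod fun_eq_iff)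
qed

lemma modD: "module R (D p q)"
  by (simp add: D_def Nq.module_CM chain_mod_empty(1))

lemma D_triv: "\<not> (0 \<le> p \<and> 0 \<le> q) \<Longrightarrow> carrier (D p q) = {\<zero>\<^bsub>D p q\<^esub>}"
  by (auto simp: D_def chain_mod_empty(2))

lemma D_nat: "D (int p) (int q) = DM q p" by (simp add: D_def)

lemma D_Suc [simp]: "D (1 + int p) (int q) = DM q (Suc p)" "D (int p) (1 + int q) = DM (Suc q) p"
  "D (1 + int p) (1 + int q) = DM (Suc q) (Suc p)"
  using D_nat[of "Suc p" q] D_nat[of p "Suc q"] D_nat[of "Suc p" "Suc q"] by auto

lemma dh_Suc: "dh (1 + int p) (int q) x = bN q p x" by (simp add: dh_def nat_add_distrib)

lemma dv_Suc: "dv (int p) (1 + int q) x = sg (DM q p) p (vM q p x)" by (simp add: dv_def nat_add_distrib D_nat)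

lemma int_1_cases: assumes "(1::int) \<le> p" obtains p' where "p = 1 + int p'"
  using assms by (metis zle_iff_zadd)

lemma int_0_cases: assumes "(0::int) \<le> p" obtains p' where "p = int p'"
  using assms by (metis nonneg_int_cases)

lemma dh_lin: "dh p q \<in> lin_maps R (D p q) (D (p - 1) q)"
proof (cases "1 \<le> p \<and> 0 \<le> q")
  case True
  then obtain p' q' where e: "p = 1 + int p'" "q = int q'" by (meson int_1_cases int_0_cases)
  show ?thesis unfolding e using Nq.bdry_lin by (simp add: dh_Suc[abs_def] D_nat)
next
  case False
  then have "dh p q = (\<lambda>x. \<zero>\<^bsub>D (p - 1) q\<^esub>)" by (auto simp: dh_def)
  then show ?thesis using lin_maps_zero_map[OF modD] by metis
qed

lemma dv_lin: "dv p q \<in> lin_maps R (D p q) (D p (q - 1))"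
proof (cases "0 \<le> p \<and> 1 \<le> q")
  case True
  then obtain p' q' where e: "p = int p'" "q = 1 + int q'" by (meson int_1_cases int_0_cases)
  show ?thesis unfolding e using lin_maps_comp[OF vM_lin sg_lin[OF Nq.module_CM]] by (simp add: dv_Suc[abs_def] D_nat)
next
  case False
  then have "dv p q = (\<lambda>x. \<zero>\<^bsub>D p (q - 1)\<^esub>)" by (auto simp: dv_def)
  then show ?thesis using lin_maps_zero_map[OF modD] by metis
qed

lemma dh_dh: assumes "x \<in> carrier (D p q)" shows "dh (p - 1) q (dh p q x) = \<zero>\<^bsub>D (p - 1 - 1) q\<^esub>"
proof (cases "1 \<le> p - 1 \<and> 0 \<le> q")
  case True
  then obtain p' q' where e: "p - 1 = 1 + int p'" "q = int q'" by (meson int_1_cases int_0_cases)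
  then have p: "p = 1 + int (Suc p')" by simp
  have "x \<in> carrier (DM q' (Suc (Suc p')))" using assms D_nat[of "Suc (Suc p')" q'] by (simp add: p e(2))
  then have "dh (1 + int p') (int q') (dh (1 + int (Suc p')) (int q') x) = \<zero>\<^bsub>DM q' p'\<^esub>"
    unfolding dh_Suc by (rule Nq.bdry_bdry)
  then show ?thesis using e p by (simp add: D_nat)
next
  case False
  then show ?thesis by (auto simp: dh_def)
qed

lemma dv_dv: assumes "x \<in> carrier (D p q)" shows "dv p (q - 1) (dv p q x) = \<zero>\<^bsub>D p (q - 1 - 1)\<^esub>"
proof (cases "0 \<le> p \<and> 1 \<le> q - 1")
  case True
  then obtain p' q' where e: "p = int p'" "q - 1 = 1 + int q'" by (meson int_1_cases int_0_cases)
  then have q: "q = 1 + int (Suc q')" by simp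
  have x: "x \<in> carrier (DM (Suc (Suc q')) p')" using assms D_nat[of p' "Suc (Suc q')"] by (simp add: q e(1))
  have "dv (int p') (1 + int q') (dv (int p') (1 + int (Suc q')) x) = \<zero>\<^bsub>DM q' p'\<^esub>"
    unfolding dv_Suc
    using lin_maps_closed[OF vM_lin x] vM_vM[OF x] lin_maps_zero[OF sg_lin Nq.module_CM Nq.module_CM, OF Nq.module_CM]
    by (simp add: sg_nat[OF vM_lin Nq.module_CM Nq.module_CM])
  then show ?thesis using e q by (simp add: D_nat)
next
  case False
  then show ?thesis by (auto simp: dv_def)
qed

lemma dh_dv:
  assumes "x \<in> carrier (D p q)"
  shows "dh p (q - 1) (dv p q x) \<oplus>\<^bsub>D (p - 1) (q - 1)\<^esub> dv (p - 1) q (dh p q x) = \<zero>\<^bsub>D (p - 1) (q - 1)\<^esub>"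
proof (cases "1 \<le> p \<and> 1 \<le> q")
  case True
  then obtain p' q' where e: "p = 1 + int p'" "q = 1 + int q'" by (meson int_1_cases)
  have x: "x \<in> carrier (DM (Suc q') (Suc p'))" using assms by (simp add: e)
  interpret M: module R "DM q' p'" by (rule Nq.module_CM)
  let ?y = "bN q' p' (vM q' (Suc p') x)"
  have yc: "?y \<in> carrier (DM q' p')" by (rule Nq.bdry_closed[OF lin_maps_closed[OF vM_lin x]])
  have 1: "dh (1 + int p') (int q') (dv (int (Suc p')) (1 + int q') x) = sg (DM q' p') (Suc p') ?y"
    unfolding dh_Suc dv_Suc
    by (rule sg_nat[OF Nq.bdry_lin Nq.module_CM Nq.module_CM lin_maps_closed[OF vM_lin x]])
  have 2: "dv (int p') (1 + int q') (dh (1 + int p') (int (Suc q')) x) = sg (DM q' p') p' ?y"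
    unfolding dh_Suc dv_Suc by (simp add: vM_bN[OF x])
  have "sg (DM q' p') (Suc p') ?y \<oplus>\<^bsub>DM q' p'\<^esub> sg (DM q' p') p' ?y = \<zero>\<^bsub>DM q' p'\<^esub>"
    using yc by (simp add: sg_Suc[OF Nq.module_CM] M.l_neg sg_closed[OF Nq.module_CM])
  then show ?thesis using 1 2 by (simp add: e D_nat)
next
  case False
  interpret M: module R "D (p - 1) (q - 1)" by (rule modD)
  have "dh p (q - 1) (dv p q x) = \<zero>\<^bsub>D (p - 1) (q - 1)\<^esub>"
    using False lin_maps_zero[OF dh_lin modD modD] by (auto simp: dh_def dv_def)
  moreover have "dv (p - 1) q (dh p q x) = \<zero>\<^bsub>D (p - 1) (q - 1)\<^esub>"
    using False by (auto simp: dv_def)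
  ultimately show ?thesis by simp
qed

sublocale dc: double_complex R D dh dv
  by (rule double_complex.intro)
    (rule P.cringR modD dh_lin dv_lin | erule dh_dh dv_dv dh_dv D_triv)+

section \<open>The augmentation to the chains of \<open>P\<close>\<close>

definition S :: "int \<Rightarrow> ('r, 'a list \<Rightarrow> 'm) module" where
  "S q = (if 0 \<le> q then chain_mod P F (nat q) else chain_mod {} F 0)"

definition dS where "dS q x = (if 1 \<le> q then bdry P F rho (nat q - 1) x else \<zero>\<^bsub>S (q - 1)\<^esub>)"

definition ep where
  "ep q x = finsum (chain_mod P F q) (\<lambda>\<tau>. ext_chain (PX' (hd \<tau>)) P F q (x \<tau>)) (chains N 0)"

definition eps where "eps q x = (if 0 \<le> q then ep (nat q) x else \<zero>\<^bsub>S q\<^esub>)"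

lemma extP_lin: "\<tau> \<in> chains N p \<Longrightarrow> ext_chain (PX' (hd \<tau>)) P F q \<in> lin_maps R (Gq q (hd \<tau>)) (P.CM q)"
  unfolding Gq_def by (rule P.ext_lin[OF PX_sub[OF chains_hd]]) auto

lemma ep_lin: "ep q \<in> lin_maps R (DM q 0) (P.CM q)"
  unfolding ep_def[abs_def] by (rule Nq.CM_linext_lin[OF P.module_CM extP_lin])

lemma ep_gen: "\<tau> \<in> chains N 0 \<Longrightarrow> u \<in> carrier (Gq q (hd \<tau>)) \<Longrightarrow> ep q (gN q 0 \<tau> u) = ext_chain (PX' (hd \<tau>)) P F q u"
  unfolding ep_def by (rule Nq.CM_linext_gen[OF P.module_CM extP_lin])

lemma ep_vM:
  assumes "x \<in> carrier (DM (Suc q) 0)" shows "ep q (vM q 0 x) = bdry P F rho q (ep (Suc q) x)"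
proof (rule Nq.CM_lin_eqI[OF lin_maps_comp[OF vM_lin ep_lin] lin_maps_comp[OF ep_lin P.bdry_lin] P.module_CM _ assms])
  fix \<tau> u assume t: "\<tau> \<in> chains N 0" and u: "u \<in> carrier (Gq (Suc q) (hd \<tau>))"
  have X: "hd \<tau> \<in> N" by (rule chains_hd[OF t])
  have b: "bX q (hd \<tau>) u \<in> carrier (Gq q (hd \<tau>))"
    using poset_sheaf.bdry_closed[OF sheafX[OF X]] u by (simp add: Gq_def)
  show "ep q (vM q 0 (gN (Suc q) 0 \<tau> u)) = bdry P F rho q (ep (Suc q) (gN (Suc q) 0 \<tau> u))"
    using P.ext_bdry[OF PX_sub[OF X] order_refl] u
    by (simp add: vM_gen[OF t u] ep_gen[OF t u] ep_gen[OF t b] Gq_def)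
qed

lemma atMost_Suc_0: "{..Suc 0} = {0, Suc 0}" by auto

lemma chains_1E:
  assumes "\<tau> \<in> chains N (Suc 0)" obtains X Y where "\<tau> = [Y, X]" "X \<in> N" "Y \<in> N" "X \<subseteq> Y"
  using assms by (auto simp: chains_altdef length_Suc_conv)

lemma chains_0E:
  assumes "\<tau> \<in> chains N 0" obtains X where "\<tau> = [X]" "X \<in> N"
  using assms by (auto simp: chains_altdef length_Suc_conv)

lemma chains_0I: "X \<in> N \<Longrightarrow> [X] \<in> chains N 0"
  by (auto simp: chains_altdef)

lemma bN_gen_1:
  assumes "X \<in> N" "Y \<in> N" "X \<subseteq> Y" "u \<in> carrier (Gq q Y)"
  shows "bN q 0 (gN q (Suc 0) [Y,X] u) = gN q 0 [X] (Ext q Y X u) \<ominus>\<^bsub>DM q 0\<^esub> gN q 0 [Y] u"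
proof -
  interpret M: module R "DM q 0" by (rule Nq.module_CM)
  have t: "[Y,X] \<in> chains N (Suc 0)" using assms by (auto simp: chains_altdef)
  have "bN q 0 (gN q (Suc 0) [Y,X] u) = Nq.bd q 0 [Y,X] u"
    by (rule Nq.bdry_gen[OF t]) (use assms(4) in simp)
  moreover have "gN q 0 [X] (Ext q Y X u) \<in> carrier (DM q 0)" "gN q 0 [Y] u \<in> carrier (DM q 0)"
    using assms lin_maps_closed[OF Ext_lin[OF assms(1,3)] assms(4)] by (auto intro!: Nq.gen_closed chains_0I)
  ultimately show ?thesis
    by (simp add: Nq.bd_def atMost_Suc_0 M.finsum_insert Nq.cf_def face_def sg_def a_minus_def)
qed

text \<open>Extended to \<open>P\<close>, the two faces of a chain \<open>[Y, X]\<close> give the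
  same element, once by way of \<open>P_X\<close> and once directly from \<open>P_Y\<close>, and
  they enter with opposite signs.\<close>

lemma ep_bN:
  assumes "x \<in> carrier (DM q (Suc 0))" shows "ep q (bN q 0 x) = \<zero>\<^bsub>P.CM q\<^esub>"
proof (rule Nq.CM_lin_eqI[OF lin_maps_comp[OF Nq.bdry_lin ep_lin] lin_maps_zero_map[OF P.module_CM] P.module_CM _ assms])
  fix \<tau> u assume t: "\<tau> \<in> chains N (Suc 0)" and u: "u \<in> carrier (Gq q (hd \<tau>))"
  obtain X Y where XY: "\<tau> = [Y, X]" "X \<in> N" "Y \<in> N" "X \<subseteq> Y" using chains_1E[OF t] .
  have uY: "u \<in> carrier (Gq q Y)" using u XY(1) by simp
  have e: "Ext q Y X u \<in> carrier (Gq q X)" by (rule lin_maps_closed[OF Ext_lin[OF XY(2,4)] uY])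
  have g: "gN q 0 [X] (Ext q Y X u) \<in> carrier (DM q 0)" "gN q 0 [Y] u \<in> carrier (DM q 0)"
    using XY e uY by (auto intro!: Nq.gen_closed chains_0I)
  have "ext_chain (PX' X) P F q (Ext q Y X u) = ext_chain (PX' Y) P F q u"
    unfolding Ext_def by (rule P.ext_ext[OF PX_anti[OF XY(4)] PX_sub[OF XY(2)]])
  moreover have "ext_chain (PX' Y) P F q u \<in> carrier (P.CM q)"
    using lin_maps_closed[OF extP_lin[OF chains_0I[OF XY(3)]]] uY by simp
  ultimately show "ep q (bN q 0 (gN q (Suc 0) \<tau> u)) = \<zero>\<^bsub>P.CM q\<^esub>"
    using ep_gen[OF chains_0I[OF XY(2)], of "Ext q Y X u" q] ep_gen[OF chains_0I[OF XY(3)], of u q] e uY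
    by (simp add: XY(1) bN_gen_1[OF XY(2-4) uY] lin_maps_minus[OF ep_lin Nq.module_CM P.module_CM g]
      abelian_group.minus_eq_zero_iff[OF module.axioms(2)[OF P.module_CM]])
qed

text \<open>\<open>Kc \<sigma>\<close> is the largest simplex of the nerve whose intersection contains the chain \<open>\<sigma>\<close>;
  coning off with it contracts the rows.  Upper convexity ensures that it is nonempty.\<close>

definition Kc :: "'a list \<Rightarrow> 'k set" where "Kc \<sigma> = {\<alpha> \<in> K. set \<sigma> \<subseteq> Pa \<alpha>}"

lemma Kc:
  assumes "\<sigma> \<in> chains P q" shows "Kc \<sigma> \<in> N" "\<sigma> \<in> chains (PX' (Kc \<sigma>)) q"
proof -
  have s: "\<sigma> \<noteq> []" "set \<sigma> \<subseteq> P" "sorted_wrt (\<ge>) \<sigma>" using assms by (auto simp: chains_altdef)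
  then have "last \<sigma> \<in> P" by auto
  then obtain \<alpha> where a: "\<alpha> \<in> K" "last \<sigma> \<in> Pa \<alpha>" using cover by blast
  have "\<sigma> = butlast \<sigma> @ [last \<sigma>]" using s(1) by simp
  then have "last \<sigma> \<le> x" if "x \<in> set \<sigma>" for x
    using s(3) that by (metis Un_iff list.set_intros(1) order_refl set_append set_ConsD sorted_wrt_append empty_iff empty_set)
  then have "set \<sigma> \<subseteq> Pa \<alpha>" using upper[OF a(1)] a(2) s(2) unfolding upper_convex_def by blast
  then have "\<alpha> \<in> Kc \<sigma>" using a(1) by (simp add: Kc_def)
  moreover have sub: "set \<sigma> \<subseteq> PX' (Kc \<sigma>)" by (auto simp: PX_def Kc_def)
  moreover have "hd \<sigma> \<in> set \<sigma>" using s(1) by simp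
  ultimately show "Kc \<sigma> \<in> N" unfolding nerve_def by (auto simp: Kc_def)
  show "\<sigma> \<in> chains (PX' (Kc \<sigma>)) q" using assms sub by (simp add: chains_altdef)
qed

lemma Kc_max: assumes "X \<in> N" "\<sigma> \<in> chains (PX' X) q" shows "X \<subseteq> Kc \<sigma>" "\<sigma> \<in> chains P q"
  using assms chains_mono[OF PX_sub[OF assms(1)]] by (auto simp: Kc_def nerve_def PX_def chains_altdef)

text \<open>Chains list the largest element first, so the cone point, being a greatest element, goes
  to the head. Chains may repeat elements, hence this works even if \<open>Kc \<sigma>\<close>
  already occurs in \<tau>.\<close>

lemma Kc_Cons:
  assumes "\<tau> \<in> chains N p" "\<sigma> \<in> chains (PX' (hd \<tau>)) q" shows "Kc \<sigma> # \<tau> \<in> chains N (Suc p)"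
proof -
  have X: "hd \<tau> \<in> N" by (rule chains_hd[OF assms(1)])
  note m = Kc_max[OF X assms(2)]
  obtain X \<tau>' where t: "\<tau> = X # \<tau>'" using assms(1) by (cases \<tau>) (auto simp: chains_altdef)
  have "Y \<subseteq> Kc \<sigma>" if "Y \<in> set \<tau>" for Y using that m(1) assms(1) by (auto simp: t chains_altdef)
  then show ?thesis using assms(1) Kc(1)[OF m(2)] by (auto simp: chains_altdef)
qed

section \<open>Contraction of the rows\<close>

lemma gX_lin: "X \<in> N \<Longrightarrow> \<sigma> \<in> chains (PX' X) q \<Longrightarrow> gX q X \<sigma> \<in> lin_maps R (F (hd \<sigma>)) (Gq q X)"
  unfolding Gq_def by (rule poset_sheaf.gen_lin[OF sheafX])

lemma gX_closed: "X \<in> N \<Longrightarrow> \<sigma> \<in> chains (PX' X) q \<Longrightarrow> m \<in> carrier (F (hd \<sigma>)) \<Longrightarrow> gX q X \<sigma> m \<in> carrier (Gq q X)"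
  by (rule lin_maps_closed[OF gX_lin])

lemma Ext_gX: "X \<subseteq> Y \<Longrightarrow> \<sigma> \<in> chains (PX' Y) q \<Longrightarrow> Ext q Y X (gX q Y \<sigma> m) = gX q X \<sigma> m"
  unfolding Ext_def by (rule P.ext_gen[OF PX_anti])

text \<open>Elements of \<open>DM q p\<close> are chains with coefficients in chains, so generators
  are taken at both levels: a chain \<tau> of the nerve and a chain \<sigma> of the intersection at
  its head.\<close>

lemma DM_lin_eqI:
  assumes f: "f \<in> lin_maps R (DM q p) M" and g: "g \<in> lin_maps R (DM q p) M" and M: "module R M"
    and eq: "\<And>\<tau> \<sigma> m. \<tau> \<in> chains N p \<Longrightarrow> \<sigma> \<in> chains (PX' (hd \<tau>)) q \<Longrightarrow> m \<in> carrier (F (hd \<sigma>)) \<Longrightarrow>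
        f (gN q p \<tau> (gX q (hd \<tau>) \<sigma> m)) = g (gN q p \<tau> (gX q (hd \<tau>) \<sigma> m))"
    and x: "x \<in> carrier (DM q p)"
  shows "f x = g x"
proof (rule Nq.CM_lin_eqI[OF f g M _ x])
  fix \<tau> u assume t: "\<tau> \<in> chains N p" and u: "u \<in> carrier (Gq q (hd \<tau>))"
  have X: "hd \<tau> \<in> N" by (rule chains_hd[OF t])
  note gl = Nq.gen_lin[OF t, of q]
  have fl: "(\<lambda>u. f (gN q p \<tau> u)) \<in> lin_maps R (chain_mod (PX' (hd \<tau>)) F q) M"
    and gl: "(\<lambda>u. g (gN q p \<tau> u)) \<in> lin_maps R (chain_mod (PX' (hd \<tau>)) F q) M"
    using lin_maps_comp[OF gl f] lin_maps_comp[OF gl g] unfolding Gq_def[of q "hd \<tau>"] .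
  have u': "u \<in> carrier (chain_mod (PX' (hd \<tau>)) F q)" using u by (simp add: Gq_def)
  show "f (gN q p \<tau> u) = g (gN q p \<tau> u)"
    by (rule poset_sheaf.CM_lin_eqI[OF sheafX[OF X] fl gl M eq[OF t] u'])
qed

text \<open>The double sum splits an element along both \<tau> and \<sigma>, because the cone point
  depends on \<sigma>. The coefficient in \<open>F (hd \<sigma>)\<close> is kept and only moved to
  the intersection of \<open>Kc \<sigma>\<close>, which still contains \<sigma>.\<close>

definition cone :: "nat \<Rightarrow> nat \<Rightarrow> ('k set list \<Rightarrow> 'a list \<Rightarrow> 'm) \<Rightarrow> 'k set list \<Rightarrow> 'a list \<Rightarrow> 'm" where
  "cone q p x = finsum (DM q (Suc p)) (\<lambda>\<tau>. finsum (DM q (Suc p))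
     (\<lambda>\<sigma>. gN q (Suc p) (Kc \<sigma> # \<tau>) (gX q (Kc \<sigma>) \<sigma> (x \<tau> \<sigma>))) (chains (PX' (hd \<tau>)) q)) (chains N p)"

lemma cone_term_lin:
  assumes "\<tau> \<in> chains N p" "\<sigma> \<in> chains (PX' (hd \<tau>)) q"
  shows "(\<lambda>m. gN q (Suc p) (Kc \<sigma> # \<tau>) (gX q (Kc \<sigma>) \<sigma> m)) \<in> lin_maps R (F (hd \<sigma>)) (DM q (Suc p))"
proof -
  note m = Kc_max[OF chains_hd[OF assms(1)] assms(2)]
  have "gX q (Kc \<sigma>) \<sigma> \<in> lin_maps R (F (hd \<sigma>)) (Gq q (hd (Kc \<sigma> # \<tau>)))"
    using gX_lin[OF Kc[OF m(2)]] by simp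
  then show ?thesis by (rule lin_maps_comp[OF _ Nq.gen_lin[OF Kc_Cons[OF assms]]])
qed

lemma cone_inner_lin:
  assumes "\<tau> \<in> chains N p"
  shows "(\<lambda>u. finsum (DM q (Suc p)) (\<lambda>\<sigma>. gN q (Suc p) (Kc \<sigma> # \<tau>) (gX q (Kc \<sigma>) \<sigma> (u \<sigma>))) (chains (PX' (hd \<tau>)) q))
    \<in> lin_maps R (Gq q (hd \<tau>)) (DM q (Suc p))"
  unfolding Gq_def[of q "hd \<tau>"]
  by (rule poset_sheaf.CM_linext_lin[OF sheafX[OF chains_hd[OF assms]] Nq.module_CM cone_term_lin[OF assms]])

lemma cone_lin: "cone q p \<in> lin_maps R (DM q p) (DM q (Suc p))"
  unfolding cone_def[abs_def] by (rule Nq.CM_linext_lin[OF Nq.module_CM cone_inner_lin])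

lemma cone_gen:
  assumes "\<tau> \<in> chains N p" "\<sigma> \<in> chains (PX' (hd \<tau>)) q" "m \<in> carrier (F (hd \<sigma>))"
  shows "cone q p (gN q p \<tau> (gX q (hd \<tau>) \<sigma> m)) = gN q (Suc p) (Kc \<sigma> # \<tau>) (gX q (Kc \<sigma>) \<sigma> m)"
proof -
  have X: "hd \<tau> \<in> N" by (rule chains_hd[OF assms(1)])
  have "cone q p (gN q p \<tau> (gX q (hd \<tau>) \<sigma> m)) = finsum (DM q (Suc p))
     (\<lambda>\<sigma>'. gN q (Suc p) (Kc \<sigma>' # \<tau>) (gX q (Kc \<sigma>') \<sigma>' (gX q (hd \<tau>) \<sigma> m \<sigma>'))) (chains (PX' (hd \<tau>)) q)"
    unfolding cone_def by (rule Nq.CM_linext_gen[OF Nq.module_CM cone_inner_lin assms(1) gX_closed[OF X assms(2,3)]])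
  also have "\<dots> = gN q (Suc p) (Kc \<sigma> # \<tau>) (gX q (Kc \<sigma>) \<sigma> m)"
    by (rule poset_sheaf.CM_linext_gen[OF sheafX[OF X] Nq.module_CM cone_term_lin[OF assms(1)] assms(2,3)])
  finally show ?thesis .
qed

text \<open>Deleting the cone point gives back the generator, since \<open>Ext\<close> moves
  \<sigma> from the intersection of \<open>Kc \<sigma>\<close> to that of \<open>hd \<tau>\<close>.
  The other faces make up the cone of the boundary, with the index shifted by one and hence with the
  opposite sign.\<close>

lemma cone_homotopy:
  assumes "x \<in> carrier (DM q (Suc p))"
  shows "bN q (Suc p) (cone q (Suc p) x) \<oplus>\<^bsub>DM q (Suc p)\<^esub> cone q p (bN q p x) = x"
proof (rule DM_lin_eqI[OF lin_maps_plus[OF lin_maps_comp[OF cone_lin Nq.bdry_lin] lin_maps_comp[OF Nq.bdry_lin cone_lin] Nq.module_CM]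
      lin_maps_id Nq.module_CM _ assms])
  fix \<tau> \<sigma> m assume t: "\<tau> \<in> chains N (Suc p)" and s: "\<sigma> \<in> chains (PX' (hd \<tau>)) q" and m: "m \<in> carrier (F (hd \<sigma>))"
  let ?M = "DM q (Suc p)" and ?e = "gN q (Suc p) \<tau> (gX q (hd \<tau>) \<sigma> m)"
  interpret M: module R ?M by (rule Nq.module_CM)
  have X: "hd \<tau> \<in> N" by (rule chains_hd[OF t])
  note mx = Kc_max[OF X s]
  note Kt = Kc_Cons[OF t s]
  note gK = gX_closed[OF Kc[OF mx(2)] m]
  note gT = gX_closed[OF X s m]
  have ec: "?e \<in> carrier ?M" by (rule Nq.gen_closed[OF t gT])
  have tne: "\<tau> \<noteq> []" using t by (auto simp: chains_altdef)
  define g where "g i = gN q (Suc p) (Kc \<sigma> # face i \<tau>) (gX q (Kc \<sigma>) \<sigma> m)" for i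
  \<comment> \<open>All faces of \<tau> get the same cone point \<open>Kc \<sigma>\<close>: if the
    head is dropped, the new head is a subset of it, so its intersection still contains
    \<sigma>.\<close>
  have f: "face i \<tau> \<in> chains N p" "\<sigma> \<in> chains (PX' (hd (face i \<tau>))) q" "Nq.cf q i \<tau> (gX q (hd \<tau>) \<sigma> m) = gX q (hd (face i \<tau>)) \<sigma> m"
    if "i \<le> Suc p" for i
  proof -
    show "face i \<tau> \<in> chains N p" by (rule chains_face[OF t that])
    have "\<sigma> \<in> chains (PX' (hd (face i \<tau>))) q \<and> Nq.cf q i \<tau> (gX q (hd \<tau>) \<sigma> m) = gX q (hd (face i \<tau>)) \<sigma> m"
    proof (cases i)
      case 0
      obtain Y Z \<tau>' where e: "\<tau> = Y # Z # \<tau>'" using t by (auto simp: chains_altdef length_Suc_conv)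
      have "Z \<subseteq> Y" using t by (auto simp: e chains_altdef)
      then show ?thesis using Ext_gX[of Z Y \<sigma> q m] s chains_mono[OF PX_anti[of Z Y], of q] by (auto simp: 0 e face_0 Nq.cf_def)
    next
      case (Suc k)
      then show ?thesis using s tne by (simp add: hd_face_Suc Nq.cf_def)
    qed
    then show "\<sigma> \<in> chains (PX' (hd (face i \<tau>))) q" "Nq.cf q i \<tau> (gX q (hd \<tau>) \<sigma> m) = gX q (hd (face i \<tau>)) \<sigma> m" by auto
  qed
  have gc: "g i \<in> carrier ?M" if "i \<le> Suc p" for i
    unfolding g_def by (rule Nq.gen_closed[OF Kc_Cons[OF f(1,2)[OF that]]]) (use gK in simp)
  let ?S = "finsum ?M (\<lambda>i. sg ?M i (g i)) {..Suc p}"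
  have Sc: "?S \<in> carrier ?M" using gc sg_closed[OF Nq.module_CM] by (intro M.finsum_closed) auto
  have 1: "cone q p (bN q p ?e) = ?S"
    unfolding Nq.bdry_gen[OF t gT]
    by (rule Nq.lin_maps_bd[OF cone_lin Nq.module_CM t gT]) (simp add: f(3) cone_gen[OF f(1,2) m] g_def)
  let ?h = "\<lambda>i. sg ?M i (gN q (Suc p) (face i (Kc \<sigma> # \<tau>)) (Nq.cf q i (Kc \<sigma> # \<tau>) (gX q (Kc \<sigma>) \<sigma> m)))"
  have hS: "?h (Suc i) = \<ominus>\<^bsub>?M\<^esub> sg ?M i (g i)" if "i \<le> Suc p" for i
    using sg_Suc[OF Nq.module_CM gc[OF that]] by (simp add: Nq.cf_def face_Suc_Cons g_def)
  have h0: "?h 0 = ?e"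
    using Ext_gX[OF mx(1) Kc(2)[OF mx(2)], of m] tne by (simp add: Nq.cf_def face_0 hd_conv_nth)
  have "bN q (Suc p) (cone q (Suc p) ?e) = bN q (Suc p) (gN q (Suc (Suc p)) (Kc \<sigma> # \<tau>) (gX q (Kc \<sigma>) \<sigma> m))"
    by (simp add: cone_gen[OF t s m])
  also have "\<dots> = finsum ?M ?h {..Suc (Suc p)}"
    using Nq.bdry_gen[OF Kt, of "gX q (Kc \<sigma>) \<sigma> m"] gK by (simp add: Nq.bd_def)
  also have "\<dots> = finsum ?M (\<lambda>i. ?h (Suc i)) {..Suc p} \<oplus>\<^bsub>?M\<^esub> ?h 0"
  proof (rule M.finsum_Suc2)
    show "?h \<in> {..Suc (Suc p)} \<rightarrow> carrier ?M"
    proof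
      fix i assume "i \<in> {..Suc (Suc p)}"
      then show "?h i \<in> carrier ?M" using lin_maps_closed[OF Nq.bd_term_lin[OF Kt], of i "gX q (Kc \<sigma>) \<sigma> m"] gK by simp
    qed
  qed
  also have "finsum ?M (\<lambda>i. ?h (Suc i)) {..Suc p} = finsum ?M (\<lambda>i. \<ominus>\<^bsub>?M\<^esub> sg ?M i (g i)) {..Suc p}"
    using gc sg_closed[OF Nq.module_CM] hS by (intro M.finsum_cong') auto
  also have "\<dots> = \<ominus>\<^bsub>?M\<^esub> ?S"
    using gc sg_closed[OF Nq.module_CM] by (intro lin_maps_finsum[OF lin_maps_neg[OF lin_maps_id Nq.module_CM] Nq.module_CM Nq.module_CM, symmetric]) auto
  finally have 2: "bN q (Suc p) (cone q (Suc p) ?e) = \<ominus>\<^bsub>?M\<^esub> ?S \<oplus>\<^bsub>?M\<^esub> ?e" using h0 by simp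
  show "bN q (Suc p) (cone q (Suc p) ?e) \<oplus>\<^bsub>?M\<^esub> cone q p (bN q p ?e) = ?e"
    unfolding 1 2 using Sc ec M.a_comm[of "\<ominus>\<^bsub>?M\<^esub> ?S" ?e] M.a_assoc[of ?e "\<ominus>\<^bsub>?M\<^esub> ?S" ?S] by (simp add: M.l_neg)
qed

text \<open>A linear section of the augmentation, placing each chain at the vertex of the nerve that
  also serves as its cone point.\<close>

definition sect :: "nat \<Rightarrow> ('a list \<Rightarrow> 'm) \<Rightarrow> 'k set list \<Rightarrow> 'a list \<Rightarrow> 'm" where
  "sect q s = finsum (DM q 0) (\<lambda>\<sigma>. gN q 0 [Kc \<sigma>] (gX q (Kc \<sigma>) \<sigma> (s \<sigma>))) (chains P q)"

lemma sect_term_lin: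
  assumes "\<sigma> \<in> chains P q" shows "(\<lambda>m. gN q 0 [Kc \<sigma>] (gX q (Kc \<sigma>) \<sigma> m)) \<in> lin_maps R (F (hd \<sigma>)) (DM q 0)"
proof -
  have "gX q (Kc \<sigma>) \<sigma> \<in> lin_maps R (F (hd \<sigma>)) (Gq q (hd [Kc \<sigma>]))" using gX_lin[OF Kc[OF assms]] by simp
  then show ?thesis by (rule lin_maps_comp[OF _ Nq.gen_lin[OF chains_0I[OF Kc(1)[OF assms]]]])
qed

lemma sect_lin: "sect q \<in> lin_maps R (P.CM q) (DM q 0)"
  unfolding sect_def[abs_def] by (rule P.CM_linext_lin[OF Nq.module_CM sect_term_lin])

lemma sect_gen: "\<sigma> \<in> chains P q \<Longrightarrow> m \<in> carrier (F (hd \<sigma>)) \<Longrightarrow> sect q (P.gn q \<sigma> m) = gN q 0 [Kc \<sigma>] (gX q (Kc \<sigma>) \<sigma> m)"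
  unfolding sect_def by (rule P.CM_linext_gen[OF Nq.module_CM sect_term_lin])

lemma ep_gen_gX:
  assumes "X \<in> N" "\<sigma> \<in> chains (PX' X) q" "m \<in> carrier (F (hd \<sigma>))"
  shows "ep q (gN q 0 [X] (gX q X \<sigma> m)) = P.gn q \<sigma> m"
  using ep_gen[OF chains_0I[OF assms(1)], of "gX q X \<sigma> m" q] gX_closed[OF assms] P.ext_gen[OF PX_sub[OF assms(1)] assms(2)]
  by simp

lemma ep_sect: assumes "s \<in> carrier (P.CM q)" shows "ep q (sect q s) = s"
  by (rule P.CM_lin_eqI[OF lin_maps_comp[OF sect_lin ep_lin] lin_maps_id P.module_CM _ assms])
    (simp add: sect_gen ep_gen_gX[OF Kc])

text \<open>At the end of the row the boundary of the coned chain \<open>[Kc \<sigma>, X]\<close> is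
  \<open>[X]\<close> minus \<open>[Kc \<sigma>]\<close>, and \<open>sect\<close> after
  \<open>ep\<close> restores the second vertex.\<close>

lemma cone_homotopy_0:
  assumes "x \<in> carrier (DM q 0)"
  shows "bN q 0 (cone q 0 x) \<oplus>\<^bsub>DM q 0\<^esub> sect q (ep q x) = x"
proof (rule DM_lin_eqI[OF lin_maps_plus[OF lin_maps_comp[OF cone_lin Nq.bdry_lin] lin_maps_comp[OF ep_lin sect_lin] Nq.module_CM]
      lin_maps_id Nq.module_CM _ assms])
  fix \<tau> \<sigma> m assume t: "\<tau> \<in> chains N 0" and s: "\<sigma> \<in> chains (PX' (hd \<tau>)) q" and m: "m \<in> carrier (F (hd \<sigma>))"
  obtain X where X: "\<tau> = [X]" "X \<in> N" using chains_0E[OF t] .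
  have sX: "\<sigma> \<in> chains (PX' X) q" using s X by simp
  interpret M: module R "DM q 0" by (rule Nq.module_CM)
  note mx = Kc_max[OF X(2) sX]
  note gK = gX_closed[OF Kc[OF mx(2)] m]
  note gT = gX_closed[OF X(2) sX m]
  have c: "gN q 0 [X] (gX q X \<sigma> m) \<in> carrier (DM q 0)" "gN q 0 [Kc \<sigma>] (gX q (Kc \<sigma>) \<sigma> m) \<in> carrier (DM q 0)"
    using gT gK X(2) Kc(1)[OF mx(2)] by (auto intro!: Nq.gen_closed chains_0I)
  show "bN q 0 (cone q 0 (gN q 0 \<tau> (gX q (hd \<tau>) \<sigma> m))) \<oplus>\<^bsub>DM q 0\<^esub> sect q (ep q (gN q 0 \<tau> (gX q (hd \<tau>) \<sigma> m)))
      = gN q 0 \<tau> (gX q (hd \<tau>) \<sigma> m)"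
    using cone_gen[OF t s m] bN_gen_1[OF X(2) Kc(1)[OF mx(2)] mx(1) gK] Ext_gX[OF mx(1) Kc(2)[OF mx(2)]] c
    by (simp add: X(1) ep_gen_gX[OF X(2) sX m] sect_gen[OF mx(2) m] M.minus_plus_cancel)
qed

lemma S_nat: "S (int q) = P.CM q" by (simp add: S_def)
lemma S_Suc: "S (1 + int q) = P.CM (Suc q)" using S_nat[of "Suc q"] by simp
lemma dS_Suc: "dS (1 + int q) x = bdry P F rho q x" by (simp add: dS_def nat_add_distrib)

lemma modS: "module R (S q)"
  by (simp add: S_def P.module_CM chain_mod_empty(1))

lemma dS_lin: "dS q \<in> lin_maps R (S q) (S (q - 1))"
proof (cases "1 \<le> q")
  case True
  then obtain q' where e: "q = 1 + int q'" by (rule int_1_cases)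
  show ?thesis unfolding e using P.bdry_lin by (simp add: dS_Suc[abs_def] S_nat S_Suc)
next
  case False
  then have "dS q = (\<lambda>x. \<zero>\<^bsub>S (q - 1)\<^esub>)" by (auto simp: dS_def)
  then show ?thesis using lin_maps_zero_map[OF modS] by metis
qed

sublocale adc: augmented_double_complex R D dh dv S dS eps
proof (intro augmented_double_complex.intro augmented_double_complex_axioms.intro)
  fix p q :: int
  show "double_complex R D dh dv" by (rule dc.double_complex_axioms)
  show "module R (S q)" "dS q \<in> lin_maps R (S q) (S (q - 1))" by (rule modS dS_lin)+
  show "dS (q - 1) (dS q s) = \<zero>\<^bsub>S (q - 1 - 1)\<^esub>" if s: "s \<in> carrier (S q)" for s
  proof (cases "1 \<le> q - 1")
    case True
    then obtain q' where e: "q - 1 = 1 + int q'" by (rule int_1_cases)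
    then have q: "q = 1 + int (Suc q')" by simp
    have "s \<in> carrier (P.CM (Suc (Suc q')))" using s S_nat[of "Suc (Suc q')"] by (simp add: q)
    then have "dS (1 + int q') (dS (1 + int (Suc q')) s) = \<zero>\<^bsub>P.CM q'\<^esub>" unfolding dS_Suc by (rule P.bdry_bdry)
    then show ?thesis using e q by (simp add: S_nat)
  next
    case False then show ?thesis by (auto simp: dS_def)
  qed
  show "eps q \<in> lin_maps R (D 0 q) (S q)"
  proof (cases "0 \<le> q")
    case True
    then obtain q' where "q = int q'" by (rule int_0_cases)
    then show ?thesis using ep_lin D_nat[of 0] by (simp add: eps_def[abs_def] S_nat)
  next
    case False
    then have "eps q = (\<lambda>x. \<zero>\<^bsub>S q\<^esub>)" by (auto simp: eps_def)
    then show ?thesis using lin_maps_zero_map[OF modS] by metis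
  qed
  show "eps (q - 1) (dv 0 q x) = dS q (eps q x)" if x: "x \<in> carrier (D 0 q)" for x
  proof (cases "1 \<le> q")
    case True
    then obtain q' where e: "q = 1 + int q'" by (rule int_1_cases)
    have "x \<in> carrier (DM (Suc q') 0)" using x D_Suc(2)[of 0 q'] by (simp add: e)
    then show ?thesis using dv_Suc[of 0 q' x] ep_vM[of x q'] by (simp add: e dS_Suc eps_def nat_add_distrib)
  next
    case False
    then have "dv 0 q x = \<zero>\<^bsub>D 0 (q - 1)\<^esub>" "dS q (eps q x) = \<zero>\<^bsub>S (q - 1)\<^esub>" "\<not> 0 \<le> q - 1" by (auto simp: dv_def dS_def)
    then show ?thesis by (simp add: eps_def)
  qed
  show "eps q (dh 1 q x) = \<zero>\<^bsub>S q\<^esub>" if x: "x \<in> carrier (D 1 q)" for x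
  proof (cases "0 \<le> q")
    case True
    then obtain q' where e: "q = int q'" by (rule int_0_cases)
    then show ?thesis using x D_Suc(1)[of 0 q'] dh_Suc[of 0 q' x] ep_bN[of x q'] by (simp add: eps_def S_nat)
  qed (simp add: eps_def)
  show "\<exists>x\<in>carrier (D 0 q). eps q x = s" if s: "s \<in> carrier (S q)" for s
  proof (cases "0 \<le> q")
    case True
    then obtain q' where e: "q = int q'" by (rule int_0_cases)
    have "s \<in> carrier (P.CM q')" using s by (simp add: e S_nat)
    then have "sect q' s \<in> carrier (D 0 q)" "eps q (sect q' s) = s"
      using lin_maps_closed[OF sect_lin] ep_sect D_nat[of 0 q'] by (auto simp: eps_def e)
    then show ?thesis by blast
  next
    case False
    then have "s = \<zero>\<^bsub>S q\<^esub>" using s by (auto simp: S_def chain_mod_empty(2))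
    then show ?thesis using D_triv[of 0 q] False by (auto simp: eps_def)
  qed
  show "\<exists>y\<in>carrier (D 1 q). dh 1 q y = x" if x: "x \<in> carrier (D 0 q)" "eps q x = \<zero>\<^bsub>S q\<^esub>" for x
  proof (cases "0 \<le> q")
    case True
    then obtain q' where e: "q = int q'" by (rule int_0_cases)
    have x': "x \<in> carrier (DM q' 0)" "ep q' x = \<zero>\<^bsub>P.CM q'\<^esub>" using x D_nat[of 0 q'] by (auto simp: e eps_def S_nat)
    interpret M: module R "DM q' 0" by (rule Nq.module_CM)
    \<comment> \<open>In the homotopy formula the second summand vanishes with \<open>ep\<close>, so
      the cone of \<open>x\<close> is the preimage that exactness asks for. In higher degrees the
      same happens for closed \<open>x\<close>.\<close>
    have "bN q' 0 (cone q' 0 x) = x"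
      using cone_homotopy_0[OF x'(1)] x'(2) lin_maps_zero[OF sect_lin P.module_CM Nq.module_CM]
        Nq.bdry_closed[OF lin_maps_closed[OF cone_lin x'(1)]] by simp
    then show ?thesis
      using lin_maps_closed[OF cone_lin x'(1)] D_Suc(1)[of 0 q'] dh_Suc[of 0 q'] by (auto simp: e)
  next
    case False
    then have "x = \<zero>\<^bsub>D 0 q\<^esub>" "carrier (D 1 q) = {\<zero>\<^bsub>D 1 q\<^esub>}" using x D_triv[of 0 q] D_triv[of 1 q] by auto
    then show ?thesis using False by (auto simp: dh_def)
  qed
  show "\<exists>y\<in>carrier (D (p + 1) q). dh (p + 1) q y = x" if p: "0 < p" and x: "x \<in> carrier (D p q)" "dh p q x = \<zero>\<^bsub>D (p - 1) q\<^esub>" for x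
  proof (cases "0 \<le> q")
    case True
    then obtain q' where e: "q = int q'" by (rule int_0_cases)
    have "1 \<le> p" using p by simp
    then obtain p' where p': "p = 1 + int p'" by (rule int_1_cases)
    have x': "x \<in> carrier (DM q' (Suc p'))" "bN q' p' x = \<zero>\<^bsub>DM q' p'\<^esub>" using x by (auto simp: e p' dh_Suc D_nat)
    interpret M: module R "DM q' (Suc p')" by (rule Nq.module_CM)
    have "bN q' (Suc p') (cone q' (Suc p') x) = x"
      using cone_homotopy[OF x'(1)] x'(2) lin_maps_zero[OF cone_lin Nq.module_CM Nq.module_CM]
        Nq.bdry_closed[OF lin_maps_closed[OF cone_lin x'(1)]] by simp
    then have "dh (1 + int (Suc p')) (int q') (cone q' (Suc p') x) = x" unfolding dh_Suc .
    moreover have "cone q' (Suc p') x \<in> carrier (D (1 + int (Suc p')) (int q'))"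
      using lin_maps_closed[OF cone_lin x'(1)] unfolding D_Suc .
    moreover have "p + 1 = 1 + int (Suc p')" using p' by simp
    ultimately show ?thesis unfolding e by metis
  next
    case False
    then have "x = \<zero>\<^bsub>D p q\<^esub>" "carrier (D (p + 1) q) = {\<zero>\<^bsub>D (p + 1) q\<^esub>}" using x D_triv[of p q] D_triv[of "p + 1" q] by auto
    then show ?thesis using False by (auto simp: dh_def)
  qed
qed

lemma HS_eq: "quot_mod (S (int n)) (adc.cycS (int n)) (adc.bndS (int n)) = HS P F rho n"
proof -
  have "adc.bndS (int n) = boundaries P F rho n"
    using dS_Suc[of n] S_Suc[of n] by (auto simp: adc.bndS_def boundaries_def add.commute)
  moreover have "adc.cycS (int n) = cycles P F rho n"
  proof (cases n)
    case 0
    then show ?thesis using S_nat[of 0] by (auto simp: adc.cycS_def cycles_def dS_def)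
  next
    case (Suc k)
    then show ?thesis using S_nat[of k] by (auto simp: adc.cycS_def cycles_def dS_Suc S_Suc)
  qed
  ultimately show ?thesis by (simp add: HS_def S_nat)
qed

end

section \<open>The second page\<close>

lemma chain_mod_zero_iff:
  assumes "x \<in> carrier (chain_mod Q G n)"
  shows "x = \<zero>\<^bsub>chain_mod Q G n\<^esub> \<longleftrightarrow> (\<forall>\<sigma>\<in>chains Q n. x \<sigma> = \<zero>\<^bsub>G (hd \<sigma>)\<^esub>)"
  using assms by (auto simp: chain_mod_eq_pi_mod fun_eq_iff)

lemma sg_eq_zero_iff:
  fixes R :: "'r ring"
  assumes "module R M" "x \<in> carrier M" shows "sg M i x = \<zero>\<^bsub>M\<^esub> \<longleftrightarrow> x = \<zero>\<^bsub>M\<^esub>"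
proof -
  have "sg M i (sg M i x) = x" using sg_sg[OF assms, of i i] by (simp add: sg_def)
  then show ?thesis using lin_maps_zero[OF sg_lin[OF assms(1)] assms(1,1)] by metis
qed

context covering
begin

section \<open>Vertical cycles and vertical homology as sheaves on the nerve\<close>

abbreviation "cyX q X \<equiv> cycles (PX' X) F rho q"
abbreviation "bdX q X \<equiv> boundaries (PX' X) F rho q"
abbreviation "Hq q \<equiv> Hsheaf Pa F rho q"
abbreviation "Hm q \<equiv> Hsheaf_map Pa F rho q"

text \<open>Homology classes belong to vertical cycles only. The cycles therefore form an
  intermediate sheaf: a subsheaf of \<open>Gq\<close> that maps onto the homology sheaf by
  \<open>cl\<close>.\<close>

definition "Zq q X = (Gq q X)\<lparr>carrier := cyX q X\<rparr>"
definition "cl q X u = bdX q X +>\<^bsub>Gq q X\<^esub> u"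

lemma subquotX: "X \<in> N \<Longrightarrow> subquot R (Gq q X) (cyX q X) (bdX q X)"
  unfolding Gq_def by (rule poset_sheaf.HS_subquot[OF sheafX])

lemma Hq_eq: "Hq q X = quot_mod (Gq q X) (cyX q X) (bdX q X)"
  by (simp add: Hsheaf_def HS_def Gq_def)

lemma Ext_cyX: "X \<in> N \<Longrightarrow> X \<subseteq> Y \<Longrightarrow> u \<in> cyX q Y \<Longrightarrow> Ext q Y X u \<in> cyX q X"
  unfolding Ext_def by (rule P.ext_cycles[OF PX_anti PX_sub])

lemma Hm_cl: "X \<in> N \<Longrightarrow> X \<subseteq> Y \<Longrightarrow> u \<in> cyX q Y \<Longrightarrow> Hm q Y X (cl q Y u) = cl q X (Ext q Y X u)"
  unfolding Ext_def cl_def Gq_def Hsheaf_map_def by (rule P.HS_map_coset[OF PX_anti PX_sub])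

lemma Hq_repE:
  assumes "X \<in> N" "c \<in> carrier (Hq q X)" obtains u where "u \<in> cyX q X" "c = cl q X u"
  using assms(2) unfolding Hq_eq subquot.carrier_quot[OF subquotX[OF assms(1)]] cl_def by blast

lemma cyX_carrier: "X \<in> N \<Longrightarrow> u \<in> cyX q X \<Longrightarrow> u \<in> carrier (Gq q X)"
  by (rule subquot.A_carrier[OF subquotX])

lemma sheaf_Zq: "poset_sheaf R N (Zq q) (Ext q)"
proof (rule poset_sheaf.intro[OF P.cringR finN])
  show "is_sheaf R N (Zq q) (Ext q)"
    unfolding is_sheaf_def
  proof (intro conjI ballI impI)
    fix X assume X: "X \<in> N"
    interpret subquot R "Gq q X" "cyX q X" "bdX q X" by (rule subquotX[OF X])
    show "module R (Zq q X)" unfolding Zq_def by (rule submodule.submodule_is_module[OF subA mod])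
    show "Ext q X X u = u" if "u \<in> carrier (Zq q X)" for u
      using that Nq.rho_id[OF X, of u q] A_carrier by (simp add: Zq_def)
    fix Y assume Y: "Y \<in> N"
    show "Ext q Y X \<in> lin_maps R (Zq q Y) (Zq q X)" if "X \<le> Y"
      using that Ext_cyX[OF X] cyX_carrier[OF Y] Ext_lin[OF X, of Y q]
      by (intro lin_mapsI) (auto simp: Zq_def lin_maps_add lin_maps_smult)
    fix W u assume "W \<in> N" "X \<le> Y" "Y \<le> W" "u \<in> carrier (Zq q W)"
    then show "Ext q Y X (Ext q W Y u) = Ext q W X u"
      using Nq.rho_comp[OF X Y, of W u q] cyX_carrier by (simp add: Zq_def)
  qed
qed

lemma sheaf_Hq: "poset_sheaf R N (Hq q) (Hm q)"
proof (rule poset_sheaf.intro[OF P.cringR finN])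
  show "is_sheaf R N (Hq q) (Hm q)"
    unfolding is_sheaf_def
  proof (intro conjI ballI impI)
    fix X assume X: "X \<in> N"
    interpret X: subquot R "Gq q X" "cyX q X" "bdX q X" by (rule subquotX[OF X])
    show "module R (Hq q X)" unfolding Hq_eq by (rule X.module_quot)
    show "Hm q X X c = c" if c: "c \<in> carrier (Hq q X)" for c
    proof -
      obtain u where u: "u \<in> cyX q X" "c = cl q X u" using Hq_repE[OF X c] .
      then show ?thesis using Hm_cl[OF X order_refl u(1)] Nq.rho_id[OF X cyX_carrier[OF X u(1)]] by simp
    qed
    fix Y assume Y: "Y \<in> N"
    interpret Y: subquot R "Gq q Y" "cyX q Y" "bdX q Y" by (rule subquotX[OF Y])
    show "Hm q Y X \<in> lin_maps R (Hq q Y) (Hq q X)" if XY: "X \<le> Y"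
    proof (rule lin_mapsI)
      note e = Ext_lin[OF X XY, of q]
      fix c assume c: "c \<in> carrier (Hq q Y)"
      obtain u where u: "u \<in> cyX q Y" "c = cl q Y u" using Hq_repE[OF Y c] .
      have eu: "Ext q Y X u \<in> cyX q X" by (rule Ext_cyX[OF X XY u(1)])
      show "Hm q Y X c \<in> carrier (Hq q X)"
        using X.quotI[OF eu] Hm_cl[OF X XY u(1)] by (simp add: u(2) cl_def Hq_eq)
      {
        fix c' assume c': "c' \<in> carrier (Hq q Y)"
        obtain u' where u': "u' \<in> cyX q Y" "c' = cl q Y u'" using Hq_repE[OF Y c'] .
        have eu': "Ext q Y X u' \<in> cyX q X" by (rule Ext_cyX[OF X XY u'(1)])
        have "c \<oplus>\<^bsub>Hq q Y\<^esub> c' = cl q Y (u \<oplus>\<^bsub>Gq q Y\<^esub> u')"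
          using Y.quot_add[OF u(1) u'(1)] by (simp add: u(2) u'(2) cl_def Hq_eq)
        then show "Hm q Y X (c \<oplus>\<^bsub>Hq q Y\<^esub> c') = Hm q Y X c \<oplus>\<^bsub>Hq q X\<^esub> Hm q Y X c'"
          using X.quot_add[OF eu eu'] Hm_cl[OF X XY Y.A(3)[OF u(1) u'(1)]] Hm_cl[OF X XY u(1)] Hm_cl[OF X XY u'(1)]
            lin_maps_add[OF e cyX_carrier[OF Y u(1)] cyX_carrier[OF Y u'(1)]]
          by (simp add: u(2) u'(2) cl_def Hq_eq)
      }
      fix a assume a: "a \<in> carrier R"
      have "a \<odot>\<^bsub>Hq q Y\<^esub> c = cl q Y (a \<odot>\<^bsub>Gq q Y\<^esub> u)"
        using Y.quot_smult[OF a u(1)] by (simp add: u(2) cl_def Hq_eq)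
      then show "Hm q Y X (a \<odot>\<^bsub>Hq q Y\<^esub> c) = a \<odot>\<^bsub>Hq q X\<^esub> Hm q Y X c"
        using X.quot_smult[OF a eu] Hm_cl[OF X XY Y.A(4)[OF a u(1)]] Hm_cl[OF X XY u(1)]
          lin_maps_smult[OF e a cyX_carrier[OF Y u(1)]]
        by (simp add: u(2) cl_def Hq_eq)
    qed
    fix W c assume W: "W \<in> N" and XY: "X \<le> Y" and YW: "Y \<le> W" and c: "c \<in> carrier (Hq q W)"
    obtain u where u: "u \<in> cyX q W" "c = cl q W u" using Hq_repE[OF W c] .
    have XW: "X \<subseteq> W" using XY YW by blast
    show "Hm q Y X (Hm q W Y c) = Hm q W X c"
      using Nq.rho_comp[OF X Y W XY YW cyX_carrier[OF W u(1)]]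
      by (simp add: u(2) Hm_cl[OF Y YW u(1)] Hm_cl[OF X XY Ext_cyX[OF Y YW u(1)]] Hm_cl[OF X XW u(1)])
  qed
qed

sublocale Zs: poset_sheaf R N "Zq q" "Ext q" for q by (rule sheaf_Zq)
sublocale Hs: poset_sheaf R N "Hq q" "Hm q" for q by (rule sheaf_Hq)

abbreviation "ZM q p \<equiv> chain_mod N (Zq q) p"
abbreviation "HM q p \<equiv> chain_mod N (Hq q) p"
abbreviation "clM q p \<equiv> chmap N (cl q) p"

lemma hom_cl: "sheaf_hom R N (Zq q) (Ext q) (Hq q) (Hm q) (cl q)"
proof (rule sheaf_hom.intro[OF sheaf_Zq sheaf_Hq], rule sheaf_hom_axioms.intro)
  show "cl q X \<in> lin_maps R (Zq q X) (Hq q X)" if "X \<in> N" for X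
    using subquot.quot_proj[OF subquotX[OF that], of q] unfolding Zq_def Hq_eq cl_def[abs_def] .
  show "cl q X (Ext q Y X s) = Hm q Y X (cl q Y s)" if "X \<in> N" "Y \<in> N" "X \<subseteq> Y" "s \<in> carrier (Zq q Y)" for X Y s
    using Hm_cl[OF that(1,3)] that(4) by (simp add: Zq_def)
qed

lemma hom_incl: "sheaf_hom R N (Zq q) (Ext q) (Gq q) (Ext q) (\<lambda>X u. u)"
proof (rule sheaf_hom.intro[OF sheaf_Zq sheaf_Gq], rule sheaf_hom_axioms.intro)
  show "(\<lambda>u. u) \<in> lin_maps R (Zq q X) (Gq q X)" if "X \<in> N" for X
    using cyX_carrier[OF that] by (intro lin_mapsI) (auto simp: Zq_def)
qed simp

lemma ZM_iff: "x \<in> carrier (ZM q p) \<longleftrightarrow> x \<in> carrier (DM q p) \<and> (\<forall>\<tau>\<in>chains N p. x \<tau> \<in> cyX q (hd \<tau>))"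
  using cyX_carrier[OF chains_hd] by (auto simp: chain_mod_eq_pi_mod[of N] Zq_def)

lemma ZM_ops: "x \<oplus>\<^bsub>ZM q p\<^esub> y = x \<oplus>\<^bsub>DM q p\<^esub> y" "a \<odot>\<^bsub>ZM q p\<^esub> x = a \<odot>\<^bsub>DM q p\<^esub> x" "\<zero>\<^bsub>ZM q p\<^esub> = \<zero>\<^bsub>DM q p\<^esub>"
  by (auto simp: chain_mod_eq_pi_mod[of N] Zq_def)

lemma ZM_D: "x \<in> carrier (ZM q p) \<Longrightarrow> x \<in> carrier (DM q p)" by (simp add: ZM_iff)

lemma ZM_minus: "y \<in> carrier (ZM q p) \<Longrightarrow> x \<ominus>\<^bsub>ZM q p\<^esub> y = x \<ominus>\<^bsub>DM q p\<^esub> y"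
  using uminus_eq_smult[OF Zs.module_CM, of y q p] uminus_eq_smult[OF Nq.module_CM ZM_D, of y q p]
  by (simp add: a_minus_def ZM_ops)

text \<open>The two sides are sums in different module records, with the same operations but
  different carriers; the equality comes from naturality of the boundary for the inclusion of
  cycles.\<close>

lemma bZ: assumes "x \<in> carrier (ZM q (Suc p))" shows "bdry N (Zq q) (Ext q) p x = bN q p x"
proof -
  have id: "chmap N (\<lambda>X u. u) n y = y" if "y \<in> carrier (ZM q n)" for n y
    using that by (auto simp: chmap_def chain_mod_eq_pi_mod[of N] fun_eq_iff)
  show ?thesis
    using sheaf_hom.chmap_bdry[OF hom_incl assms] id[OF assms] id[OF Zs.bdry_closed[OF assms]] by simp
qed

lemma bN_ZM: "x \<in> carrier (ZM q (Suc p)) \<Longrightarrow> bN q p x \<in> carrier (ZM q p)"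
  using Zs.bdry_closed[of x q p] bZ by simp

lemma clM_lin: "clM q p \<in> lin_maps R (ZM q p) (HM q p)"
  by (rule sheaf_hom.chmap_lin[OF hom_cl])

lemma clM_bN: "x \<in> carrier (ZM q (Suc p)) \<Longrightarrow> bdry N (Hq q) (Hm q) p (clM q (Suc p) x) = clM q p (bN q p x)"
  using sheaf_hom.chmap_bdry[OF hom_cl] bZ by metis

text \<open>Representatives may be chosen on each chain of the nerve independently, because a chain
  module is a product. This is the exactness by which chains of classes are compared with classes of
  chains.\<close>

lemma clM_onto:
  assumes "c \<in> carrier (HM q p)" shows "\<exists>x\<in>carrier (ZM q p). clM q p x = c"
proof -
  have "\<forall>\<tau>. \<exists>u. \<tau> \<in> chains N p \<longrightarrow> u \<in> cyX q (hd \<tau>) \<and> c \<tau> = cl q (hd \<tau>) u"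
    using assms Hq_repE[OF chains_hd] by (simp add: chain_mod_eq_pi_mod[of N]) metis
  then obtain u where u: "\<And>\<tau>. \<tau> \<in> chains N p \<Longrightarrow> u \<tau> \<in> cyX q (hd \<tau>) \<and> c \<tau> = cl q (hd \<tau>) (u \<tau>)" by metis
  let ?x = "\<lambda>\<tau>. if \<tau> \<in> chains N p then u \<tau> else undefined"
  have "?x \<in> carrier (ZM q p)" using u by (simp add: chain_mod_eq_pi_mod[of N] Zq_def)
  moreover have "clM q p ?x = c" using u assms by (intro ext) (simp add: chmap_def chain_mod_eq_pi_mod[of N])
  ultimately show ?thesis by blast
qed

text \<open>The vertical map acts on the coefficient at each chain of the nerve separately, and its
  sign does not change the kernel. For \<open>q = 0\<close> every element is a cycle and the target
  is the zero module.\<close>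

lemma dv_zero_iff:
  assumes "x \<in> carrier (DM q p)" shows "dv (int p) (int q) x = \<zero>\<^bsub>D (int p) (int q - 1)\<^esub> \<longleftrightarrow> x \<in> carrier (ZM q p)"
proof (cases q)
  case 0
  then show ?thesis using assms
    by (simp add: dv_def ZM_iff) (auto simp: cycles_def chain_mod_eq_pi_mod[of N] Gq_def)
next
  case (Suc k)
  have x: "x \<in> carrier (DM (Suc k) p)" using assms Suc by simp
  have xt: "x \<tau> \<in> carrier (chain_mod (PX' (hd \<tau>)) F (Suc k))" if "\<tau> \<in> chains N p" for \<tau>
    using x that by (simp add: chain_mod_eq_pi_mod[of N] Gq_def)
  have "dv (int p) (int q) x = \<zero>\<^bsub>D (int p) (int q - 1)\<^esub> \<longleftrightarrow> sg (DM k p) p (vM k p x) = \<zero>\<^bsub>DM k p\<^esub>"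
    by (simp add: Suc dv_Suc D_nat)
  also have "\<dots> \<longleftrightarrow> vM k p x = \<zero>\<^bsub>DM k p\<^esub>"
    by (rule sg_eq_zero_iff[OF Nq.module_CM lin_maps_closed[OF vM_lin x]])
  also have "\<dots> \<longleftrightarrow> (\<forall>\<tau>\<in>chains N p. bX k (hd \<tau>) (x \<tau>) = \<zero>\<^bsub>Gq k (hd \<tau>)\<^esub>)"
    unfolding chain_mod_zero_iff[OF lin_maps_closed[OF vM_lin x]] by (simp add: vM_def chmap_def)
  also have "\<dots> \<longleftrightarrow> x \<in> carrier (ZM q p)"
    using assms xt by (simp add: ZM_iff cycles_def Suc Gq_def)
  finally show ?thesis .
qed

section \<open>The second page compared with the homology of the nerve\<close>

definition "Vi q p = dv (int p) (1 + int q) ` carrier (DM (Suc q) p)"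

lemma dv_lin_nat: "dv (int p) (1 + int q) \<in> lin_maps R (DM (Suc q) p) (DM q p)"
  using dv_lin[of "int p" "1 + int q"] by (simp add: D_nat)

lemma Vi_sub: "submodule (Vi q p) R (DM q p)"
  unfolding Vi_def by (rule submodule_image[OF dv_lin_nat Nq.module_CM Nq.module_CM module.carrier_is_submodule[OF Nq.module_CM]])

lemmas Vi = submoduleD[OF Vi_sub Nq.module_CM]

text \<open>The sign in \<open>dv\<close> can be moved to the argument, so it does not affect the
  image.\<close>

lemma Vi_eq: "Vi q p = vM q p ` carrier (DM (Suc q) p)"
proof -
  have s: "sg (DM q p) p (vM q p x) = vM q p (sg (DM (Suc q) p) p x)" if "x \<in> carrier (DM (Suc q) p)" for x
    by (rule sg_nat[OF vM_lin Nq.module_CM Nq.module_CM that, symmetric])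
  have "vM q p x \<in> Vi q p" if x: "x \<in> carrier (DM (Suc q) p)" for x
  proof -
    let ?y = "sg (DM (Suc q) p) p x"
    have y: "?y \<in> carrier (DM (Suc q) p)" by (rule sg_closed[OF Nq.module_CM x])
    have "sg (DM (Suc q) p) p ?y = x" using sg_sg[OF Nq.module_CM x, of p p] by (simp add: sg_def)
    then have "dv (int p) (1 + int q) ?y = vM q p x" using s[OF y] by (simp add: dv_Suc)
    then show ?thesis unfolding Vi_def using y by (metis imageI)
  qed
  moreover have "dv (int p) (1 + int q) x \<in> vM q p ` carrier (DM (Suc q) p)" if "x \<in> carrier (DM (Suc q) p)" for x
    using s[OF that] sg_closed[OF Nq.module_CM that] by (simp add: dv_Suc)
  ultimately show ?thesis unfolding Vi_def by blast
qed

text \<open>As in \<open>clM_onto\<close>, preimages under the boundaries in the intersections are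
  chosen on each chain of the nerve separately.\<close>

lemma Vi_iff:
  assumes "u \<in> carrier (DM q p)" shows "u \<in> Vi q p \<longleftrightarrow> (\<forall>\<tau>\<in>chains N p. u \<tau> \<in> bdX q (hd \<tau>))"
proof
  assume "u \<in> Vi q p"
  then obtain x where "x \<in> carrier (DM (Suc q) p)" "u = vM q p x" unfolding Vi_eq by blast
  then show "\<forall>\<tau>\<in>chains N p. u \<tau> \<in> bdX q (hd \<tau>)"
    by (auto simp: vM_def chmap_def chain_mod_eq_pi_mod[of N] Gq_def boundaries_def)
next
  assume "\<forall>\<tau>\<in>chains N p. u \<tau> \<in> bdX q (hd \<tau>)"
  then have "\<forall>\<tau>. \<exists>v. \<tau> \<in> chains N p \<longrightarrow> v \<in> carrier (Gq (Suc q) (hd \<tau>)) \<and> u \<tau> = bX q (hd \<tau>) v"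
    unfolding boundaries_def Gq_def by blast
  then obtain v where v: "\<And>\<tau>. \<tau> \<in> chains N p \<Longrightarrow> v \<tau> \<in> carrier (Gq (Suc q) (hd \<tau>)) \<and> u \<tau> = bX q (hd \<tau>) (v \<tau>)" by metis
  let ?x = "\<lambda>\<tau>. if \<tau> \<in> chains N p then v \<tau> else undefined"
  have "?x \<in> carrier (DM (Suc q) p)" using v by (simp add: chain_mod_eq_pi_mod[of N])
  moreover have "vM q p ?x = u" using v assms by (intro ext) (simp add: vM_def chmap_def chain_mod_eq_pi_mod[of N])
  ultimately show "u \<in> Vi q p" unfolding Vi_eq by blast
qed

lemma clM_zero_iff:
  assumes "x \<in> carrier (ZM q p)" shows "clM q p x = \<zero>\<^bsub>HM q p\<^esub> \<longleftrightarrow> x \<in> Vi q p"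
proof -
  have z: "cl q (hd \<tau>) (x \<tau>) = \<zero>\<^bsub>Hq q (hd \<tau>)\<^esub> \<longleftrightarrow> x \<tau> \<in> bdX q (hd \<tau>)" if "\<tau> \<in> chains N p" for \<tau>
    unfolding cl_def Hq_eq
    by (rule subquot.quot_eq_zero_iff[OF subquotX[OF chains_hd[OF that]]]) (use assms that in \<open>simp add: ZM_iff\<close>)
  have "clM q p x = \<zero>\<^bsub>HM q p\<^esub> \<longleftrightarrow> (\<forall>\<tau>\<in>chains N p. cl q (hd \<tau>) (x \<tau>) = \<zero>\<^bsub>Hq q (hd \<tau>)\<^esub>)"
    unfolding chain_mod_zero_iff[OF lin_maps_closed[OF clM_lin assms]] by (simp add: chmap_def)
  then show ?thesis using Vi_iff[OF ZM_D[OF assms]] z by simp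
qed

text \<open>Vertical boundaries are closed under negation; this adapts the condition of
  \<open>A2_iff\<close>, which is phrased as a vanishing sum.\<close>

lemma plus_Vi_iff:
  assumes "u \<in> carrier (DM q p)"
  shows "(\<exists>x'\<in>carrier (DM (Suc q) p). u \<oplus>\<^bsub>DM q p\<^esub> dv (int p) (1 + int q) x' = \<zero>\<^bsub>DM q p\<^esub>) \<longleftrightarrow> u \<in> Vi q p"
proof -
  interpret M: module R "DM q p" by (rule Nq.module_CM)
  have "(\<exists>v\<in>Vi q p. u \<oplus>\<^bsub>DM q p\<^esub> v = \<zero>\<^bsub>DM q p\<^esub>) \<longleftrightarrow> u \<in> Vi q p"
  proof
    assume "\<exists>v\<in>Vi q p. u \<oplus>\<^bsub>DM q p\<^esub> v = \<zero>\<^bsub>DM q p\<^esub>"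
    then obtain v where v: "v \<in> Vi q p" "u \<oplus>\<^bsub>DM q p\<^esub> v = \<zero>\<^bsub>DM q p\<^esub>" by blast
    have "v \<in> carrier (DM q p)" using v(1) Vi(1) by blast
    then have "u = \<ominus>\<^bsub>DM q p\<^esub> v" using v(2) assms M.minus_equality by metis
    then show "u \<in> Vi q p" using Vi(5)[OF v(1)] by simp
  next
    assume "u \<in> Vi q p"
    then have "\<ominus>\<^bsub>DM q p\<^esub> u \<in> Vi q p" by (rule Vi(5))
    then show "\<exists>v\<in>Vi q p. u \<oplus>\<^bsub>DM q p\<^esub> v = \<zero>\<^bsub>DM q p\<^esub>" using M.r_neg[OF assms] by blast
  qed
  then show ?thesis unfolding Vi_def by blast
qed

text \<open>By \<open>A2_iff\<close> the left side asks for a vertical cycle whose horizontal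
  boundary is a vertical boundary. Since \<open>clM\<close> kills exactly the vertical boundaries
  and commutes with the horizontal differential, this means that the class is a cycle.\<close>

lemma A2_nat:
  "x \<in> dc.fc.A 2 (int p) (int q) \<longleftrightarrow> x \<in> carrier (ZM q p) \<and> clM q p x \<in> cycles N (Hq q) (Hm q) p"
proof -
  have "x \<in> dc.fc.A 2 (int p) (int q) \<longleftrightarrow> x \<in> carrier (ZM q p) \<and>
     (\<exists>x'\<in>carrier (D (int p - 1) (int q + 1)). dh (int p) (int q) x \<oplus>\<^bsub>D (int p - 1) (int q)\<^esub> dv (int p - 1) (int q + 1) x' = \<zero>\<^bsub>D (int p - 1) (int q)\<^esub>)"
    (is "_ \<longleftrightarrow> _ \<and> ?E")
    unfolding dc.A2_iff D_nat using dv_zero_iff ZM_D by blast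
  moreover have "?E \<longleftrightarrow> clM q p x \<in> cycles N (Hq q) (Hm q) p" if x: "x \<in> carrier (ZM q p)"
  proof (cases p)
    \<comment> \<open>Column -1 is zero, so the condition holds trivially, as does the one for
      cycles of degree 0.\<close>
    case 0
    have "clM q 0 x \<in> carrier (HM q 0)" using lin_maps_closed[OF clM_lin] x 0 by blast
    then show ?thesis using dc.zero_closed[of "-1"] dc.zero_add(1)[OF dc.zero_closed, of "-1" "int q"]
      by (auto simp: 0 cycles_def dh_def dv_def)
  next
    case (Suc k)
    have x': "x \<in> carrier (ZM q (Suc k))" using x Suc by simp
    have "clM q (Suc k) x \<in> cycles N (Hq q) (Hm q) (Suc k) \<longleftrightarrow> clM q k (bN q k x) = \<zero>\<^bsub>HM q k\<^esub>"
      using lin_maps_closed[OF clM_lin x'] by (simp add: cycles_def clM_bN[OF x'])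
    also have "\<dots> \<longleftrightarrow> bN q k x \<in> Vi q k" by (rule clM_zero_iff[OF bN_ZM[OF x']])
    finally show ?thesis using plus_Vi_iff[OF ZM_D[OF bN_ZM[OF x']]]
      by (simp add: Suc dh_Suc D_nat add.commute[of _ 1])
  qed
  ultimately show ?thesis by blast
qed

text \<open>By \<open>B2_iff\<close> the left side asks that \<open>x\<close> differ by a vertical
  boundary from the horizontal boundary of a vertical cycle \<open>y\<close>. The map
  \<open>clM\<close> removes the vertical boundary, and by \<open>clM_onto\<close> the classes of
  such \<open>y\<close> are all chains of the homology sheaf.\<close>

lemma B2_nat:
  assumes x: "x \<in> carrier (ZM q p)"
  shows "x \<in> dc.fc.B 2 (int p) (int q) \<longleftrightarrow> clM q p x \<in> boundaries N (Hq q) (Hm q) p"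
proof -
  interpret M: module R "DM q p" by (rule Nq.module_CM)
  interpret H: module R "HM q p" by (rule Hs.module_CM)
  note xD = ZM_D[OF x]
  have "x \<in> dc.fc.B 2 (int p) (int q) \<longleftrightarrow> (\<exists>y\<in>carrier (DM q (Suc p)). \<exists>y'\<in>carrier (DM (Suc q) p).
     dv (int (Suc p)) (int q) y = \<zero>\<^bsub>D (int (Suc p)) (int q - 1)\<^esub> \<and> x = bN q p y \<oplus>\<^bsub>DM q p\<^esub> dv (int p) (1 + int q) y')"
    unfolding dc.B2_iff by (simp add: dh_Suc D_nat add.commute[of _ 1])
  also have "\<dots> \<longleftrightarrow> (\<exists>y\<in>carrier (ZM q (Suc p)). \<exists>v\<in>Vi q p. x = bN q p y \<oplus>\<^bsub>DM q p\<^esub> v)"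
    unfolding Vi_def using dv_zero_iff ZM_D by blast
  also have "\<dots> \<longleftrightarrow> (\<exists>y\<in>carrier (ZM q (Suc p)). x \<ominus>\<^bsub>DM q p\<^esub> bN q p y \<in> Vi q p)"
  proof (rule bex_cong[OF refl])
    fix y assume y: "y \<in> carrier (ZM q (Suc p))"
    have b: "bN q p y \<in> carrier (DM q p)" by (rule ZM_D[OF bN_ZM[OF y]])
    show "(\<exists>v\<in>Vi q p. x = bN q p y \<oplus>\<^bsub>DM q p\<^esub> v) \<longleftrightarrow> x \<ominus>\<^bsub>DM q p\<^esub> bN q p y \<in> Vi q p"
    proof
      assume "\<exists>v\<in>Vi q p. x = bN q p y \<oplus>\<^bsub>DM q p\<^esub> v"
      then obtain v where v: "v \<in> Vi q p" "x = bN q p y \<oplus>\<^bsub>DM q p\<^esub> v" by blast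
      have "v \<in> carrier (DM q p)" using v(1) Vi(1) by blast
      then have "x \<ominus>\<^bsub>DM q p\<^esub> bN q p y = v"
        using b v(2) M.a_comm[of "bN q p y" v] by (simp add: a_minus_def M.a_assoc M.r_neg)
      then show "x \<ominus>\<^bsub>DM q p\<^esub> bN q p y \<in> Vi q p" using v(1) by simp
    next
      assume "x \<ominus>\<^bsub>DM q p\<^esub> bN q p y \<in> Vi q p"
      moreover have "x = bN q p y \<oplus>\<^bsub>DM q p\<^esub> (x \<ominus>\<^bsub>DM q p\<^esub> bN q p y)"
        using M.minus_plus_cancel[OF xD b] M.a_comm[OF b M.minus_closed[OF xD b]] by simp
      ultimately show "\<exists>v\<in>Vi q p. x = bN q p y \<oplus>\<^bsub>DM q p\<^esub> v" by blast
    qed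
  qed
  also have "\<dots> \<longleftrightarrow> (\<exists>y\<in>carrier (ZM q (Suc p)). clM q p x = bdry N (Hq q) (Hm q) p (clM q (Suc p) y))"
  proof (rule bex_cong[OF refl])
    fix y assume y: "y \<in> carrier (ZM q (Suc p))"
    have b: "bN q p y \<in> carrier (ZM q p)" by (rule bN_ZM[OF y])
    interpret Z: module R "ZM q p" by (rule Zs.module_CM)
    have "x \<ominus>\<^bsub>DM q p\<^esub> bN q p y \<in> carrier (ZM q p)" using Z.minus_closed[OF x b] by (simp add: ZM_minus[OF b])
    then have "x \<ominus>\<^bsub>DM q p\<^esub> bN q p y \<in> Vi q p \<longleftrightarrow> clM q p (x \<ominus>\<^bsub>ZM q p\<^esub> bN q p y) = \<zero>\<^bsub>HM q p\<^esub>"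
      using clM_zero_iff by (simp add: ZM_minus[OF b])
    also have "\<dots> \<longleftrightarrow> clM q p x = clM q p (bN q p y)"
      using lin_maps_closed[OF clM_lin x] lin_maps_closed[OF clM_lin b]
      by (simp add: lin_maps_minus[OF clM_lin Zs.module_CM Hs.module_CM x b] H.minus_eq_zero_iff)
    finally show "x \<ominus>\<^bsub>DM q p\<^esub> bN q p y \<in> Vi q p \<longleftrightarrow> clM q p x = bdry N (Hq q) (Hm q) p (clM q (Suc p) y)"
      by (simp add: clM_bN[OF y])
  qed
  also have "\<dots> \<longleftrightarrow> clM q p x \<in> boundaries N (Hq q) (Hm q) p"
    unfolding boundaries_def using clM_onto[of _ q "Suc p"] lin_maps_closed[OF clM_lin, of _ q "Suc p"] by blast
  finally show ?thesis .
qed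

text \<open>The graph of \<open>clM\<close> on \<open>A 2\<close> serves as the additive relation.
  Every cycle is reached by \<open>clM_onto\<close> and \<open>A2_nat\<close>, and
  \<open>B2_nat\<close> makes the two kinds of boundaries correspond in both directions.\<close>

lemma E2_iso: "mod_iso R (dc.fc.page 2 (int p) (int q)) (HS N (Hq q) (Hm q) p)"
proof -
  let ?A = "dc.fc.A 2 (int p) (int q)" and ?B = "dc.fc.B 2 (int p) (int q)"
  let ?C = "cycles N (Hq q) (Hm q) p" and ?D = "boundaries N (Hq q) (Hm q) p"
  let ?L = "(\<lambda>x. (x, clM q p x)) ` ?A"
  have S: "subquot R (DM q p) ?A ?B" using dc.fc.page_subquot[of "int p" "int q" 2 2] by (simp add: D_nat)
  have H: "subquot R (HM q p) ?C ?D" by (rule Hs.HS_subquot)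
  have AZ: "x \<in> carrier (ZM q p)" if "x \<in> ?A" for x using that A2_nat by blast
  have L: "subquot_rel R (DM q p) ?A ?B (HM q p) ?C ?D ?L"
  proof (intro subquot_rel.intro subquot_rel_axioms.intro S H)
    show "?L \<subseteq> ?A \<times> ?C" using A2_nat by blast
    show "a \<in> ?A \<Longrightarrow> \<exists>b. (a, b) \<in> ?L" for a by blast
    show "(a, b) \<in> ?L \<Longrightarrow> a \<in> ?B \<Longrightarrow> b \<in> ?D" for a b using B2_nat AZ by blast
    show "(a \<oplus>\<^bsub>DM q p\<^esub> a', b \<oplus>\<^bsub>HM q p\<^esub> b') \<in> ?L" if "(a,b) \<in> ?L" "(a',b') \<in> ?L" for a b a' b'
    proof -
      have a: "a \<in> ?A" "a' \<in> ?A" "b = clM q p a" "b' = clM q p a'" using that by auto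
      then show ?thesis using lin_maps_add[OF clM_lin AZ[OF a(1)] AZ[OF a(2)]] subquot.A(3)[OF S a(1,2)]
        by (simp add: ZM_ops image_iff)
    qed
    show "(r \<odot>\<^bsub>DM q p\<^esub> a, r \<odot>\<^bsub>HM q p\<^esub> b) \<in> ?L" if "r \<in> carrier R" "(a,b) \<in> ?L" for r a b
    proof -
      have a: "a \<in> ?A" "b = clM q p a" using that by auto
      then show ?thesis using lin_maps_smult[OF clM_lin that(1) AZ[OF a(1)]] subquot.A(4)[OF S that(1) a(1)]
        by (simp add: ZM_ops image_iff)
    qed
  qed
  have "mod_iso R (quot_mod (DM q p) ?A ?B) (quot_mod (HM q p) ?C ?D)"
  proof (rule subquot_rel.qmap_iso[OF L])
    fix b assume b: "b \<in> ?C"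
    then have "b \<in> carrier (HM q p)" using subquot.A_carrier[OF H] by blast
    then obtain x where "x \<in> carrier (ZM q p)" "clM q p x = b" using clM_onto by blast
    then show "\<exists>a. (a, b) \<in> ?L" using b A2_nat by blast
  next
    show "(a, b) \<in> ?L \<Longrightarrow> b \<in> ?D \<Longrightarrow> a \<in> ?B" for a b using B2_nat AZ by blast
  qed
  then show ?thesis by (simp add: dc.fc.page_def HS_def D_nat)
qed

lemma converges:
  "converging_ss R dc.fc.page dc.fc.dpage (\<lambda>p q. HS N (Hq q) (Hm q) p) (\<lambda>n. HS P F rho n)"
  using adc.converging_augmented[of "\<lambda>p q. HS N (Hq q) (Hm q) p", OF E2_iso] by (simp add: HS_eq)

end

theorem theorem2:
  fixes R :: "'r ring" and P :: "'a::order set"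
    and F :: "'a \<Rightarrow> ('r,'m) module" and rho :: "'a \<Rightarrow> 'a \<Rightarrow> 'm \<Rightarrow> 'm"
    and K :: "'k set" and Pa :: "'k \<Rightarrow> 'a set"
  assumes "cring R"
    and "finite P"
    and "is_sheaf R P F rho"
    and "finite K"
    and "\<forall>\<alpha>\<in>K. upper_convex P (Pa \<alpha>)"
    and "P = (\<Union>\<alpha>\<in>K. Pa \<alpha>)"
  shows "\<exists>(E :: nat \<Rightarrow> int \<Rightarrow> int \<Rightarrow> ('r, ('k set list \<Rightarrow> 'a list \<Rightarrow> 'm) set) module) d.
           converging_ss R E d
             (\<lambda>p q. HS (nerve K Pa) (Hsheaf Pa F rho q) (Hsheaf_map Pa F rho q) p)
             (\<lambda>n. HS P F rho n)"
proof -
  interpret covering R P F rho K Pa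
    by (intro covering.intro covering_axioms.intro poset_sheaf.intro) (use assms in auto)
  show ?thesis using converges by blast
qed

end
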